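(* Let $\lambda,\mu>0$, $\alpha\in\mathbb{R}$, and $q_-<x_1<0<q_+$. Let $W^1,W^2$ be two independent standard Wiener processes, and let $(\xi_\varepsilon)_{\varepsilon>0}$ be a family of real random variables, independent of $(W^1,W^2)$, converging in distribution as $\varepsilon\to0$ to a random variable $\xi_0$ that is not concentrated at $0$. For each $\varepsilon>0$ let $X_\varepsilon=(X^1_\varepsilon,X^2_\varepsilon)$ be the strong solution of \[ dX^1_\varepsilon(t)=\lambda X^1_\varepsilon(t)\,dt+\varepsilon\, dW^1(t),\qquad dX^2_\varepsilon(t)=-\mu X^2_\varepsilon(t)\,dt+\varepsilon\, dW^2(t),\qquad t\ge 0, \] with $X^1_\varepsilon(0)=x_1$ and $X^2_\varepsilon(0)=\varepsilon^\alpha\xi_\varepsilon$. Let $\tau_\varepsilon=\inf\{t\ge0: X^1_\varepsilon(t)\in\{q_-,q_+\}\}$ and $C_\varepsilon=\{X^1_\varepsilon(\tau_\varepsilon)=q_+\}$. Let $V,N,\xi$ be independent random variables such that $V$ is standard exponential ($\mathsf{P}\{V\ge x\}=e^{-x}$ for $x\ge0$), $N$ is standard Gaussian, and $\xi$ is distributed as $\xi_0$. Let $\beta=\min\{1,\ 2\mu/\lambda+\alpha\}$. Then, as $\varepsilon\to0$, \[ \mathsf{Law}\left[\frac{X^2_\varepsilon(\tau_\varepsilon)}{\varepsilon^\beta}\ \Big|\ C_\varepsilon\right]\Rightarrow\mathsf{Law}\left[\mathbf{1}_{\beta=\frac{2\mu}{\lambda}+\alpha}\,\frac{V^{\mu/\lambda}\,\xi}{(2\lambda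 q_+|x_1|)^{\mu/\lambda}}+\mathbf{1}_{\beta=1}\,\frac{N}{\sqrt{2\mu}}\right]. \]
   Context: $\mathsf{Law}[Y\mid A]$ denotes the conditional distribution of $Y$ given an event $A$ of positive probability, and $\Rightarrow$ denotes weak convergence of probability measures. $\mathbf{1}_{\beta=c}$ equals $1$ if $\beta=c$ and $0$ otherwise. *)

theory Defs
  imports "HOL-Probability.Probability"
begin

section \<open>Weak convergence along a filter\<close>

text \<open>The library's \<^const>\<open>weak_conv_m\<close> covers sequences only; here the parameter may be
  continuous. The two lemmas below relate the two notions.\<close>

definition weak_conv_along ::
  "'i filter \<Rightarrow> ('i \<Rightarrow> 'a::topological_space measure) \<Rightarrow> 'a measure \<Rightarrow> bool" where
  "weak_conv_along F P Q \<longleftrightarrow>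
     (\<forall>f :: 'a \<Rightarrow> real. continuous_on UNIV f \<and> bounded (range f) \<longrightarrow>
        ((\<lambda>i. \<integral>x. f x \<partial>P i) \<longlongrightarrow> (\<integral>x. f x \<partial>Q)) F)"

lemma weak_conv_along_sequentially:
  assumes P: "\<And>n. real_distribution (P n)" and Q: "real_distribution Q"
  shows "weak_conv_along sequentially P Q \<longleftrightarrow> weak_conv_m P Q"
proof
  assume L: "weak_conv_along sequentially P Q"
  show "weak_conv_m P Q"
  proof (rule integral_bdd_continuous_conv_imp_weak_conv[OF P Q])
    fix f :: "real \<Rightarrow> real"
    assume "\<And>x. isCont f x" "\<And>x. \<bar>f x\<bar> \<le> 1"
    then have "continuous_on UNIV f" "bounded (range f)"
      by (auto simp: continuous_at_imp_continuous_on bounded_iff)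
    with L show "(\<lambda>n. integral\<^sup>L (P n) f) \<longlonglongrightarrow> integral\<^sup>L Q f"
      by (simp add: weak_conv_along_def)
  qed
next
  assume R: "weak_conv_m P Q"
  show "weak_conv_along sequentially P Q"
    unfolding weak_conv_along_def
  proof (intro allI impI, elim conjE)
    fix f :: "real \<Rightarrow> real"
    assume f: "continuous_on UNIV f" "bounded (range f)"
    then obtain B where "\<And>x. norm (f x) \<le> B"
      by (auto simp: bounded_iff)
    moreover have "isCont f x" for x
      using f(1) by (simp add: continuous_on_eq_continuous_at)
    ultimately show "(\<lambda>n. integral\<^sup>L (P n) f) \<longlonglongrightarrow> integral\<^sup>L Q f"
      using weak_conv_imp_integral_bdd_continuous_conv[OF P Q R] by blast
  qed
qed

lemma weak_conv_along_at_right_0: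
  fixes P :: "real \<Rightarrow> 'a::topological_space measure"
  shows "weak_conv_along (at_right 0) P Q \<longleftrightarrow>
    (\<forall>e. (\<forall>n. e n > 0) \<and> e \<longlonglongrightarrow> 0 \<longrightarrow> weak_conv_along sequentially (\<lambda>n. P (e n)) Q)"
  unfolding weak_conv_along_def tendsto_at_iff_sequentially comp_def
  by (auto simp: less_le)

section \<open>Conditional laws and independence\<close>

text \<open>\<^const>\<open>uniform_measure\<close> \<open>M A\<close> is the conditional measure given \<open>A\<close>; this is meaningful only
  for an event \<open>A\<close> of positive probability.\<close>

definition cond_law :: "'w measure \<Rightarrow> 'w set \<Rightarrow> ('w \<Rightarrow> real) \<Rightarrow> real measure" where
  "cond_law M A Y = distr (uniform_measure M A) borel Y"

text \<open>As \<^const>\<open>prob_space.indep_var\<close>, but the two random elements may have different types.\<close>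

definition indep_elements ::
  "'w measure \<Rightarrow> 'a measure \<Rightarrow> ('w \<Rightarrow> 'a) \<Rightarrow> 'b measure \<Rightarrow> ('w \<Rightarrow> 'b) \<Rightarrow> bool" where
  "indep_elements M S Y T Z \<longleftrightarrow>
     Y \<in> measurable M S \<and> Z \<in> measurable M T \<and>
     prob_space.indep_set M {Y -` A \<inter> space M | A. A \<in> sets S} {Z -` B \<inter> space M | B. B \<in> sets T}"

section \<open>Processes with time set \<open>{0..}\<close>\<close>

text \<open>Values of a process at negative times are never used.\<close>

definition sample_path :: "(real \<Rightarrow> 'w \<Rightarrow> 'a) \<Rightarrow> 'w \<Rightarrow> real \<Rightarrow> 'a" where
  "sample_path Y \<omega> = (\<lambda>t\<in>{0..}. Y t \<omega>)"

definition path_space :: "(real \<Rightarrow> 'a::topological_space) measure" where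
  "path_space = (\<Pi>\<^sub>M t\<in>{0..}. borel)"

definition standard_wiener :: "'w measure \<Rightarrow> (real \<Rightarrow> 'w \<Rightarrow> real) \<Rightarrow> bool" where
  "standard_wiener M W \<longleftrightarrow>
     (\<forall>t\<ge>0. W t \<in> borel_measurable M) \<and>
     (AE \<omega> in M. W 0 \<omega> = 0) \<and>
     (\<forall>s t. 0 \<le> s \<and> s < t \<longrightarrow>
        distributed M lborel (\<lambda>\<omega>. W t \<omega> - W s \<omega>) (normal_density 0 (sqrt (t - s)))) \<and>
     (\<forall>(n::nat) t. 0 \<le> t 0 \<and> (\<forall>i<n. t i \<le> t (Suc i)) \<longrightarrow>
        prob_space.indep_vars M (\<lambda>_. borel) (\<lambda>i \<omega>. W (t (Suc i)) \<omega> - W (t i) \<omega>) {..<n}) \<and>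
     (AE \<omega> in M. continuous_on {0..} (\<lambda>t. W t \<omega>))"

text \<open>The value is \<open>\<infinity>\<close> if the set is never hit.\<close>

definition hitting_time :: "(real \<Rightarrow> 'w \<Rightarrow> 'a) \<Rightarrow> 'a set \<Rightarrow> 'w \<Rightarrow> ereal" where
  "hitting_time Y S \<omega> = Inf (ereal ` {t. 0 \<le> t \<and> Y t \<omega> \<in> S})"

section \<open>Stochastic differential equations with additive noise\<close>

text \<open>The filtration generated by the initial value and the driving process, augmented by the
  null sets of \<open>M\<close>.\<close>

definition driving_filtration ::
  "'w measure \<Rightarrow> ('w \<Rightarrow> 'a::topological_space) \<Rightarrow> (real \<Rightarrow> 'w \<Rightarrow> 'a) \<Rightarrow> real \<Rightarrow> 'w measure" where
  "driving_filtration M Y0 W t =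
     sigma (space M)
       ({Y0 -` A \<inter> space M | A. A \<in> sets borel} \<union>
        {W s -` A \<inter> space M | s A. 0 \<le> s \<and> s \<le> t \<and> A \<in> sets borel} \<union>
        null_sets M)"

text \<open>A strong solution of \<open>dX = b(X) dt + \<sigma> dW\<close> with \<open>X(0) = Y0\<close>, where \<open>\<sigma>\<close> is a constant scalar.
  As \<open>W(0) = 0\<close> almost surely, the stochastic integral of the constant \<open>\<sigma>\<close> over \<open>[0,t]\<close> is
  \<open>\<sigma> W(t)\<close>.\<close>

definition strong_solution ::
  "'w measure \<Rightarrow> ('a \<Rightarrow> 'a::euclidean_space) \<Rightarrow> real \<Rightarrow> (real \<Rightarrow> 'w \<Rightarrow> 'a) \<Rightarrow> ('w \<Rightarrow> 'a)
     \<Rightarrow> (real \<Rightarrow> 'w \<Rightarrow> 'a) \<Rightarrow> bool" where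
  "strong_solution M b \<sigma> W Y0 X \<longleftrightarrow>
     (\<forall>t\<ge>0. X t \<in> borel_measurable (driving_filtration M Y0 W t)) \<and>
     (\<forall>\<omega>\<in>space M. continuous_on {0..} (\<lambda>t. X t \<omega>)) \<and>
     (AE \<omega> in M. X 0 \<omega> = Y0 \<omega>) \<and>
     (AE \<omega> in M. \<forall>t\<ge>0. (\<lambda>s. b (X s \<omega>)) absolutely_integrable_on {0..t} \<and>
        X t \<omega> = X 0 \<omega> + integral {0..t} (\<lambda>s. b (X s \<omega>)) + \<sigma> *\<^sub>R W t \<omega>)"

end

theory Submission
  imports Defs "HOL-Real_Asymp.Real_Asymp"
begin

text \<open>
  The idea of the proof. Write \<open>\<epsilon>\<close> for the noise level, \<open>X\<^sup>1\<close> for the unstable and \<open>X\<^sup>2\<close> for the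
  stable coordinate, \<open>\<tau>\<close> for the exit time and \<open>C\<close> for the event of exit at \<open>q\<^sub>+\<close>. The event \<open>C\<close> is
  rare: the path has to climb from \<open>x\<^sub>1 < 0\<close> over the unstable point \<open>0\<close>, which has a probability of
  order \<open>\<epsilon> exp (-\<lambda> x\<^sub>1\<^sup>2 / \<epsilon>\<^sup>2)\<close>. Everything rests on the law of \<open>\<tau>\<close> given such an event.

  \<^item> Law of the exit time. The discounted coordinate \<open>exp (-\<lambda> t) X\<^sup>1(t)\<close> converges to a Gaussian
  variable \<open>Y\<close> with mean \<open>x\<^sub>1\<close> and variance \<open>\<epsilon>\<^sup>2 / (2 \<lambda>)\<close>, and on \<open>C\<close> it satisfies
  \<open>Y = exp (-\<lambda> \<tau>) (q\<^sub>+ + \<epsilon> N')\<close>, where \<open>N'\<close> comes from the noise after \<open>\<tau>\<close> and is independent of the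
  past. So \<open>C\<close> is the event \<open>Y > 0\<close> up to an error that is exponentially small compared with its
  probability, and \<open>exp (-\<lambda> \<tau>) q\<^sub>+\<close> is \<open>Y\<close> up to a factor close to \<open>1\<close>. The event that the path leaves at \<open>q\<^sub>-\<close> first and that \<open>Y > 0\<close> nevertheless is negligible,
  because \<open>|q\<^sub>-| > |x\<^sub>1|\<close>. A Gaussian variable conditioned to exceed a level \<open>s\<close> overshoots it by
  an exponential variable divided by \<open>s\<close>. Hence \<open>2 \<lambda> |x\<^sub>1| q\<^sub>+ \<epsilon>\<^sup>-\<^sup>2 exp (-\<lambda> \<tau>)\<close> given \<open>C\<close> converges to a
  standard exponential variable \<open>V\<close> (\<open>overshoot_tail\<close>, \<open>exit_bounds\<close>, \<open>gauss_tail_ratio\<close>,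
  \<open>exit_time_law\<close>).

  \<^item> Position of the stable coordinate. The pair \<open>(\<tau>, C)\<close> depends on \<open>W\<^sup>1\<close> only, and
  \<open>X\<^sup>2(t) = exp (-\<mu> t) \<epsilon>\<^sup>\<alpha> \<xi> + \<epsilon> H(t)\<close> with \<open>H(t)\<close> Gaussian of variance
  \<open>(1 - exp (-2 \<mu> t)) / (2 \<mu>)\<close> and independent of \<open>\<xi>\<close>, both independent of \<open>W\<^sup>1\<close>. So the exit time may
  be treated as a constant that is averaged afterwards (\<open>exit_position_integral\<close>). Since
  \<open>exp (-\<mu> \<tau>)\<close> is close to \<open>(\<epsilon>\<^sup>2 V / (2 \<lambda> |x\<^sub>1| q\<^sub>+))\<close> to the power \<open>\<mu> / \<lambda>\<close>, the first term has order
  \<open>\<epsilon>\<close> to the power \<open>2 \<mu> / \<lambda> + \<alpha>\<close> and the second has order \<open>\<epsilon>\<close>; the larger of the two, or both,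
  survive the division by \<open>\<epsilon>\<^sup>\<beta>\<close>. Skorohod's theorem turns the weak convergence of the law of \<open>V\<close> and
  of \<open>\<xi>\<close> into pointwise convergence, and dominated convergence concludes (\<open>mixture_limit\<close>,
  \<open>conditional_exit_limit\<close>).

  The noise is additive, so the equation can be read path by path, and the Gaussian variables above
  appear as limits of weighted sums of increments of the Wiener process
  (\<open>linear_equation_riemann_sum\<close>). The strong Markov property at \<open>\<tau>\<close> is obtained by rounding \<open>\<tau>\<close>
  up to a finite grid, where it becomes the independence of finitely many increments.
\<close>

section \<open>Linear equations driven by a continuous path\<close>

text \<open>The integrating factor turns the equation into \<open>d(exp (-b t) x) = e exp (-b t) dw\<close>. On a
  cell of the grid the two increments differ by an amount that is small compared with the length of
  the cell, because \<open>x\<close> is uniformly continuous; these errors are added up. The bound is uniform in the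
  starting index \<open>k\<close>, so that one grid serves all the values of a rounded exit time.\<close>

lemma linear_equation_riemann_sum:
  fixes x w :: "real \<Rightarrow> real"
  assumes T: "0 \<le> T" and cont: "continuous_on {0..T} x"
    and eq: "\<And>t. t \<in> {0..T} \<Longrightarrow> x t = x 0 + integral {0..t} (\<lambda>s. b * x s) + e * w t"
    and \<eta>: "0 < \<eta>"
  shows "\<forall>\<^sub>F n in sequentially. \<forall>k\<le>n.
    \<bar>exp (- b * T) * x T - exp (- b * (T * real k / real n)) * x (T * real k / real n)
      - e * (\<Sum>i=k..<n. exp (- b * (T * real i / real n))
               * (w (T * real (Suc i) / real n) - w (T * real i / real n)))\<bar> \<le> \<eta>"
proof -
  obtain B where B: "\<And>t. t \<in> {0..T} \<Longrightarrow> \<bar>x t\<bar> \<le> B" "0 < B"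
  proof -
    have "bounded (x ` {0..T})"
      by (intro compact_imp_bounded compact_continuous_image cont) auto
    then show ?thesis using that unfolding bounded_pos by (metis imageI real_norm_def)
  qed
  define K where "K = exp (\<bar>b\<bar> * T)"
  have K: "0 < K" by (simp add: K_def)
  define \<eta>' where "\<eta>' = \<eta> / (2 * (K * \<bar>b\<bar> * T + 1))"
  have den: "0 < K * \<bar>b\<bar> * T + 1" using K T by (simp add: add_nonneg_pos)
  have \<eta>': "0 < \<eta>'" using \<eta> den by (simp add: \<eta>'_def)
  have \<eta>'2: "K * \<bar>b\<bar> * T * \<eta>' \<le> \<eta> / 2"
  proof -
    have "K * \<bar>b\<bar> * T * \<eta>' \<le> (K * \<bar>b\<bar> * T + 1) * \<eta>'" using \<eta>' by (simp add: algebra_simps)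
    also have "\<dots> = \<eta> / 2" using den by (simp add: \<eta>'_def field_simps)
    finally show ?thesis .
  qed
  have "uniformly_continuous_on {0..T} x"
    by (intro compact_uniformly_continuous cont) auto
  then obtain d where d: "0 < d" "\<And>s t. s \<in> {0..T} \<Longrightarrow> t \<in> {0..T} \<Longrightarrow> \<bar>t - s\<bar> < d \<Longrightarrow> \<bar>x t - x s\<bar> < \<eta>'"
    unfolding uniformly_continuous_on_def dist_real_def using \<eta>' by meson
  have "(\<lambda>n::nat. T / real n) \<longlonglongrightarrow> 0" by real_asymp
  then have ev1: "\<forall>\<^sub>F n in sequentially. T / real n < d"
    using d(1) by (rule order_tendstoD)
  have "(\<lambda>n::nat. K * B * (real n * \<bar>exp (- b * T / real n) - 1 + b * T / real n\<bar>)) \<longlonglongrightarrow> 0"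
  proof -
    define c where "c = b * T"
    have "(\<lambda>n::nat. real n * (exp (- c / real n) - 1 + c / real n)) \<longlonglongrightarrow> 0"
      by real_asymp
    then have "(\<lambda>n::nat. K * B * \<bar>real n * (exp (- c / real n) - 1 + c / real n)\<bar>) \<longlonglongrightarrow> K * B * 0"
      by (intro tendsto_mult tendsto_const tendsto_rabs_zero)
    then show ?thesis by (simp add: abs_mult c_def)
  qed
  then have ev2: "\<forall>\<^sub>F n in sequentially. K * B * (real n * \<bar>exp (- b * T / real n) - 1 + b * T / real n\<bar>) < \<eta> / 2"
    using \<eta> by (intro order_tendstoD(2)) auto
  show ?thesis
    using ev1 ev2 eventually_gt_at_top[of 0]
  proof (eventually_elim, intro allI impI)
    fix n k :: nat
    assume n1: "T / real n < d" and n2: "K * B * (real n * \<bar>exp (- b * T / real n) - 1 + b * T / real n\<bar>) < \<eta> / 2"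
      and n0: "0 < n" and k: "k \<le> n"
    define h where "h = T / real n"
    define r where "r i = T * real i / real n" for i :: nat
    define f where "f i = exp (- b * r i) * x (r i)" for i
    define q where "q = \<bar>exp (- b * h) - 1 + b * h\<bar>"
    have h: "0 \<le> h" using T by (simp add: h_def)
    have rS: "r (Suc i) = r i + h" for i by (simp add: r_def h_def field_simps add_divide_distrib)
    have r0: "0 \<le> r i" for i using T by (simp add: r_def)
    have rT: "r i \<le> T" if "i \<le> n" for i
      using that T n0 by (simp add: r_def divide_le_eq mult_left_mono)
    have rn: "r n = T" using n0 by (simp add: r_def)
    have err: "\<bar>f (Suc i) - f i - e * (exp (- b * r i) * (w (r (Suc i)) - w (r i)))\<bar>
        \<le> K * (\<bar>b\<bar> * \<eta>' * h + B * q)" if i: "i < n" for i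
    proof -
      have in1: "r i \<in> {0..T}" "r (Suc i) \<in> {0..T}" using r0 rT i by auto
      have le: "r i \<le> r (Suc i)" using rS h by simp
      have int: "(\<lambda>s. b * x s) integrable_on {0..r (Suc i)}"
        by (intro integrable_continuous_interval continuous_intros continuous_on_subset[OF cont]) (use in1 in auto)
      have "integral {0..r i} (\<lambda>s. b * x s) + integral {r i..r (Suc i)} (\<lambda>s. b * x s) = integral {0..r (Suc i)} (\<lambda>s. b * x s)"
        by (rule Henstock_Kurzweil_Integration.integral_combine) (use in1 le int in auto)
      then have dx: "x (r (Suc i)) - x (r i) = integral {r i..r (Suc i)} (\<lambda>s. b * x s) + e * (w (r (Suc i)) - w (r i))"
        using eq[OF in1(1)] eq[OF in1(2)] by (simp add: algebra_simps)
      let ?J = "integral {r i..r (Suc i)} (\<lambda>s. b * (x s - x (r (Suc i))))"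
      have ints: "(\<lambda>s. b * x s) integrable_on {r i..r (Suc i)}"
        by (intro integrable_continuous_interval continuous_intros continuous_on_subset[OF cont]) (use in1 in auto)
      have J: "?J = integral {r i..r (Suc i)} (\<lambda>s. b * x s) - b * h * x (r (Suc i))"
      proof -
        have "?J = integral {r i..r (Suc i)} (\<lambda>s. b * x s - b * x (r (Suc i)))"
          by (simp add: algebra_simps)
        also have "\<dots> = integral {r i..r (Suc i)} (\<lambda>s. b * x s) - integral {r i..r (Suc i)} (\<lambda>s. b * x (r (Suc i)))"
          by (rule Henstock_Kurzweil_Integration.integral_diff) (use ints in auto)
        also have "integral {r i..r (Suc i)} (\<lambda>s. b * x (r (Suc i))) = b * h * x (r (Suc i))"
          using le by (simp add: rS h)
        finally show ?thesis .
      qed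
      have Jb: "\<bar>?J\<bar> \<le> \<bar>b\<bar> * \<eta>' * h"
      proof -
        have "norm ?J \<le> (\<bar>b\<bar> * \<eta>') * (r (Suc i) - r i)"
        proof (rule integral_bound)
          show "r i \<le> r (Suc i)" by fact
          show "continuous_on {r i..r (Suc i)} (\<lambda>s. b * (x s - x (r (Suc i))))"
            by (intro continuous_intros continuous_on_subset[OF cont]) (use in1 in auto)
          fix s assume s: "s \<in> {r i..r (Suc i)}"
          have "\<bar>x s - x (r (Suc i))\<bar> < \<eta>'"
          proof (rule d(2))
            show "\<bar>s - r (Suc i)\<bar> < d" using s rS[of i] n1 h by (simp add: h_def)
          qed (use s in1 in auto)
          then show "norm (b * (x s - x (r (Suc i)))) \<le> \<bar>b\<bar> * \<eta>'"
            by (simp add: abs_mult mult_left_mono)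
        qed
        then show ?thesis by (simp add: rS)
      qed
      \<comment> \<open>The error of a cell has two sources: the oscillation of \<open>x\<close> and the second-order term of \<open>exp\<close>.\<close>
      have "f (Suc i) = exp (- b * r i) * (exp (- b * h) * x (r (Suc i)))"
        by (simp add: f_def rS algebra_simps flip: exp_add)
      then have "f (Suc i) - f i - e * (exp (- b * r i) * (w (r (Suc i)) - w (r i)))
          = exp (- b * r i) * (exp (- b * h) * x (r (Suc i)) - x (r i) - e * (w (r (Suc i)) - w (r i)))"
        by (simp add: f_def algebra_simps)
      also have "exp (- b * h) * x (r (Suc i)) - x (r i) - e * (w (r (Suc i)) - w (r i))
          = ?J + (exp (- b * h) - 1 + b * h) * x (r (Suc i))"
        using dx J by (simp add: algebra_simps)
      finally have "\<bar>f (Suc i) - f i - e * (exp (- b * r i) * (w (r (Suc i)) - w (r i)))\<bar>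
          = exp (- b * r i) * \<bar>?J + (exp (- b * h) - 1 + b * h) * x (r (Suc i))\<bar>"
        by (simp add: abs_mult)
      also have "\<dots> \<le> K * (\<bar>b\<bar> * \<eta>' * h + q * B)"
      proof (rule mult_mono)
        have "- b * r i \<le> \<bar>b\<bar> * T"
          by (rule order_trans[OF mult_mono[of "-b" "\<bar>b\<bar>" "r i" "r i"]])
             (use in1 r0 in \<open>auto intro!: mult_left_mono\<close>)
        then show "exp (- b * r i) \<le> K" by (simp add: K_def)
        have "\<bar>?J + (exp (- b * h) - 1 + b * h) * x (r (Suc i))\<bar> \<le> \<bar>?J\<bar> + \<bar>exp (- b * h) - 1 + b * h\<bar> * \<bar>x (r (Suc i))\<bar>"
          by (metis abs_mult abs_triangle_ineq)
        also have "\<dots> \<le> \<bar>b\<bar> * \<eta>' * h + q * B"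
          unfolding q_def by (intro add_mono Jb mult_left_mono B in1) auto
        finally show "\<bar>?J + (exp (- b * h) - 1 + b * h) * x (r (Suc i))\<bar> \<le> \<bar>b\<bar> * \<eta>' * h + q * B" .
      qed (use K in auto)
      finally show ?thesis by (simp add: algebra_simps)
    qed
    have tel: "f n - f k = (\<Sum>i=k..<n. f (Suc i) - f i)"
      using sum_Suc_diff'[of k n f] k by simp
    have "\<bar>f n - f k - e * (\<Sum>i=k..<n. exp (- b * r i) * (w (r (Suc i)) - w (r i)))\<bar>
       = \<bar>\<Sum>i=k..<n. f (Suc i) - f i - e * (exp (- b * r i) * (w (r (Suc i)) - w (r i)))\<bar>"
      unfolding tel by (simp add: sum_subtractf sum_distrib_left)
    also have "\<dots> \<le> (\<Sum>i=k..<n. K * (\<bar>b\<bar> * \<eta>' * h + B * q))"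
      by (rule order_trans[OF sum_abs sum_mono]) (use err in auto)
    also have "\<dots> = real (n - k) * (K * (\<bar>b\<bar> * \<eta>' * h + B * q))" by simp
    also have "\<dots> \<le> real n * (K * (\<bar>b\<bar> * \<eta>' * h + B * q))"
      by (rule mult_right_mono) (use K B \<eta>' h in \<open>auto simp: q_def\<close>)
    also have "\<dots> = K * \<bar>b\<bar> * (real n * h) * \<eta>' + K * B * (real n * q)" by (simp add: algebra_simps)
    also have "real n * h = T" using n0 by (simp add: h_def)
    also have "K * \<bar>b\<bar> * T * \<eta>' + K * B * (real n * q) \<le> \<eta> / 2 + \<eta> / 2"
      using \<eta>'2 n2 by (intro add_mono) (auto simp: q_def h_def)
    finally have "\<bar>f n - f k - e * (\<Sum>i=k..<n. exp (- b * r i) * (w (r (Suc i)) - w (r i)))\<bar> \<le> \<eta>"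
      by simp
    then show "\<bar>exp (- b * T) * x T - exp (- b * (T * real k / real n)) * x (T * real k / real n)
      - e * (\<Sum>i=k..<n. exp (- b * (T * real i / real n))
               * (w (T * real (Suc i) / real n) - w (T * real i / real n)))\<bar> \<le> \<eta>"
      unfolding f_def rn unfolding r_def .
  qed
qed

section \<open>Increments of a Wiener process\<close>

lemma (in prob_space) wiener_weighted_increments_normal:
  assumes W: "standard_wiener M W"
    and u: "0 \<le> u 0" "\<And>i. i < n \<Longrightarrow> u i < u (Suc i)"
    and k: "k < n" and c: "\<And>i. c i \<noteq> 0"
  shows "distributed M lborel (\<lambda>\<omega>. \<Sum>i=k..<n. c i * (W (u (Suc i)) \<omega> - W (u i) \<omega>))
    (normal_density 0 (sqrt (\<Sum>i=k..<n. (c i)\<^sup>2 * (u (Suc i) - u i))))"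
proof -
  have u0: "0 \<le> u i" if "i \<le> n" for i
    using that
  proof (induction i)
    case (Suc i)
    then show ?case using u(2)[of i] by simp
  qed (use u in simp)
  have norm1: "distributed M lborel (\<lambda>\<omega>. c i * (W (u (Suc i)) \<omega> - W (u i) \<omega>))
      (normal_density 0 (\<bar>c i\<bar> * sqrt (u (Suc i) - u i)))" if "i < n" for i
  proof -
    have "distributed M lborel (\<lambda>\<omega>. W (u (Suc i)) \<omega> - W (u i) \<omega>) (normal_density 0 (sqrt (u (Suc i) - u i)))"
      using W u(2)[OF that] u0[of i] that unfolding standard_wiener_def by auto
    from normal_density_affine[OF this, of "c i" 0] show ?thesis
      using u(2)[OF that] c by simp
  qed
  have "indep_vars (\<lambda>_. borel) (\<lambda>i \<omega>. W (u (Suc i)) \<omega> - W (u i) \<omega>) {..<n}"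
  proof -
    have "\<forall>i<n. u i \<le> u (Suc i)" using u(2) by (simp add: less_imp_le)
    then show ?thesis using W u(1) unfolding standard_wiener_def by blast
  qed
  then have "indep_vars (\<lambda>_. borel) (\<lambda>i \<omega>. c i * (W (u (Suc i)) \<omega> - W (u i) \<omega>)) {..<n}"
    by (rule indep_vars_compose2) auto
  then have ind: "indep_vars (\<lambda>_. borel) (\<lambda>i \<omega>. c i * (W (u (Suc i)) \<omega> - W (u i) \<omega>)) {k..<n}"
    by (rule indep_vars_subset) auto
  have "distributed M lborel (\<lambda>\<omega>. \<Sum>i=k..<n. c i * (W (u (Suc i)) \<omega> - W (u i) \<omega>))
      (normal_density (\<Sum>i=k..<n. 0) (sqrt (\<Sum>i=k..<n. (\<bar>c i\<bar> * sqrt (u (Suc i) - u i))\<^sup>2)))"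
    by (rule sum_indep_normal[OF _ _ ind]) (use k u c norm1 in auto)
  also have "(\<Sum>i=k..<n. (\<bar>c i\<bar> * sqrt (u (Suc i) - u i))\<^sup>2) = (\<Sum>i=k..<n. (c i)\<^sup>2 * (u (Suc i) - u i))"
    using u(2) by (intro sum.cong) (auto simp: power_mult_distrib less_imp_le)
  finally show ?thesis by simp
qed

text \<open>Up to null sets the past is generated by cylinder events, and these are stable under
  intersection. As \<open>W 0 = 0\<close> almost surely, a cylinder event is a statement about finitely many increments
  before \<open>t\<close>, which are independent of the later ones. Dynkin's argument does the rest.\<close>

lemma (in prob_space) wiener_past_indep_future:
  assumes W: "standard_wiener M W"
    and t: "0 \<le> t" "t \<le> u k" and u: "\<And>i. k \<le> i \<Longrightarrow> i < n \<Longrightarrow> u i \<le> u (Suc i)"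
    and k: "k \<le> n"
    and A: "A \<in> sets (driving_filtration M (\<lambda>_. y) W t)" and D: "D \<in> sets borel"
  shows "prob (A \<inter> {\<omega>\<in>space M. (\<Sum>i=k..<n. c i * (W (u (Suc i)) \<omega> - W (u i) \<omega>)) \<in> D})
    = prob A * prob {\<omega>\<in>space M. (\<Sum>i=k..<n. c i * (W (u (Suc i)) \<omega> - W (u i) \<omega>)) \<in> D}"
proof -
  define Z where "Z \<omega> = (\<Sum>i=k..<n. c i * (W (u (Suc i)) \<omega> - W (u i) \<omega>))" for \<omega>
  define E where "E = {\<omega>\<in>space M. Z \<omega> \<in> D}"
  have u0: "0 \<le> u i" if "k \<le> i" "i \<le> n" for i
    using that(2,1)
  proof (induction i)
    case (Suc i)
    then show ?case using u[of i] t by (cases "k = Suc i") auto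
  qed (use t in auto)
  have Wm[measurable]: "W s \<in> borel_measurable M" if "0 \<le> s" for s
    using W that unfolding standard_wiener_def by auto
  have Zm[measurable]: "Z \<in> borel_measurable M"
    unfolding Z_def by (intro borel_measurable_sum borel_measurable_times borel_measurable_diff Wm u0) auto
  have Em[measurable]: "E \<in> events" using D unfolding E_def by measurable
  define G where "G = {A\<in>events. \<exists>J B. finite J \<and> J \<subseteq> {0..t} \<and> (\<forall>r\<in>J. B r \<in> sets (borel :: real measure))
      \<and> (AE \<omega> in M. \<omega> \<in> A \<longleftrightarrow> (\<forall>r\<in>J. W r \<omega> \<in> B r))}"
  have cyl: "prob (A \<inter> E) = prob A * prob E" if "A \<in> G" for A
  proof -
    from that obtain J B where J: "finite J" "J \<subseteq> {0..t}" "\<And>r. r \<in> J \<Longrightarrow> B r \<in> sets (borel :: real measure)"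
      and AE: "AE \<omega> in M. \<omega> \<in> A \<longleftrightarrow> (\<forall>r\<in>J. W r \<omega> \<in> B r)" and Am[measurable]: "A \<in> events"
      unfolding G_def by auto
    define l where "l = sorted_list_of_set (insert 0 (insert t J))"
    define L where "L = length l"
    have fin: "finite (insert 0 (insert t J))" using J by auto
    have setl: "set l = insert 0 (insert t J)" unfolding l_def by (rule set_sorted_list_of_set[OF fin])
    have srt: "sorted l" unfolding l_def by simp
    have L0: "0 < L" using setl unfolding L_def by (cases l) auto
    have l0: "l ! 0 = 0"
    proof -
      have "0 \<in> set l" using setl by auto
      then obtain j where "j < length l" "l ! j = 0" by (auto simp: in_set_conv_nth)
      then have "l ! 0 \<le> 0" using sorted_nth_mono[OF srt, of 0 j] by simp
      moreover have "l ! 0 \<in> set l" using L0 unfolding L_def by auto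
      ultimately show ?thesis using setl J t by auto
    qed
    have lt: "l ! j \<le> t" "0 \<le> l ! j" if "j < L" for j
    proof -
      have "l ! j \<in> set l" using that unfolding L_def by auto
      then show "l ! j \<le> t" "0 \<le> l ! j" using setl J t by auto
    qed
    define m where "m = n - k"
    \<comment> \<open>One grid holds the times \<open>l\<close> of the cylinder event and the times \<open>u\<close> of the future. The increment with index \<open>L - 1\<close>, from \<open>t\<close> to \<open>u k\<close>, belongs to neither group.\<close>
    define v where "v i = (if i < L then l ! i else u (k + (i - L)))" for i
    have v: "0 \<le> v 0" "\<forall>i<L+m. v i \<le> v (Suc i)"
    proof -
      show "0 \<le> v 0" using l0 L0 by (simp add: v_def)
      show "\<forall>i<L+m. v i \<le> v (Suc i)"
      proof (intro allI impI)
        fix i assume i: "i < L + m"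
        consider "Suc i < L" | "Suc i = L" | "L \<le> i" by linarith
        then show "v i \<le> v (Suc i)"
        proof cases
          case 1
          then show ?thesis using srt by (simp add: v_def L_def sorted_nth_mono)
        next
          case 2
          then show ?thesis using lt[of i] t by (simp add: v_def)
        next
          case 3
          then show ?thesis using u[of "k + (i - L)"] i k by (simp add: v_def m_def Suc_diff_le)
        qed
      qed
    qed
    define inc where "inc i \<omega> = W (v (Suc i)) \<omega> - W (v i) \<omega>" for i \<omega>
    have ind: "indep_vars (\<lambda>_. borel) inc {..<L+m}"
      using W v unfolding standard_wiener_def inc_def by blast
    obtain idx where idx: "\<And>r. r \<in> J \<Longrightarrow> idx r < L \<and> l ! (idx r) = r"
    proof -
      have "\<forall>r\<in>J. \<exists>j. j < L \<and> l ! j = r" using setl unfolding L_def by (simp add: in_set_conv_nth[symmetric])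
      then have "\<exists>f. \<forall>r\<in>J. f r < L \<and> l ! f r = r" by (rule bchoice)
      then show ?thesis using that by blast
    qed
    let ?A = "{..<L-1}" and ?B = "{L..<L+m}"
    let ?PA = "PiM ?A (\<lambda>_. borel) :: (nat \<Rightarrow> real) measure" and ?PB = "PiM ?B (\<lambda>_. borel) :: (nat \<Rightarrow> real) measure"
    have iv: "indep_var ?PA (\<lambda>\<omega>. restrict (\<lambda>i. inc i \<omega>) ?A) ?PB (\<lambda>\<omega>. restrict (\<lambda>i. inc i \<omega>) ?B)"
      by (rule indep_var_restrict[OF ind]) auto
    define SA where "SA = {f\<in>space ?PA. \<forall>r\<in>J. (\<Sum>i<idx r. f i) \<in> B r}"
    define SB where "SB = {f\<in>space ?PB. (\<Sum>i=k..<n. c i * f (L + (i - k))) \<in> D}"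
    have SA: "SA \<in> sets ?PA"
    proof -
      have "{f\<in>space ?PA. (\<Sum>i<idx r. f i) \<in> B r} \<in> sets ?PA" if r: "r \<in> J" for r
      proof -
        have m: "(\<lambda>f. \<Sum>i<idx r. f i) \<in> borel_measurable ?PA"
          by (intro borel_measurable_sum measurable_component_singleton) (use idx[OF r] in auto)
        show ?thesis using measurable_sets[OF m J(3)[OF r]] by (simp add: vimage_def Int_def conj_commute)
      qed
      then show ?thesis unfolding SA_def using J(1) by (intro sets.sets_Collect_finite_All) auto
    qed
    have SB: "SB \<in> sets ?PB"
    proof -
      have m: "(\<lambda>f. \<Sum>i=k..<n. c i * f (L + (i - k))) \<in> borel_measurable ?PB"
        by (intro borel_measurable_sum borel_measurable_times borel_measurable_const measurable_component_singleton)
           (auto simp: m_def)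
      show ?thesis unfolding SB_def using measurable_sets[OF m D] by (simp add: vimage_def Int_def conj_commute)
    qed
    have Zeq: "Z \<omega> = (\<Sum>i=k..<n. c i * inc (L + (i - k)) \<omega>)" for \<omega>
    proof -
      have "inc (L + (i - k)) \<omega> = W (u (Suc i)) \<omega> - W (u i) \<omega>" if "k \<le> i" for i
      proof -
        have "v (L + (i - k)) = u i" "v (Suc (L + (i - k))) = u (Suc i)"
          using that by (auto simp: v_def)
        then show ?thesis by (simp add: inc_def)
      qed
      then show ?thesis unfolding Z_def by (intro sum.cong) auto
    qed
    have tele: "(\<Sum>i<j. inc i \<omega>) = W (l ! j) \<omega> - W 0 \<omega>" if "j < L" for j \<omega>
    proof -
      have "(\<Sum>i<j. inc i \<omega>) = W (v j) \<omega> - W (v 0) \<omega>"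
        unfolding inc_def by (rule sum_lessThan_telescope)
      then show ?thesis using that L0 l0 by (simp add: v_def)
    qed
    let ?X = "\<lambda>\<omega>. restrict (\<lambda>i. inc i \<omega>) ?A" and ?Y = "\<lambda>\<omega>. restrict (\<lambda>i. inc i \<omega>) ?B"
    have W0: "AE \<omega> in M. W 0 \<omega> = 0" using W unfolding standard_wiener_def by auto
    have XA: "?X -` SA \<inter> space M = {\<omega>\<in>space M. \<forall>r\<in>J. (\<Sum>i<idx r. inc i \<omega>) \<in> B r}"
    proof -
      have "(\<Sum>i<idx r. ?X \<omega> i) = (\<Sum>i<idx r. inc i \<omega>)" if "r \<in> J" for r \<omega>
        using idx[OF that] by (intro sum.cong) auto
      then show ?thesis unfolding SA_def by (auto simp: space_PiM)
    qed
    have YB: "?Y -` SB \<inter> space M = E"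
    proof -
      have "(\<Sum>i=k..<n. c i * ?Y \<omega> (L + (i - k))) = Z \<omega>" for \<omega>
        unfolding Zeq by (intro sum.cong) (auto simp: m_def)
      then show ?thesis unfolding SB_def E_def by (auto simp: space_PiM)
    qed
    have mXY: "?X -` SA \<inter> space M \<in> events" "?Y -` SB \<inter> space M \<in> events"
      using measurable_sets[OF indep_var_rv1[OF iv] SA] measurable_sets[OF indep_var_rv2[OF iv] SB] by auto
    have AE': "AE \<omega> in M. \<omega> \<in> A \<longleftrightarrow> \<omega> \<in> ?X -` SA \<inter> space M"
      using AE W0 AE_space
    proof eventually_elim
      case (elim \<omega>)
      have "(\<Sum>i<idx r. inc i \<omega>) = W r \<omega>" if "r \<in> J" for r
        using tele[of "idx r" \<omega>] idx[OF that] elim(2) by simp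
      then show ?case unfolding XA using elim by simp
    qed
    have "prob (A \<inter> E) = prob ((?X -` SA \<inter> space M) \<inter> E)"
      by (rule measure_eq_AE) (use AE' mXY in auto)
    also have "(?X -` SA \<inter> space M) \<inter> E = (\<lambda>x. (?X x, ?Y x)) -` (SA \<times> SB) \<inter> space M"
      unfolding YB[symmetric] by auto
    also have "prob \<dots> = prob (?X -` SA \<inter> space M) * prob (?Y -` SB \<inter> space M)"
      by (rule indep_varD[OF iv SA SB])
    also have "prob (?X -` SA \<inter> space M) = prob A"
      by (rule measure_eq_AE) (use AE' mXY in auto)
    finally show ?thesis unfolding YB .
  qed
  have "indep_set (sigma_sets (space M) G) (sigma_sets (space M) {E})"
  proof (rule indep_set_sigma_sets)
    show "indep_set G {E}"
    proof (rule indep_setI)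
      show "G \<subseteq> events" by (auto simp: G_def)
      show "{E} \<subseteq> events" using Em by simp
    qed (use cyl in simp)
    show "Int_stable {E}" by (auto simp: Int_stable_def)
    show "Int_stable G"
    proof (rule Int_stableI)
      fix A A' assume "A \<in> G" "A' \<in> G"
      then obtain J B J' B' where *: "finite J" "J \<subseteq> {0..t}" "\<forall>r\<in>J. B r \<in> sets (borel :: real measure)"
          "AE \<omega> in M. \<omega> \<in> A \<longleftrightarrow> (\<forall>r\<in>J. W r \<omega> \<in> B r)" "A \<in> events"
          "finite J'" "J' \<subseteq> {0..t}" "\<forall>r\<in>J'. B' r \<in> sets (borel :: real measure)"
          "AE \<omega> in M. \<omega> \<in> A' \<longleftrightarrow> (\<forall>r\<in>J'. W r \<omega> \<in> B' r)" "A' \<in> events"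
        unfolding G_def by blast
      let ?B = "\<lambda>r. (if r \<in> J then B r else UNIV) \<inter> (if r \<in> J' then B' r else UNIV)"
      have "AE \<omega> in M. \<omega> \<in> A \<inter> A' \<longleftrightarrow> (\<forall>r\<in>J \<union> J'. W r \<omega> \<in> ?B r)"
        using *(4,9) by eventually_elim auto
      moreover have "\<forall>r\<in>J \<union> J'. ?B r \<in> sets borel" using *(3,8) by (simp add: sets.Int)
      ultimately show "A \<inter> A' \<in> G" unfolding G_def using *
        by (intro CollectI conjI exI[of _ "J \<union> J'"] exI[of _ ?B]) simp_all
    qed
  qed
  moreover have "A \<in> sigma_sets (space M) G"
  proof -
    have "sets (driving_filtration M (\<lambda>_. y) W t) = sigma_sets (space M)
       ({(\<lambda>_. y) -` A \<inter> space M | A. A \<in> sets borel} \<union>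
        {W s -` A \<inter> space M | s A. 0 \<le> s \<and> s \<le> t \<and> A \<in> sets borel} \<union> null_sets M)"
      unfolding driving_filtration_def
      by (intro sets_measure_of) (auto dest: sets.sets_into_space)
    moreover have "\<dots> \<subseteq> sigma_sets (space M) G"
    proof (rule sigma_sets_mono', intro Un_least subsetI)
      fix T assume "T \<in> {(\<lambda>_. y) -` A \<inter> space M | A. A \<in> sets borel}"
      then obtain S where S: "T = (\<lambda>_. y) -` S \<inter> space M" by auto
      show "T \<in> G"
      proof (cases "y \<in> S")
        case True
        then have "T = space M" using S by auto
        then show ?thesis
          unfolding G_def by (intro CollectI conjI exI[of _ "{}"]) simp_all
      next
        case False
        then have "T = {}" using S by auto
        then show ?thesis using t(1)
          unfolding G_def by (intro CollectI conjI exI[of _ "{0}"] exI[of _ "\<lambda>_. {}"]) simp_all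
      qed
    next
      fix T assume "T \<in> {W s -` A \<inter> space M | s A. 0 \<le> s \<and> s \<le> t \<and> A \<in> sets borel}"
      then obtain s S where *: "T = W s -` S \<inter> space M" "0 \<le> s" "s \<le> t" "S \<in> sets borel" by auto
      then have "T \<in> events" using Wm by (auto intro: measurable_sets)
      then show "T \<in> G" using *
        unfolding G_def by (intro CollectI conjI exI[of _ "{s}"] exI[of _ "\<lambda>_. S"]) simp_all
    next
      fix N assume N: "N \<in> null_sets M"
      then have "AE \<omega> in M. \<omega> \<notin> N" by (rule AE_not_in)
      then show "N \<in> G" using t(1) N
        unfolding G_def by (intro CollectI conjI exI[of _ "{0}"] exI[of _ "\<lambda>_. {}"]) auto
    qed
    ultimately show ?thesis using A by auto
  qed
  moreover have "E \<in> sigma_sets (space M) {E}" by auto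
  ultimately have "prob (A \<inter> E) = prob A * prob E" by (rule indep_setD)
  then show ?thesis unfolding E_def Z_def .
qed

section \<open>First hits of a level by a continuous path\<close>

text \<open>In contrast to a statement about the hitting time, this one mentions the path up to time \<open>t\<close>
  only, so that its adaptedness can be seen.\<close>

definition hits_first :: "(real \<Rightarrow> real) \<Rightarrow> real \<Rightarrow> real \<Rightarrow> real \<Rightarrow> bool" where
  "hits_first x a b t \<longleftrightarrow> (\<exists>s\<in>{0..t}. x s = a \<and> (\<forall>r\<in>{0..s}. x r \<noteq> b))"

lemma continuous_left_rational:
  fixes x :: "real \<Rightarrow> real"
  assumes cont: "continuous_on {0..} x" and s: "0 < s" and \<eta>: "0 < \<eta>"
  obtains r where "r \<in> \<rat>" "0 < r" "r < s" "\<bar>x r - x s\<bar> < \<eta>"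
proof -
  obtain d where d: "0 < d" "\<And>r. 0 \<le> r \<Longrightarrow> \<bar>r - s\<bar> < d \<Longrightarrow> \<bar>x r - x s\<bar> < \<eta>"
    using cont s \<eta> unfolding continuous_on_iff dist_real_def by (metis atLeast_iff less_imp_le)
  obtain r where "r \<in> \<rat>" "max 0 (s - d) < r" "r < s"
    using Rats_dense_in_real[of "max 0 (s - d)" s] d s by auto
  then show ?thesis using d(2)[of r] by (intro that) auto
qed

text \<open>Up to the hit the path stays at a positive distance from \<open>b\<close>, by compactness; conversely an
  accumulation point of times at which the path comes close to \<open>a\<close> is a hit. As the path is continuous,
  rational times suffice, and the event becomes a countable combination of events that concern
  single times.\<close>

lemma hits_first_rational:
  assumes cont: "continuous_on {0..} x"
  shows "hits_first x a b t \<longleftrightarrow>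
    (\<exists>j::nat. \<forall>m::nat. \<exists>r\<in>\<rat> \<inter> {0..t}. \<bar>x r - a\<bar> < 1 / Suc m \<and> (\<forall>q\<in>\<rat> \<inter> {0..r}. 1 / Suc j \<le> \<bar>x q - b\<bar>))"
    (is "_ \<longleftrightarrow> ?R")
proof
  assume "hits_first x a b t"
  then obtain s where s: "0 \<le> s" "s \<le> t" "x s = a" "\<And>r. 0 \<le> r \<Longrightarrow> r \<le> s \<Longrightarrow> x r \<noteq> b"
    unfolding hits_first_def by auto
  have "continuous_on {0..s} (\<lambda>r. \<bar>x r - b\<bar>)"
    by (intro continuous_intros continuous_on_subset[OF cont]) auto
  then obtain r0 where r0: "r0 \<in> {0..s}" "\<And>r. r \<in> {0..s} \<Longrightarrow> \<bar>x r0 - b\<bar> \<le> \<bar>x r - b\<bar>"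
    using continuous_attains_inf[of "{0..s}" "\<lambda>r. \<bar>x r - b\<bar>"] s(1) by auto
  have "0 < \<bar>x r0 - b\<bar>" using s(4)[of r0] r0(1) by auto
  then obtain j where j: "1 / real (Suc j) < \<bar>x r0 - b\<bar>"
    using nat_approx_posE by metis
  show ?R
  proof (intro exI[of _ j] allI)
    fix m :: nat
    obtain r where r: "r \<in> \<rat>" "0 \<le> r" "r \<le> s" "\<bar>x r - a\<bar> < 1 / Suc m"
    proof (cases "s = 0")
      case True
      then show ?thesis using s by (intro that[of 0]) auto
    next
      case False
      then obtain r where "r \<in> \<rat>" "0 < r" "r < s" "\<bar>x r - x s\<bar> < 1 / Suc m"
        using continuous_left_rational[OF cont, of s "1 / Suc m"] s by auto
      then show ?thesis using s by (intro that[of r]) auto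
    qed
    have "1 / Suc j \<le> \<bar>x q - b\<bar>" if "q \<in> \<rat> \<inter> {0..r}" for q
      using r0(2)[of q] j that r by auto
    then show "\<exists>r\<in>\<rat> \<inter> {0..t}. \<bar>x r - a\<bar> < 1 / Suc m \<and> (\<forall>q\<in>\<rat> \<inter> {0..r}. 1 / Suc j \<le> \<bar>x q - b\<bar>)"
      using r s by (intro bexI[of _ r]) auto
  qed
next
  assume ?R
  then obtain j where "\<forall>m::nat. \<exists>r\<in>\<rat> \<inter> {0..t}. \<bar>x r - a\<bar> < 1 / Suc m \<and> (\<forall>q\<in>\<rat> \<inter> {0..r}. 1 / Suc j \<le> \<bar>x q - b\<bar>)"
    by blast
  then obtain r where r: "\<And>m. r m \<in> {0..t}" "\<And>m::nat. \<bar>x (r m) - a\<bar> < 1 / Suc m"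
      "\<And>m q. q \<in> \<rat> \<Longrightarrow> 0 \<le> q \<Longrightarrow> q \<le> r m \<Longrightarrow> 1 / Suc j \<le> \<bar>x q - b\<bar>"
    unfolding Bex_def Ball_def by (auto simp: choice_iff)
  obtain s f where s: "s \<in> {0..t}" "strict_mono f" "(r \<circ> f) \<longlonglongrightarrow> s"
    using seq_compactE[OF compact_imp_seq_compact[OF compact_Icc[of 0 t]], of r] r(1) by blast
  have "(\<lambda>m. x (r (f m))) \<longlonglongrightarrow> x s"
    using continuous_on_tendsto_compose[OF cont s(3)] s(1) r(1) by (auto simp: comp_def)
  moreover have "(\<lambda>m. x (r (f m))) \<longlonglongrightarrow> a"
  proof -
    have "(\<lambda>m. x (r m) - a) \<longlonglongrightarrow> 0"
      by (rule tendsto_rabs_zero_cancel, rule tendsto_sandwich[of "\<lambda>_. 0" _ _ "\<lambda>m. 1 / Suc m"])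
         (use r(2) LIMSEQ_inverse_real_of_nat in \<open>auto simp: less_imp_le inverse_eq_divide\<close>)
    then have "(\<lambda>m. x (r m)) \<longlonglongrightarrow> a" by (simp add: LIM_zero_iff)
    then show ?thesis using LIMSEQ_subseq_LIMSEQ[OF _ s(2)] by (auto simp: comp_def)
  qed
  ultimately have xs: "x s = a" by (rule LIMSEQ_unique)
  have "x q \<noteq> b" if q: "q \<in> {0..s}" for q
  proof (cases "q = 0")
    case True
    then show ?thesis using r(3)[of 0 0] r(1)[of 0] by auto
  next
    case False
    show ?thesis
    proof
      assume xq: "x q = b"
      obtain p where p: "p \<in> \<rat>" "0 < p" "p < q" "\<bar>x p - x q\<bar> < 1 / Suc j"
        using continuous_left_rational[OF cont, of q "1 / Suc j"] False q by auto
      have "\<forall>\<^sub>F m in sequentially. p < (r \<circ> f) m"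
        using s(3) by (rule order_tendstoD) (use p q in auto)
      then obtain m where "p < r (f m)" by (auto simp: eventually_sequentially)
      then show False using r(3)[of p "f m"] p xq by auto
    qed
  qed
  then show "hits_first x a b t" unfolding hits_first_def using s(1) xs by (intro bexI[of _ s]) auto
qed

lemma hits_first_measurable:
  assumes X: "\<And>r. 0 \<le> r \<Longrightarrow> r \<le> t \<Longrightarrow> X r \<in> borel_measurable N"
    and cont: "\<And>\<omega>. \<omega> \<in> space N \<Longrightarrow> continuous_on {0..} (\<lambda>r. X r \<omega> :: real)"
  shows "{\<omega>\<in>space N. hits_first (\<lambda>r. X r \<omega>) a b t} \<in> sets N"
proof -
  have cr: "countable (\<rat> \<inter> A)" for A :: "real set" by (intro countable_Int1 countable_rat)
  have "{\<omega>\<in>space N. \<exists>j::nat. \<forall>m::nat. \<exists>r\<in>\<rat> \<inter> {0..t}.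
      \<bar>X r \<omega> - a\<bar> < 1 / Suc m \<and> (\<forall>q\<in>\<rat> \<inter> {0..r}. 1 / Suc j \<le> \<bar>X q \<omega> - b\<bar>)} \<in> sets N"
  proof (intro sets.sets_Collect_countable_Ex sets.sets_Collect_countable_All sets.sets_Collect_countable_Ex' cr)
    fix j m :: nat and r assume r: "r \<in> \<rat> \<inter> {0..t}"
    then have [measurable]: "X r \<in> borel_measurable N" using X by auto
    show "{\<omega>\<in>space N. \<bar>X r \<omega> - a\<bar> < 1 / Suc m \<and> (\<forall>q\<in>\<rat> \<inter> {0..r}. 1 / Suc j \<le> \<bar>X q \<omega> - b\<bar>)} \<in> sets N"
    proof (intro sets.sets_Collect_conj sets.sets_Collect_countable_All' cr)
      show "{\<omega>\<in>space N. \<bar>X r \<omega> - a\<bar> < 1 / Suc m} \<in> sets N" by measurable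
      fix q assume "q \<in> \<rat> \<inter> {0..r}"
      then have [measurable]: "X q \<in> borel_measurable N" using X r by auto
      show "{\<omega>\<in>space N. 1 / Suc j \<le> \<bar>X q \<omega> - b\<bar>} \<in> sets N" by measurable
    qed
  qed
  then show ?thesis by (simp add: hits_first_rational[OF cont] cong: conj_cong)
qed

text \<open>The set of times in \<open>{0..}\<close> at which a continuous path is in a closed set is closed, so the
  infimum is attained.\<close>

lemma hitting_time_cases:
  fixes Y :: "real \<Rightarrow> 'w \<Rightarrow> 'a::topological_space"
  assumes cont: "continuous_on {0..} (\<lambda>t. Y t \<omega>)" and S: "closed S"
  obtains (never) "hitting_time Y S \<omega> = \<infinity>" "\<And>t. 0 \<le> t \<Longrightarrow> Y t \<omega> \<notin> S"
  | (hit) s where "hitting_time Y S \<omega> = ereal s" "0 \<le> s" "Y s \<omega> \<in> S" "\<And>t. 0 \<le> t \<Longrightarrow> t < s \<Longrightarrow> Y t \<omega> \<notin> S"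
proof (cases "\<exists>t\<ge>0. Y t \<omega> \<in> S")
  case False
  then have "{t. 0 \<le> t \<and> Y t \<omega> \<in> S} = {}" by auto
  then have "hitting_time Y S \<omega> = \<infinity>" unfolding hitting_time_def by (simp only: image_empty Inf_empty top_ereal_def)
  then show ?thesis using False never by auto
next
  case True
  let ?A = "{t. 0 \<le> t \<and> Y t \<omega> \<in> S}"
  have "?A = {0..} \<inter> (\<lambda>t. Y t \<omega>) -` S" by auto
  moreover have "closed ({0..} \<inter> (\<lambda>t. Y t \<omega>) -` S)"
    by (rule continuous_closed_preimage[OF cont _ S]) auto
  ultimately have cl: "closed ?A" by simp
  have bd: "bdd_below ?A" by (auto intro: bdd_belowI[of _ 0])
  have inA: "Inf ?A \<in> ?A"
    by (rule closed_contains_Inf[OF _ bd cl]) (use True in auto)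
  have low: "Inf ?A \<le> t" if "t \<in> ?A" for t using cInf_lower[OF that bd] .
  have "hitting_time Y S \<omega> = ereal (Inf ?A)"
    unfolding hitting_time_def
    by (rule antisym) (use inA low in \<open>auto intro!: Inf_lower Inf_greatest\<close>)
  then show ?thesis using inA low hit[of "Inf ?A"] by force
qed

lemma hits_first_iff_hitting_time:
  fixes Y :: "real \<Rightarrow> 'w \<Rightarrow> real"
  assumes cont: "continuous_on {0..} (\<lambda>t. Y t \<omega>)" and ab: "a \<noteq> b"
  shows "hits_first (\<lambda>t. Y t \<omega>) a b t \<longleftrightarrow>
    hitting_time Y {a, b} \<omega> \<le> ereal t \<and> Y (real_of_ereal (hitting_time Y {a, b} \<omega>)) \<omega> = a"
proof (rule hitting_time_cases[where Y = Y and \<omega> = \<omega> and S = "{a, b}"])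
  show "continuous_on {0..} (\<lambda>t. Y t \<omega>)" by (rule cont)
next
  show "closed {a, b}" by auto
next
  assume "hitting_time Y {a, b} \<omega> = \<infinity>" "\<And>t. 0 \<le> t \<Longrightarrow> Y t \<omega> \<notin> {a, b}"
  then show ?thesis unfolding hits_first_def by auto
next
  fix s assume s: "hitting_time Y {a, b} \<omega> = ereal s" "0 \<le> s" "Y s \<omega> \<in> {a, b}" "\<And>t. 0 \<le> t \<Longrightarrow> t < s \<Longrightarrow> Y t \<omega> \<notin> {a, b}"
  show ?thesis
  proof
    assume "hits_first (\<lambda>t. Y t \<omega>) a b t"
    then obtain r where r: "0 \<le> r" "r \<le> t" "Y r \<omega> = a" "\<forall>q\<in>{0..r}. Y q \<omega> \<noteq> b"
      unfolding hits_first_def by auto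
    have "s \<le> r" using s(4)[of r] r by force
    then show "hitting_time Y {a, b} \<omega> \<le> ereal t \<and> Y (real_of_ereal (hitting_time Y {a, b} \<omega>)) \<omega> = a"
      using s r by auto
  next
    assume *: "hitting_time Y {a, b} \<omega> \<le> ereal t \<and> Y (real_of_ereal (hitting_time Y {a, b} \<omega>)) \<omega> = a"
    have "Y r \<omega> \<noteq> b" if "r \<in> {0..s}" for r
      using s(4)[of r] * s(1) ab that by (cases "r = s") auto
    then show "hits_first (\<lambda>t. Y t \<omega>) a b t"
      unfolding hits_first_def using s * by (intro bexI[of _ s]) auto
  qed
qed

section \<open>Solutions as limits of Gaussian sums\<close>

text \<open>One coordinate of the planar equation with its own noise. Adaptedness is not part of the notion:
  the adaptedness needed below is to the filtration of this one noise, and it follows from the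
  equation.\<close>

definition solves_linear ::
  "'w measure \<Rightarrow> real \<Rightarrow> real \<Rightarrow> (real \<Rightarrow> 'w \<Rightarrow> real) \<Rightarrow> (real \<Rightarrow> 'w \<Rightarrow> real) \<Rightarrow> bool" where
  "solves_linear M b e W X \<longleftrightarrow>
     (\<forall>t\<ge>0. X t \<in> borel_measurable M) \<and>
     (\<forall>\<omega>\<in>space M. continuous_on {0..} (\<lambda>t. X t \<omega>)) \<and>
     (AE \<omega> in M. \<forall>t\<ge>0. X t \<omega> = X 0 \<omega> + integral {0..t} (\<lambda>s. b * X s \<omega>) + e * W t \<omega>)"

lemma solves_linearD:
  assumes "solves_linear M b e W X"
  shows "\<And>t. 0 \<le> t \<Longrightarrow> X t \<in> borel_measurable M"
    and "\<And>\<omega>. \<omega> \<in> space M \<Longrightarrow> continuous_on {0..} (\<lambda>t. X t \<omega>)"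
    and "AE \<omega> in M. \<forall>t\<ge>0. X t \<omega> = X 0 \<omega> + integral {0..t} (\<lambda>s. b * X s \<omega>) + e * W t \<omega>"
  using assms unfolding solves_linear_def by blast+

text \<open>The left Riemann sum of the Wiener integral of \<open>exp (-b s)\<close> from the \<open>k\<close>th point of the uniform grid
  of \<open>{0..T}\<close> up to \<open>T\<close>; \<open>noise_var\<close> is its variance.\<close>

definition noise_sum :: "(real \<Rightarrow> 'w \<Rightarrow> real) \<Rightarrow> real \<Rightarrow> real \<Rightarrow> nat \<Rightarrow> nat \<Rightarrow> 'w \<Rightarrow> real" where
  "noise_sum W b T n k \<omega> =
     (\<Sum>i=k..<n. exp (- b * (T * real i / real n)) * (W (T * real (Suc i) / real n) \<omega> - W (T * real i / real n) \<omega>))"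

definition noise_var :: "real \<Rightarrow> real \<Rightarrow> nat \<Rightarrow> nat \<Rightarrow> real" where
  "noise_var b T n k = (\<Sum>i=k..<n. (exp (- b * (T * real i / real n)))\<^sup>2 * (T / real n))"

lemma exp_grid_square: "(exp (- b * (T * real i / real n)))\<^sup>2 = exp (- (2 * b * T) / real n) ^ i"
proof -
  have "(exp (- b * (T * real i / real n)))\<^sup>2 = exp (2 * (- b * (T * real i / real n)))"
    by (simp only: exp_double)
  also have "2 * (- b * (T * real i / real n)) = real i * (- (2 * b * T) / real n)" by simp
  also have "exp \<dots> = exp (- (2 * b * T) / real n) ^ i" by (rule exp_of_nat_mult)
  finally show ?thesis .
qed

lemma noise_sum_uniform:
  assumes X: "solves_linear M b e W X" and T: "0 \<le> T"
  shows "AE \<omega> in M. \<forall>\<eta>>0. \<forall>\<^sub>F n in sequentially. \<forall>k\<le>n.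
    \<bar>exp (- b * T) * X T \<omega> - exp (- b * (T * real k / real n)) * X (T * real k / real n) \<omega>
      - e * noise_sum W b T n k \<omega>\<bar> \<le> \<eta>"
proof -
  have "AE \<omega> in M. \<forall>t\<ge>0. X t \<omega> = X 0 \<omega> + integral {0..t} (\<lambda>s. b * X s \<omega>) + e * W t \<omega>"
    by (rule solves_linearD(3)[OF X])
  with AE_space show ?thesis
  proof eventually_elim
    case (elim \<omega>)
    have "continuous_on {0..T} (\<lambda>t. X t \<omega>)"
      by (rule continuous_on_subset[OF solves_linearD(2)[OF X elim(1)]]) auto
    moreover have "X t \<omega> = X 0 \<omega> + integral {0..t} (\<lambda>s. b * X s \<omega>) + e * W t \<omega>" if "t \<in> {0..T}" for t
      by (rule elim(2)[THEN spec, THEN mp]) (use that in simp)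
    ultimately show ?case
      unfolding noise_sum_def
      by (intro allI impI linear_equation_riemann_sum[OF T, of "\<lambda>t. X t \<omega>" b e "\<lambda>t. W t \<omega>"])
  qed
qed

lemma noise_sum_tendsto:
  assumes X: "solves_linear M b e W X" and T: "0 \<le> T"
  shows "AE \<omega> in M. (\<lambda>n. e * noise_sum W b T n 0 \<omega>) \<longlonglongrightarrow> exp (- b * T) * X T \<omega> - X 0 \<omega>"
  using noise_sum_uniform[OF assms]
proof eventually_elim
  case (elim \<omega>)
  show ?case
  proof (rule metric_LIMSEQ_I)
    fix r :: real assume "0 < r"
    have "\<forall>\<^sub>F n in sequentially. \<forall>k\<le>n.
      \<bar>exp (- b * T) * X T \<omega> - exp (- b * (T * real k / real n)) * X (T * real k / real n) \<omega>
      - e * noise_sum W b T n k \<omega>\<bar> \<le> r / 2" by (rule elim[THEN spec, THEN mp, OF half_gt_zero[OF \<open>0 < r\<close>]])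
    then have "\<forall>\<^sub>F n in sequentially. dist (e * noise_sum W b T n 0 \<omega>) (exp (- b * T) * X T \<omega> - X 0 \<omega>) < r"
    proof eventually_elim
      case (elim n)
      from elim[THEN spec, of 0] show ?case
        using \<open>0 < r\<close> unfolding dist_real_def by (simp add: abs_minus_commute)
    qed
    then show "\<exists>no. \<forall>n\<ge>no. dist (e * noise_sum W b T n 0 \<omega>) (exp (- b * T) * X T \<omega> - X 0 \<omega>) < r"
      by (simp add: eventually_sequentially)
  qed
qed

text \<open>A left Riemann sum of a decreasing function lies above its integral. So the variance of the
  noise after a grid point, rescaled to this point, is not bounded by \<open>1 / (2 * b)\<close>, but by a sum of a
  geometric series that tends to \<open>1 / (2 * b)\<close> as the grid is refined.\<close>

lemma noise_var_le:
  assumes b: "0 < b" and T: "0 < T" and k: "k \<le> n"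
  shows "(exp (b * (T * real k / real n)))\<^sup>2 * noise_var b T n k \<le> (T / real n) / (1 - exp (- 2 * b * T / real n))"
proof (cases "n = 0")
  case True
  then show ?thesis using k by (simp add: noise_var_def)
next
  case n: False
  define q where "q = exp (- 2 * b * T / real n)"
  have q: "0 < q" "q < 1" using b T n by (auto simp: q_def)
  have "(exp (b * (T * real k / real n)))\<^sup>2 * noise_var b T n k = (\<Sum>i=k..<n. q ^ (i - k) * (T / real n))"
    unfolding noise_var_def sum_distrib_left
  proof (rule sum.cong)
    fix i assume "i \<in> {k..<n}"
    then have i: "i = k + (i - k)" by simp
    have "(exp (- b * (T * real i / real n)))\<^sup>2 = q ^ k * q ^ (i - k)"
      unfolding exp_grid_square q_def by (subst i, subst power_add) simp
    moreover have "(exp (b * (T * real k / real n)))\<^sup>2 * q ^ k = 1"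
    proof -
      have "q ^ k = (exp (- b * (T * real k / real n)))\<^sup>2" unfolding exp_grid_square q_def by simp
      then show ?thesis by (simp add: power_mult_distrib[symmetric] exp_add[symmetric])
    qed
    ultimately have "(exp (b * (T * real k / real n)))\<^sup>2 * (exp (- b * (T * real i / real n)))\<^sup>2 = q ^ (i - k)"
      by (simp add: mult.assoc[symmetric])
    then show "(exp (b * (T * real k / real n)))\<^sup>2 * ((exp (- b * (T * real i / real n)))\<^sup>2 * (T / real n)) = q ^ (i - k) * (T / real n)"
      by (simp add: mult.assoc[symmetric])
  qed simp
  also have "\<dots> = (\<Sum>i=k..<n. q ^ (i - k)) * (T / real n)" by (rule sum_distrib_right[symmetric])
  also have "(\<Sum>i=k..<n. q ^ (i - k)) = (\<Sum>i<n - k. q ^ i)"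
    by (rule sum.reindex_bij_witness[of _ "\<lambda>i. i + k" "\<lambda>i. i - k"]) auto
  also have "\<dots> = (1 - q ^ (n - k)) / (1 - q)"
    using q sum_gp_strict[of q "n - k"] by simp
  also have "\<dots> * (T / real n) \<le> 1 / (1 - q) * (T / real n)"
    using q T by (intro mult_right_mono divide_right_mono) auto
  finally show ?thesis by (simp add: q_def mult.commute)
qed

lemma noise_var_tendsto:
  assumes b: "b \<noteq> 0" and T: "0 \<le> T"
  shows "(\<lambda>n. noise_var b T n 0) \<longlonglongrightarrow> (1 - exp (- 2 * b * T)) / (2 * b)"
proof (cases "T = 0")
  case True
  then show ?thesis by (simp add: noise_var_def)
next
  case False
  then have T: "0 < T" using T by simp
  have "\<forall>\<^sub>F n in sequentially. noise_var b T n 0 = (1 - exp (- 2 * b * T)) * ((T / real n) / (1 - exp (- (2 * b * T) / real n)))"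
    using eventually_gt_at_top[of 0]
  proof eventually_elim
    case (elim n)
    define q where "q = exp (- (2 * b * T) / real n)"
    have q: "q \<noteq> 1" using b T elim by (auto simp: q_def)
    have "noise_var b T n 0 = (\<Sum>i<n. q ^ i) * (T / real n)"
      unfolding noise_var_def sum_distrib_right atLeast0LessThan
      by (simp only: exp_grid_square q_def)
    also have "(\<Sum>i<n. q ^ i) = (1 - q ^ n) / (1 - q)"
      using q sum_gp_strict[of q n] by simp
    also have "q ^ n = exp (- 2 * b * T)"
      using elim by (simp add: q_def exp_of_nat_mult[symmetric])
    finally show ?case by (simp add: q_def)
  qed
  moreover have "(\<lambda>n. (1 - exp (- 2 * b * T)) * ((T / real n) / (1 - exp (- (2 * b * T) / real n))))
      \<longlonglongrightarrow> (1 - exp (- 2 * b * T)) * (1 / (2 * b))"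
  proof (rule tendsto_mult[OF tendsto_const])
    define c where "c = 2 * b * T"
    have c: "c \<noteq> 0" using b T by (simp add: c_def)
    have "((\<lambda>y::real. y / (1 - exp (- y))) \<longlongrightarrow> 1) (at 0)" by real_asymp
    moreover have "filterlim (\<lambda>n. c / real n) (at 0) sequentially"
    proof (rule filterlim_atI)
      show "(\<lambda>n. c / real n) \<longlonglongrightarrow> 0" by real_asymp
      show "\<forall>\<^sub>F n in sequentially. c / real n \<noteq> 0"
        using eventually_gt_at_top[of 0] by eventually_elim (use c in simp)
    qed
    ultimately have "(\<lambda>n. (c / real n) / (1 - exp (- (c / real n)))) \<longlonglongrightarrow> 1"
      by (rule filterlim_compose)
    then have "(\<lambda>n. T / c * ((c / real n) / (1 - exp (- (c / real n))))) \<longlonglongrightarrow> T / c * 1"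
      by (rule tendsto_mult[OF tendsto_const])
    then have "(\<lambda>n. (T / real n) / (1 - exp (- c / real n))) \<longlonglongrightarrow> T / c"
      using c by simp
    then show "(\<lambda>n. (T / real n) / (1 - exp (- (2 * b * T) / real n))) \<longlonglongrightarrow> 1 / (2 * b)"
      using T by (simp add: c_def)
  qed
  ultimately show ?thesis by (simp add: filterlim_cong)
qed

lemma (in prob_space) noise_sum_normal:
  assumes W: "standard_wiener M W" and T: "0 < T" and k: "k < n"
  shows "distributed M lborel (noise_sum W b T n k) (normal_density 0 (sqrt (noise_var b T n k)))"
proof -
  have "distributed M lborel (\<lambda>\<omega>. \<Sum>i=k..<n. exp (- b * (T * real i / real n)) * (W (T * real (Suc i) / real n) \<omega> - W (T * real i / real n) \<omega>))
    (normal_density 0 (sqrt (\<Sum>i=k..<n. (exp (- b * (T * real i / real n)))\<^sup>2 * (T * real (Suc i) / real n - T * real i / real n))))"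
    by (rule wiener_weighted_increments_normal[OF W]) (use T k in \<open>auto intro: divide_strict_right_mono\<close>)
  moreover have "T * real (Suc i) / real n - T * real i / real n = T / real n" for i
    by (simp add: field_simps add_divide_distrib)
  ultimately show ?thesis by (simp add: noise_var_def noise_sum_def[abs_def])
qed

lemma noise_var_pos: "0 < T \<Longrightarrow> k < n \<Longrightarrow> 0 < noise_var b T n k"
  unfolding noise_var_def by (intro sum_pos) auto

text \<open>Above \<open>c\<close> the density with mean \<open>0\<close> is at most \<open>exp (- c\<^sup>2 / (2 * \<sigma>\<^sup>2))\<close> times the density with
  mean \<open>c\<close>.\<close>

lemma (in prob_space) normal_upper_tail:
  assumes Z: "distributed M lborel Z (normal_density 0 \<sigma>)" and \<sigma>: "0 < \<sigma>" and c: "0 \<le> c"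
  shows "prob {\<omega>\<in>space M. c < Z \<omega>} \<le> exp (- c\<^sup>2 / (2 * \<sigma>\<^sup>2))"
proof -
  have "emeasure M (Z -` {c<..} \<inter> space M) = (\<integral>\<^sup>+x. ennreal (normal_density 0 \<sigma> x) * indicator {c<..} x \<partial>lborel)"
    by (rule distributed_emeasure[OF Z]) auto
  also have "\<dots> \<le> (\<integral>\<^sup>+x. ennreal (exp (- c\<^sup>2 / (2 * \<sigma>\<^sup>2))) * ennreal (normal_density c \<sigma> x) \<partial>lborel)"
  proof (rule nn_integral_mono)
    fix x :: real
    have "normal_density 0 \<sigma> x \<le> exp (- c\<^sup>2 / (2 * \<sigma>\<^sup>2)) * normal_density c \<sigma> x" if "c < x"
    proof -
      have "- x\<^sup>2 / (2 * \<sigma>\<^sup>2) \<le> - c\<^sup>2 / (2 * \<sigma>\<^sup>2) + - (x - c)\<^sup>2 / (2 * \<sigma>\<^sup>2)"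
      proof -
        have "c * c \<le> c * x" using that c by (intro mult_left_mono) auto
        then have "- x\<^sup>2 \<le> - c\<^sup>2 + - (x - c)\<^sup>2" by (simp add: power2_eq_square algebra_simps)
        then have "- x\<^sup>2 / (2 * \<sigma>\<^sup>2) \<le> (- c\<^sup>2 + - (x - c)\<^sup>2) / (2 * \<sigma>\<^sup>2)"
          by (rule divide_right_mono) auto
        then show ?thesis by (simp only: add_divide_distrib)
      qed
      then have "exp (- x\<^sup>2 / (2 * \<sigma>\<^sup>2)) \<le> exp (- c\<^sup>2 / (2 * \<sigma>\<^sup>2)) * exp (- (x - c)\<^sup>2 / (2 * \<sigma>\<^sup>2))"
        by (simp flip: exp_add)
      then have "1 / sqrt (2 * pi * \<sigma>\<^sup>2) * exp (- x\<^sup>2 / (2 * \<sigma>\<^sup>2)) \<le> 1 / sqrt (2 * pi * \<sigma>\<^sup>2) * (exp (- c\<^sup>2 / (2 * \<sigma>\<^sup>2)) * exp (- (x - c)\<^sup>2 / (2 * \<sigma>\<^sup>2)))"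
        by (intro mult_left_mono) auto
      then show ?thesis by (simp add: normal_density_def mult_ac)
    qed
    then show "ennreal (normal_density 0 \<sigma> x) * indicator {c<..} x \<le> ennreal (exp (- c\<^sup>2 / (2 * \<sigma>\<^sup>2))) * ennreal (normal_density c \<sigma> x)"
      by (auto simp: indicator_def ennreal_mult[symmetric] intro!: ennreal_leI)
  qed
  also have "\<dots> = ennreal (exp (- c\<^sup>2 / (2 * \<sigma>\<^sup>2))) * (\<integral>\<^sup>+x. ennreal (normal_density c \<sigma> x) \<partial>lborel)"
    by (rule nn_integral_cmult) auto
  also have "(\<integral>\<^sup>+x. ennreal (normal_density c \<sigma> x) \<partial>lborel) = 1"
    using prob_space.emeasure_space_1[OF prob_space_normal_density[OF \<sigma>, of c]] by (simp add: emeasure_density)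
  finally have "emeasure M (Z -` {c<..} \<inter> space M) \<le> ennreal (exp (- c\<^sup>2 / (2 * \<sigma>\<^sup>2)))" by simp
  then have "prob (Z -` {c<..} \<inter> space M) \<le> exp (- c\<^sup>2 / (2 * \<sigma>\<^sup>2))"
    by (simp add: emeasure_eq_measure)
  then show ?thesis by (simp add: vimage_def Int_def conj_commute)
qed

section \<open>Adaptedness of the exit\<close>

lemma driving_filtration_generators:
  fixes W :: "real \<Rightarrow> 'w \<Rightarrow> real"
  assumes W: "\<And>s. 0 \<le> s \<Longrightarrow> W s \<in> borel_measurable M"
  shows "space (driving_filtration M (\<lambda>_. y) W t) = space M"
    and "sets (driving_filtration M (\<lambda>_. y) W t) \<subseteq> sets M"
    and "null_sets M \<subseteq> sets (driving_filtration M (\<lambda>_. y) W t)"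
    and "\<And>s. 0 \<le> s \<Longrightarrow> s \<le> t \<Longrightarrow> W s \<in> borel_measurable (driving_filtration M (\<lambda>_. y) W t)"
proof -
  let ?G = "{(\<lambda>_. y) -` A \<inter> space M | A. A \<in> sets borel} \<union>
        {W s -` A \<inter> space M | s A. 0 \<le> s \<and> s \<le> t \<and> A \<in> sets borel} \<union> null_sets M"
  have G: "?G \<subseteq> Pow (space M)" by (auto dest: sets.sets_into_space)
  show sp: "space (driving_filtration M (\<lambda>_. y) W t) = space M"
    unfolding driving_filtration_def by (rule space_measure_of[OF G])
  have st: "sets (driving_filtration M (\<lambda>_. y) W t) = sigma_sets (space M) ?G"
    unfolding driving_filtration_def by (rule sets_measure_of[OF G])
  have "(\<lambda>_. y) -` A \<inter> space M \<in> sets M" for A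
    by (cases "y \<in> A") auto
  then have "?G \<subseteq> sets M" using W by (auto intro: measurable_sets)
  then show "sets (driving_filtration M (\<lambda>_. y) W t) \<subseteq> sets M"
    unfolding st by (rule sets.sigma_sets_subset)
  show "null_sets M \<subseteq> sets (driving_filtration M (\<lambda>_. y) W t)" unfolding st by (rule subsetI) simp
  fix s assume s: "0 \<le> s" "s \<le> t"
  show "W s \<in> borel_measurable (driving_filtration M (\<lambda>_. y) W t)"
  proof (rule measurableI)
    fix A :: "real set" assume "A \<in> sets borel"
    then have "W s -` A \<inter> space M \<in> ?G" using s by blast
    then show "W s -` A \<inter> space (driving_filtration M (\<lambda>_. y) W t) \<in> sets (driving_filtration M (\<lambda>_. y) W t)"
      unfolding sp st by (rule sigma_sets.Basic)
  qed simp
qed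

lemma driving_filtration_mono:
  fixes W :: "real \<Rightarrow> 'w \<Rightarrow> real"
  assumes W: "\<And>s. 0 \<le> s \<Longrightarrow> W s \<in> borel_measurable M" and rt: "r \<le> t"
  shows "sets (driving_filtration M (\<lambda>_. y) W r) \<subseteq> sets (driving_filtration M (\<lambda>_. y) W t)"
proof -
  let ?G = "\<lambda>t. {(\<lambda>_. y) -` A \<inter> space M | A. A \<in> sets borel} \<union>
        {W s -` A \<inter> space M | s A. 0 \<le> s \<and> s \<le> t \<and> A \<in> sets borel} \<union> null_sets M"
  have G: "?G t \<subseteq> Pow (space M)" for t by (auto dest: sets.sets_into_space)
  have "sets (driving_filtration M (\<lambda>_. y) W t) = sigma_sets (space M) (?G t)" for t
    unfolding driving_filtration_def by (rule sets_measure_of[OF G])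
  moreover have "?G r \<subseteq> ?G t"
    by (intro Un_mono order_refl) (use rt order_trans[of _ r t] in blast)
  ultimately show ?thesis by (simp only: sigma_sets_mono')
qed

lemma measurable_of_AE_eq:
  assumes N: "space N = space M" "sets N \<subseteq> sets M" "null_sets M \<subseteq> sets N"
    and f: "f \<in> borel_measurable N" and g: "g \<in> borel_measurable M" and eq: "AE \<omega> in M. f \<omega> = g \<omega>"
  shows "g \<in> borel_measurable N"
proof (rule measurableI)
  fix A :: "'b set" assume A: "A \<in> sets borel"
  let ?F = "f -` A \<inter> space M" and ?G = "g -` A \<inter> space M"
  have F: "?F \<in> sets N" "?F \<in> sets M" using measurable_sets[OF f A] N by auto
  have G: "?G \<in> sets M" using measurable_sets[OF g A] by auto
  have nul: "B \<in> null_sets M" if "B \<in> sets M" "B \<subseteq> {\<omega>. f \<omega> \<noteq> g \<omega>}" for B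
  proof -
    have "AE \<omega> in M. \<omega> \<notin> B" using eq by eventually_elim (use that(2) in auto)
    then show ?thesis using AE_iff_null_sets[OF that(1)] by simp
  qed
  have nul1: "?F - ?G \<in> null_sets M" by (rule nul) (use F G in auto)
  have nul2: "?G - ?F \<in> null_sets M" by (rule nul) (use F G in auto)
  have "?G = (?F - (?F - ?G)) \<union> (?G - ?F)" by auto
  also have "\<dots> \<in> sets N" by (rule sets.Un[OF sets.Diff[OF F(1) subsetD[OF N(3) nul1]] subsetD[OF N(3) nul2]])
  finally show "g -` A \<inter> space N \<in> sets N" using N(1) by simp
qed simp

text \<open>The solution at time \<open>t\<close> is almost surely a limit of noise sums over the grids of \<open>{0..t}\<close>. The
  filtration that comes with a planar solution would be too large: it contains the noise and the
  initial value of the other coordinate.\<close>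

lemma solution_adapted:
  assumes W: "standard_wiener M W" and X: "solves_linear M b e W X"
    and X0: "AE \<omega> in M. X 0 \<omega> = x0" and t: "0 \<le> t"
  shows "X t \<in> borel_measurable (driving_filtration M (\<lambda>_. y) W t)"
proof -
  have Wm: "W s \<in> borel_measurable M" if "0 \<le> s" for s using W that unfolding standard_wiener_def by auto
  note F = driving_filtration_generators[of W M, OF Wm, where y=y and t=t]
  let ?N = "driving_filtration M (\<lambda>_. y) W t"
  have S: "noise_sum W b t n 0 \<in> borel_measurable ?N" for n
  proof -
    have "W (t * real i / real n) \<in> borel_measurable ?N" if "i \<le> n" for i
      by (rule F(4)) (use that t in \<open>auto simp: divide_le_eq mult_left_mono\<close>)
    then show ?thesis unfolding noise_sum_def[abs_def]
      by (intro borel_measurable_sum borel_measurable_times borel_measurable_diff borel_measurable_const) (auto simp del: of_nat_Suc)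
  qed
  show ?thesis
  proof (rule measurable_of_AE_eq[OF F(1-3)])
    show "(\<lambda>\<omega>. exp (b * t) * (x0 + lim (\<lambda>n. e * noise_sum W b t n 0 \<omega>))) \<in> borel_measurable ?N"
      using S by measurable
    show "X t \<in> borel_measurable M" by (rule solves_linearD(1)[OF X t])
    show "AE \<omega> in M. exp (b * t) * (x0 + lim (\<lambda>n. e * noise_sum W b t n 0 \<omega>)) = X t \<omega>"
      using noise_sum_tendsto[OF X t] X0
    proof eventually_elim
      case (elim \<omega>)
      then have "lim (\<lambda>n. e * noise_sum W b t n 0 \<omega>) = exp (- b * t) * X t \<omega> - x0"
        by (auto dest: limI)
      then show ?case by (simp add: mult.assoc[symmetric] exp_add[symmetric])
    qed
  qed
qed

text \<open>The first point \<open>k\<close> of the uniform grid of \<open>{0..T}\<close>, with \<open>n\<close> cells, that is not before \<open>s\<close>.\<close>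

definition grid_index :: "real \<Rightarrow> nat \<Rightarrow> real \<Rightarrow> nat" where
  "grid_index T n s = nat \<lceil>real n * s / T\<rceil>"

lemma grid_index_bounds:
  assumes "0 < T" "0 < n" "0 \<le> s" "s \<le> T"
  shows "grid_index T n s \<le> n"
    and "s \<le> T * real (grid_index T n s) / real n"
    and "T * real (grid_index T n s) / real n \<le> s + T / real n"
proof -
  have nn: "0 \<le> real n * s / T" using assms by simp
  have "real n * s / T \<le> real n * 1" using assms by (simp add: divide_le_eq mult_left_mono)
  then show "grid_index T n s \<le> n" unfolding grid_index_def by (simp add: ceiling_le_iff nat_le_iff)
  have r: "real (grid_index T n s) = of_int \<lceil>real n * s / T\<rceil>"
    unfolding grid_index_def using nn by (simp add: of_nat_nat)
  have "real n * s / T \<le> real (grid_index T n s)" unfolding r by simp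
  then show "s \<le> T * real (grid_index T n s) / real n" using assms by (simp add: field_simps)
  have "real (grid_index T n s) \<le> real n * s / T + 1" unfolding r by linarith
  then show "T * real (grid_index T n s) / real n \<le> s + T / real n" using assms by (simp add: field_simps)
qed

lemma grid_index_le_iff:
  assumes "0 < T" "0 < n"
  shows "grid_index T n s \<le> k \<longleftrightarrow> s \<le> T * real k / real n"
proof -
  have "grid_index T n s \<le> k \<longleftrightarrow> real n * s / T \<le> real k"
    unfolding grid_index_def by (simp add: nat_le_iff ceiling_le_iff)
  also have "\<dots> \<longleftrightarrow> s \<le> T * real k / real n" using assms by (simp add: field_simps)
  finally show ?thesis .
qed

lemma grid_index_tendsto:
  assumes "0 < T" "0 \<le> s" "s \<le> T"
  shows "(\<lambda>n. T * real (grid_index T n s) / real n) \<longlonglongrightarrow> s"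
proof (rule tendsto_sandwich[of "\<lambda>_. s" _ _ "\<lambda>n. s + T / real n"])
  show "\<forall>\<^sub>F n in sequentially. s \<le> T * real (grid_index T n s) / real n"
    using eventually_gt_at_top[of 0] by eventually_elim (use assms grid_index_bounds in auto)
  show "\<forall>\<^sub>F n in sequentially. T * real (grid_index T n s) / real n \<le> s + T / real n"
    using eventually_gt_at_top[of 0] by eventually_elim (use assms grid_index_bounds in auto)
  show "(\<lambda>n. s + T / real n) \<longlonglongrightarrow> s" by real_asymp
qed simp

definition exit_cell :: "'w measure \<Rightarrow> (real \<Rightarrow> 'w \<Rightarrow> real) \<Rightarrow> real \<Rightarrow> real \<Rightarrow> real \<Rightarrow> nat \<Rightarrow> nat \<Rightarrow> 'w set" where
  "exit_cell M X a b T n k = {\<omega>\<in>space M. hits_first (\<lambda>t. X t \<omega>) a b T \<and>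
     grid_index T n (real_of_ereal (hitting_time X {a, b} \<omega>)) = k}"

lemma hits_firstD:
  fixes X :: "real \<Rightarrow> 'w \<Rightarrow> real" and \<omega> :: 'w
  assumes cont: "continuous_on {0..} (\<lambda>t. X t \<omega>)" and ab: "a \<noteq> b" and h: "hits_first (\<lambda>t. X t \<omega>) a b T"
  obtains s where "hitting_time X {a, b} \<omega> = ereal s" "0 \<le> s" "s \<le> T" "X s \<omega> = a"
    "\<And>t. hits_first (\<lambda>t. X t \<omega>) a b t \<longleftrightarrow> s \<le> t"
proof (rule hitting_time_cases[where Y = X and \<omega> = \<omega> and S = "{a, b}"])
  show "continuous_on {0..} (\<lambda>t. X t \<omega>)" by (rule cont)
  show "closed {a, b}" by auto
next
  assume "hitting_time X {a, b} \<omega> = \<infinity>"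
  then show thesis using h hits_first_iff_hitting_time[where Y = X and \<omega> = \<omega>, OF cont ab] by auto
next
  fix s assume "hitting_time X {a, b} \<omega> = ereal s" "0 \<le> s"
  then show thesis using h hits_first_iff_hitting_time[where Y = X and \<omega> = \<omega>, OF cont ab] that[of s] by auto
qed

text \<open>Rounding up keeps the exit time a stopping time: the cell of the exit is known at the end of
  the cell.\<close>

lemma exit_cell_adapted:
  assumes W: "standard_wiener M W" and X: "solves_linear M b e W X"
    and X0: "AE \<omega> in M. X 0 \<omega> = x0" and ab: "a \<noteq> c" and T: "0 < T" and n: "0 < n" and k: "k \<le> n"
  shows "exit_cell M X a c T n k \<in> sets (driving_filtration M (\<lambda>_. y) W (T * real k / real n))"
proof -
  have Wm: "W s \<in> borel_measurable M" if "0 \<le> s" for s using W that unfolding standard_wiener_def by auto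
  let ?t = "\<lambda>k::nat. T * real k / real n"
  let ?N = "driving_filtration M (\<lambda>_. y) W (?t k)"
  note F = driving_filtration_generators[of W M, OF Wm, where y=y]
  have cont: "continuous_on {0..} (\<lambda>t. X t \<omega>)" if "\<omega> \<in> space M" for \<omega>
    by (rule solves_linearD(2)[OF X that])
  have Xm: "X r \<in> borel_measurable ?N" if "0 \<le> r" "r \<le> ?t k" for r
  proof -
    have "sets (driving_filtration M (\<lambda>_. y) W r) \<subseteq> sets ?N"
      by (rule driving_filtration_mono[OF Wm that(2)])
    then show "X r \<in> borel_measurable ?N"
      by (intro subsetD[OF measurable_mono solution_adapted[OF W X X0 that(1), of y]])
         (simp_all only: F(1) order_refl)
  qed
  have ev: "{\<omega>\<in>space M. hits_first (\<lambda>t. X t \<omega>) a c (?t j)} \<in> sets ?N" if "j \<le> k" for j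
  proof -
    have "?t j \<le> ?t k" using that T n by (intro divide_right_mono mult_left_mono) auto
    then have "{\<omega>\<in>space ?N. hits_first (\<lambda>r. X r \<omega>) a c (?t j)} \<in> sets ?N"
      by (intro hits_first_measurable Xm cont) (auto simp: F(1))
    then show ?thesis by (simp add: F(1))
  qed
  have key: "hits_first (\<lambda>t. X t \<omega>) a c (?t k) \<and> (0 < k \<longrightarrow> \<not> hits_first (\<lambda>t. X t \<omega>) a c (?t (k - 1)))
      \<longleftrightarrow> hits_first (\<lambda>t. X t \<omega>) a c T \<and> grid_index T n (real_of_ereal (hitting_time X {a, c} \<omega>)) = k"
    if \<omega>: "\<omega> \<in> space M" for \<omega>
  proof (cases "hits_first (\<lambda>t. X t \<omega>) a c T")
    case False
    have "?t k \<le> T" using k T n by (simp add: divide_le_eq mult_left_mono)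
    then have "\<not> hits_first (\<lambda>t. X t \<omega>) a c (?t k)" using False unfolding hits_first_def by force
    then show ?thesis using False by simp
  next
    case True
    obtain s where s: "hitting_time X {a, c} \<omega> = ereal s" "0 \<le> s" "\<And>t. hits_first (\<lambda>t. X t \<omega>) a c t \<longleftrightarrow> s \<le> t"
    proof (rule hits_firstD[where X = X and \<omega> = \<omega> and a = a and b = c and T = T])
      show "continuous_on {0..} (\<lambda>t. X t \<omega>)" by (rule cont[OF \<omega>])
    qed (use ab True in simp_all)
    have "grid_index T n s = k \<longleftrightarrow> grid_index T n s \<le> k \<and> (0 < k \<longrightarrow> \<not> grid_index T n s \<le> k - 1)" by auto
    then show ?thesis using True s by (simp add: grid_index_le_iff[OF T n])
  qed
  have "exit_cell M X a c T n k = (if k = 0 then {\<omega>\<in>space M. hits_first (\<lambda>t. X t \<omega>) a c (?t k)}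
      else {\<omega>\<in>space M. hits_first (\<lambda>t. X t \<omega>) a c (?t k)} - {\<omega>\<in>space M. hits_first (\<lambda>t. X t \<omega>) a c (?t (k - 1))})"
    unfolding exit_cell_def using key by auto
  also have "\<dots> \<in> sets ?N"
    by (split if_split, intro conjI impI)
       (rule ev[OF order_refl], rule sets.Diff[OF ev[OF order_refl] ev], rule diff_le_self)
  finally show ?thesis .
qed

section \<open>Noise after the exit\<close>

lemma hitting_time_measurable:
  assumes X: "solves_linear M b e W X" and ab: "a \<noteq> c"
  shows "hitting_time X {a, c} \<in> borel_measurable M"
    and "(\<lambda>\<omega>. real_of_ereal (hitting_time X {a, c} \<omega>)) \<in> borel_measurable M"
proof -
  note cont = solves_linearD(2)[OF X]
  show *: "hitting_time X {a, c} \<in> borel_measurable M"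
  proof (rule borel_measurableI_le)
    fix y :: ereal
    have H: "{\<omega>\<in>space M. hits_first (\<lambda>t. X t \<omega>) p q t} \<in> sets M" for p q t
      by (rule hits_first_measurable) (use solves_linearD[OF X] in auto)
    have eq: "{\<omega>\<in>space M. hitting_time X {a, c} \<omega> \<le> ereal t} =
        {\<omega>\<in>space M. hits_first (\<lambda>t. X t \<omega>) a c t} \<union> {\<omega>\<in>space M. hits_first (\<lambda>t. X t \<omega>) c a t}" for t
    proof -
      have "hitting_time X {a, c} \<omega> \<le> ereal t \<longleftrightarrow>
          hits_first (\<lambda>t. X t \<omega>) a c t \<or> hits_first (\<lambda>t. X t \<omega>) c a t" if "\<omega> \<in> space M" for \<omega>
      proof -
        have ac: "{c, a} = {a, c}" by auto
        note 1 = hits_first_iff_hitting_time[where Y = X and \<omega> = \<omega> and t = t]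
        show ?thesis
          unfolding 1[OF cont[OF that] ab] 1[OF cont[OF that] ab[symmetric]] ac
          by (rule hitting_time_cases[where Y = X and \<omega> = \<omega> and S = "{a, c}"])
             (use cont[OF that] in auto)
      qed
      then show ?thesis by auto
    qed
    have "hitting_time X {a, c} \<omega> \<ge> 0" for \<omega>
      unfolding hitting_time_def by (rule Inf_greatest) auto
    then have neg: "\<not> hitting_time X {a, c} \<omega> \<le> -\<infinity>" for \<omega>
      by (metis ereal_infty_less_eq(2) MInfty_neq_ereal(1) zero_ereal_def)
    show "{\<omega>\<in>space M. hitting_time X {a, c} \<omega> \<le> y} \<in> sets M"
      by (cases y) (use H eq neg in auto)
  qed
  then show "(\<lambda>\<omega>. real_of_ereal (hitting_time X {a, c} \<omega>)) \<in> borel_measurable M" by measurable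
qed

text \<open>This is the strong Markov property at the exit time, in the form of a tail estimate. With
  \<open>X (\<tau>) = a\<close>, the variable that is compared with \<open>c\<close> is, up to the sign \<open>sg\<close>, the integral of the noise
  between \<open>\<tau>\<close> and \<open>T\<close> with weight \<open>exp (-lam (s - \<tau>))\<close>. If the exit time is rounded up to a grid, the noise
  after the \<open>k\<close>th grid point is independent of the event that the exit falls into the \<open>k\<close>th cell, so the
  Gaussian tail bound holds on every cell and hence on their union. As the inequality with \<open>c\<close> is
  strict, it persists for all fine grids, and the grid may be refined.\<close>

lemma (in prob_space) overshoot_tail:
  fixes X W :: "real \<Rightarrow> 'a \<Rightarrow> real" and \<tau> :: "'a \<Rightarrow> real"
  assumes W: "standard_wiener M W" and X: "solves_linear M lam e W X" and X0: "AE \<omega> in M. X 0 \<omega> = x0"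
    and pos: "0 < lam" "0 < e" "0 < T" "0 \<le> c" and ab: "a \<noteq> b" and sg: "\<bar>sg\<bar> = 1"
  defines "\<tau> \<equiv> \<lambda>\<omega>. real_of_ereal (hitting_time X {a, b} \<omega>)"
  shows "prob {\<omega>\<in>space M. hits_first (\<lambda>t. X t \<omega>) a b T \<and>
      c < sg * ((exp (lam * \<tau> \<omega>) * (exp (- lam * T) * X T \<omega>) - a) / e)}
    \<le> prob {\<omega>\<in>space M. hits_first (\<lambda>t. X t \<omega>) a b T} * exp (- lam * c\<^sup>2)"
proof -
  let ?t = "\<lambda>n k::nat. T * real k / real n"
  define E where "E = {\<omega>\<in>space M. hits_first (\<lambda>t. X t \<omega>) a b T}"
  define Y where "Y \<omega> = exp (- lam * T) * X T \<omega>" for \<omega>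
  define B where "B = {\<omega>\<in>space M. hits_first (\<lambda>t. X t \<omega>) a b T \<and> c < sg * ((exp (lam * \<tau> \<omega>) * Y \<omega> - a) / e)}"
  define Z where "Z n k \<omega> = sg * (exp (lam * ?t n k) * noise_sum W lam T n k \<omega>)" for n k \<omega>
  define A where "A n k = exit_cell M X a b T n k" for n k
  define Bn where "Bn n = (\<Union>k\<le>n. A n k \<inter> {\<omega>\<in>space M. c < Z n k \<omega>})" for n
  have Wm: "W s \<in> borel_measurable M" if "0 \<le> s" for s using W that unfolding standard_wiener_def by auto
  have [measurable]: "\<tau> \<in> borel_measurable M" unfolding \<tau>_def by (rule hitting_time_measurable(2)[OF X ab])
  have [measurable]: "X T \<in> borel_measurable M" using solves_linearD(1)[OF X, of T] pos by simp
  have E[measurable]: "E \<in> events" unfolding E_def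
    by (rule hits_first_measurable) (use solves_linearD[OF X] in auto)
  have B_eq: "B = E \<inter> {\<omega>\<in>space M. c < sg * ((exp (lam * \<tau> \<omega>) * Y \<omega> - a) / e)}"
    unfolding B_def E_def by auto
  have B[measurable]: "B \<in> events" unfolding B_eq Y_def by measurable
  have Zm: "Z n k \<in> borel_measurable M" for n k
    unfolding Z_def noise_sum_def
    by (intro borel_measurable_times borel_measurable_const borel_measurable_sum borel_measurable_diff Wm)
       (use pos(3) in simp_all)
  have filt: "A n k \<in> sets (driving_filtration M (\<lambda>_. 0) W (?t n k))" if "0 < n" "k \<le> n" for n k
    unfolding A_def by (rule exit_cell_adapted[OF W X X0 ab pos(3) that])
  have Am: "A n k \<in> events" if "0 < n" "k \<le> n" for n k
    by (rule subsetD[OF driving_filtration_generators(2)[OF Wm] filt[OF that]])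
  have disj: "disjoint_family_on (\<lambda>k. A n k) I" for n I
    unfolding A_def exit_cell_def disjoint_family_on_def by auto
  have disj2: "disjoint_family_on (\<lambda>k. A n k \<inter> D k) I" for n I D
    unfolding A_def exit_cell_def disjoint_family_on_def by auto
  have EA: "E = (\<Union>k\<le>n. A n k)" if "0 < n" for n
  proof -
    have "grid_index T n (\<tau> \<omega>) \<le> n" if \<omega>: "\<omega> \<in> E" for \<omega>
    proof (rule hits_firstD[where X = X and \<omega> = \<omega> and a = a and b = b and T = T])
      show "continuous_on {0..} (\<lambda>t. X t \<omega>)" "hits_first (\<lambda>t. X t \<omega>) a b T"
        using \<omega> solves_linearD(2)[OF X] by (auto simp: E_def)
      fix s assume "hitting_time X {a, b} \<omega> = ereal s" "0 \<le> s" "s \<le> T"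
      then show ?thesis using grid_index_bounds(1)[OF pos(3) \<open>0 < n\<close>, of s] by (simp add: \<tau>_def)
    qed (rule ab)
    then show ?thesis unfolding A_def exit_cell_def E_def \<tau>_def by auto
  qed
  \<comment> \<open>A bound for the variance of \<open>Z n k\<close> that does not depend on \<open>k\<close> and tends to \<open>1 / (2 * lam)\<close>.\<close>
  define v where "v n = (T / real n) / (1 - exp (- 2 * lam * T / real n))" for n
  have step: "prob (A n k \<inter> {\<omega>\<in>space M. c < Z n k \<omega>}) \<le> prob (A n k) * exp (- c\<^sup>2 / (2 * v n))"
    if n: "0 < n" "k \<le> n" for n k
  proof (cases "k = n")
    case True
    have "{\<omega>\<in>space M. c < Z n k \<omega>} = {}" using True pos by (simp add: Z_def noise_sum_def)
    then show ?thesis by (simp only: Int_empty_right) simp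
  next
    case False
    then have k: "k < n" using n by simp
    let ?c = "\<lambda>i. (sg * exp (lam * ?t n k)) * exp (- lam * ?t n i)"
    have Zs: "Z n k \<omega> = (\<Sum>i=k..<n. ?c i * (W (?t n (Suc i)) \<omega> - W (?t n i) \<omega>))" for \<omega>
      unfolding Z_def noise_sum_def sum_distrib_left by (simp add: mult.assoc)
    have "prob (A n k \<inter> {\<omega>\<in>space M. Z n k \<omega> \<in> {c<..}}) = prob (A n k) * prob {\<omega>\<in>space M. Z n k \<omega> \<in> {c<..}}"
      unfolding Zs
      by (rule wiener_past_indep_future[OF W _ _ _ _ filt[OF n]])
         (use pos n in \<open>auto intro!: divide_right_mono mult_left_mono\<close>)
    then have "prob (A n k \<inter> {\<omega>\<in>space M. c < Z n k \<omega>}) = prob (A n k) * prob {\<omega>\<in>space M. c < Z n k \<omega>}" by simp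
    also have "\<dots> \<le> prob (A n k) * exp (- c\<^sup>2 / (2 * v n))"
    proof (rule mult_left_mono)
      let ?s = "exp (lam * ?t n k) * sqrt (noise_var lam T n k)"
      have sp: "0 < ?s" using noise_var_pos[OF pos(3) k] by simp
      have "distributed M lborel (\<lambda>\<omega>. 0 + (sg * exp (lam * ?t n k)) * noise_sum W lam T n k \<omega>)
          (normal_density (0 + (sg * exp (lam * ?t n k)) * 0) (\<bar>sg * exp (lam * ?t n k)\<bar> * sqrt (noise_var lam T n k)))"
        by (rule normal_density_affine[OF noise_sum_normal[OF W pos(3) k]])
           (use noise_var_pos[OF pos(3) k] sg in auto)
      then have "distributed M lborel (Z n k) (normal_density 0 ?s)"
        by (simp add: Z_def[abs_def] abs_mult sg mult.assoc)
      then have "prob {\<omega>\<in>space M. c < Z n k \<omega>} \<le> exp (- c\<^sup>2 / (2 * ?s\<^sup>2))"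
        by (rule normal_upper_tail) (use sp pos in auto)
      also have "\<dots> \<le> exp (- c\<^sup>2 / (2 * v n))"
      proof -
        have s2: "?s\<^sup>2 \<le> v n"
          using noise_var_le[OF pos(1,3) n(2)] noise_var_pos[OF pos(3) k, of lam]
          by (simp add: v_def power_mult_distrib)
        have "0 < ?s\<^sup>2" by (rule zero_less_power[OF sp])
        then have "c\<^sup>2 / (2 * v n) \<le> c\<^sup>2 / (2 * ?s\<^sup>2)"
          using s2 by (intro frac_le mult_left_mono mult_pos_pos) simp_all
        then show ?thesis by simp
      qed
      finally show "prob {\<omega>\<in>space M. c < Z n k \<omega>} \<le> exp (- c\<^sup>2 / (2 * v n))" .
    qed simp
    finally show ?thesis .
  qed
  have Bnm: "Bn n \<in> events" if "0 < n" for n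
    unfolding Bn_def using Am[OF that] Zm by (intro sets.finite_UN) auto
  have PBn: "prob (Bn n) \<le> prob E * exp (- c\<^sup>2 / (2 * v n))" if n: "0 < n" for n
  proof -
    have "prob (Bn n) = (\<Sum>k\<le>n. prob (A n k \<inter> {\<omega>\<in>space M. c < Z n k \<omega>}))"
      unfolding Bn_def
      by (rule finite_measure_finite_Union) (use Am[OF n] Zm disj2 in auto)
    also have "\<dots> \<le> (\<Sum>k\<le>n. prob (A n k) * exp (- c\<^sup>2 / (2 * v n)))"
      by (intro sum_mono step n) auto
    also have "\<dots> = (\<Sum>k\<le>n. prob (A n k)) * exp (- c\<^sup>2 / (2 * v n))" by (simp only: sum_distrib_right)
    also have "(\<Sum>k\<le>n. prob (A n k)) = prob E"
      unfolding EA[OF n] by (rule finite_measure_finite_Union[symmetric]) (use Am[OF n] disj in auto)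
    finally show ?thesis .
  qed
  have evB: "AE \<omega> in M. \<omega> \<in> B \<longrightarrow> (\<forall>\<^sub>F n in sequentially. \<omega> \<in> Bn n)"
    using noise_sum_uniform[OF X less_imp_le[OF pos(3)]] AE_space
  proof eventually_elim
    case (elim \<omega>)
    show ?case
    proof
      assume \<omega>: "\<omega> \<in> B"
      then have hf: "hits_first (\<lambda>t. X t \<omega>) a b T" and big: "c < sg * ((exp (lam * \<tau> \<omega>) * Y \<omega> - a) / e)"
        by (auto simp: B_def)
      have cont: "continuous_on {0..} (\<lambda>t. X t \<omega>)" by (rule solves_linearD(2)[OF X elim(2)])
      obtain s where s: "\<tau> \<omega> = s" "0 \<le> s" "s \<le> T" "X s \<omega> = a"
      proof (rule hits_firstD[where X = X and \<omega> = \<omega> and a = a and b = b and T = T])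
        show "continuous_on {0..} (\<lambda>t. X t \<omega>)" by (rule cont)
      qed (use ab hf in \<open>auto simp: \<tau>_def\<close>)
      let ?k = "\<lambda>n. grid_index T n s"
      let ?R = "\<lambda>n. exp (- lam * T) * X T \<omega> - exp (- lam * ?t n (?k n)) * X (?t n (?k n)) \<omega> - e * noise_sum W lam T n (?k n) \<omega>"
      have R0: "?R \<longlonglongrightarrow> 0"
      proof (rule tendsto_rabs_zero_cancel, rule order_tendstoI)
        fix y :: real assume "y < 0"
        then show "\<forall>\<^sub>F n in sequentially. y < \<bar>?R n\<bar>" by (intro always_eventually allI) (auto intro: less_le_trans)
      next
        fix y :: real assume "0 < y"
        from elim(1)[THEN spec, THEN mp, OF half_gt_zero[OF this]] eventually_gt_at_top[of 0]
        show "\<forall>\<^sub>F n in sequentially. \<bar>?R n\<bar> < y"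
        proof eventually_elim
          case (elim n)
          have "\<bar>?R n\<bar> \<le> y / 2" using elim(1) grid_index_bounds(1)[OF pos(3) elim(2) s(2,3)] by blast
          then show ?case using \<open>0 < y\<close> by linarith
        qed
      qed
      have tk: "(\<lambda>n. ?t n (?k n)) \<longlonglongrightarrow> s" by (rule grid_index_tendsto[OF pos(3) s(2,3)])
      have tk0: "0 \<le> ?t n (?k n)" for n using pos by simp
      have Xk: "(\<lambda>n. X (?t n (?k n)) \<omega>) \<longlonglongrightarrow> a"
        using continuous_on_tendsto_compose[OF cont tk] s tk0 by auto
      have "(\<lambda>n. sg * ((exp (lam * ?t n (?k n)) * (Y \<omega> - ?R n) - X (?t n (?k n)) \<omega>) / e))
          \<longlonglongrightarrow> sg * ((exp (lam * s) * (Y \<omega> - 0) - a) / e)"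
        by (intro tendsto_intros tk Xk R0) (use pos in auto)
      moreover have "sg * ((exp (lam * ?t n (?k n)) * (Y \<omega> - ?R n) - X (?t n (?k n)) \<omega>) / e) = Z n (?k n) \<omega>" for n
      proof -
        have ee: "exp (lam * ?t n (?k n)) * exp (- lam * ?t n (?k n)) = 1" by (simp flip: exp_add)
        have "Y \<omega> - ?R n = exp (- lam * ?t n (?k n)) * X (?t n (?k n)) \<omega> + e * noise_sum W lam T n (?k n) \<omega>"
          by (simp add: Y_def)
        then have "exp (lam * ?t n (?k n)) * (Y \<omega> - ?R n) - X (?t n (?k n)) \<omega>
           = (exp (lam * ?t n (?k n)) * exp (- lam * ?t n (?k n))) * X (?t n (?k n)) \<omega> - X (?t n (?k n)) \<omega>
             + e * (exp (lam * ?t n (?k n)) * noise_sum W lam T n (?k n) \<omega>)"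
          by (simp only: distrib_left mult_ac)
        then show ?thesis unfolding ee using pos by (simp add: Z_def)
      qed
      ultimately have "(\<lambda>n. Z n (?k n) \<omega>) \<longlonglongrightarrow> sg * ((exp (lam * s) * Y \<omega> - a) / e)" by simp
      then have "\<forall>\<^sub>F n in sequentially. c < Z n (?k n) \<omega>"
        by (rule order_tendstoD) (use big s in simp)
      then show "\<forall>\<^sub>F n in sequentially. \<omega> \<in> Bn n"
        using eventually_gt_at_top[of 0]
      proof eventually_elim
        case (elim n)
        have "\<omega> \<in> A n (?k n)" unfolding A_def exit_cell_def
          using \<omega> s hf by (auto simp: \<tau>_def B_def)
        then show ?case unfolding Bn_def using grid_index_bounds(1)[OF pos(3) elim(2) s(2,3)] elim(1) \<omega>
          by (auto simp: B_def intro!: bexI[of _ "?k n"])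
      qed
    qed
  qed
  \<comment> \<open>Almost every point of \<open>B\<close> is in \<open>Bn n\<close> for all large \<open>n\<close>, so the part of \<open>B\<close> that \<open>Bn n\<close> misses vanishes in the limit.\<close>
  have lim0: "(\<lambda>n. prob (B - Bn (Suc n))) \<longlonglongrightarrow> 0"
  proof -
    have "(\<lambda>n. \<integral>\<omega>. indicator (B - Bn (Suc n)) \<omega> \<partial>M) \<longlonglongrightarrow> (\<integral>\<omega>. (0::real) \<partial>M)"
    proof (rule integral_dominated_convergence[where w = "\<lambda>_. 1"])
      show "(\<lambda>\<omega>. indicator (B - Bn (Suc n)) \<omega> :: real) \<in> borel_measurable M" for n
        using Bnm[of "Suc n"] by measurable
      show "AE \<omega> in M. (\<lambda>n. indicator (B - Bn (Suc n)) \<omega> :: real) \<longlonglongrightarrow> 0"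
        using evB
      proof eventually_elim
        case (elim \<omega>)
        have "\<forall>\<^sub>F n in sequentially. \<omega> \<notin> B - Bn (Suc n)"
        proof (cases "\<omega> \<in> B")
          case True
          then have "\<forall>\<^sub>F n in sequentially. \<omega> \<in> Bn n" using elim by simp
          then have "\<forall>\<^sub>F n in sequentially. \<omega> \<in> Bn (Suc n)" by (auto simp: eventually_sequentially intro: le_SucI)
          then show ?thesis by eventually_elim simp
        qed simp
        then have "\<forall>\<^sub>F n in sequentially. indicator (B - Bn (Suc n)) \<omega> = (0::real)"
          by eventually_elim (simp add: indicator_def)
        then show ?case by (rule tendsto_eventually)
      qed
    qed (auto simp: indicator_def)
    moreover have "(\<integral>\<omega>. indicator (B - Bn (Suc n)) \<omega> \<partial>M) = prob (B - Bn (Suc n))" for n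
      using Bnm[of "Suc n"] B by (simp add: sets.Diff)
    ultimately show ?thesis by simp
  qed
  have vlim: "(\<lambda>n. exp (- c\<^sup>2 / (2 * v (Suc n)))) \<longlonglongrightarrow> exp (- lam * c\<^sup>2)"
  proof -
    define q where "q = 2 * lam * T"
    have "q > 0" using pos by (simp add: q_def)
    then have "(\<lambda>n. (T / real (Suc n)) / (1 - exp (- q / real (Suc n)))) \<longlonglongrightarrow> T / q"
      by (real_asymp simp: field_simps)
    moreover have "T / q = 1 / (2 * lam)" using pos by (simp add: q_def)
    ultimately have "(\<lambda>n. v (Suc n)) \<longlonglongrightarrow> 1 / (2 * lam)" by (simp add: v_def q_def)
    then have "(\<lambda>n. exp (- c\<^sup>2 / (2 * v (Suc n)))) \<longlonglongrightarrow> exp (- c\<^sup>2 / (2 * (1 / (2 * lam))))"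
      by (intro tendsto_intros) (use pos in auto)
    then show ?thesis by (simp add: mult.commute)
  qed
  have "prob B \<le> prob E * exp (- c\<^sup>2 / (2 * v (Suc n))) + prob (B - Bn (Suc n))" for n
  proof -
    have "prob B \<le> prob (Bn (Suc n) \<union> (B - Bn (Suc n)))"
      by (rule finite_measure_mono) (use Bnm[of "Suc n"] in auto)
    also have "\<dots> \<le> prob (Bn (Suc n)) + prob (B - Bn (Suc n))"
      by (rule measure_Un_le) (use Bnm[of "Suc n"] in auto)
    finally show ?thesis using PBn[of "Suc n"] by simp
  qed
  then have "prob B \<le> prob E * exp (- lam * c\<^sup>2) + 0"
    by (intro LIMSEQ_le_const[OF tendsto_add[OF tendsto_mult[OF tendsto_const vlim] lim0]]) auto
  then show ?thesis unfolding B_def E_def Y_def by simp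
qed

section \<open>Asymptotics of the Gaussian tail\<close>

definition gauss_tail :: "real \<Rightarrow> real" where
  "gauss_tail x = measure std_normal_distribution {x<..}"

text \<open>The substitution \<open>x = s + u / s\<close>, at the scale of the overshoot over a high level \<open>s\<close>.\<close>

lemma gauss_tail_integral:
  assumes s: "0 < s"
  shows "s * gauss_tail (s + w / s) / std_normal_density s
    = (\<integral>u. indicator {w<..} u * exp (- u - u\<^sup>2 / (2 * s\<^sup>2)) \<partial>lborel)"
proof -
  have "gauss_tail (s + w / s) = (\<integral>x. indicator {s + w / s<..} x \<partial>std_normal_distribution)"
    unfolding gauss_tail_def by simp
  also have "\<dots> = (\<integral>x. std_normal_density x *\<^sub>R indicator {s + w / s<..} x \<partial>lborel)"
    by (rule integral_density) auto
  also have "\<dots> = \<bar>1 / s\<bar> *\<^sub>R (\<integral>u. std_normal_density (s + (1 / s) * u) *\<^sub>R indicator {s + w / s<..} (s + (1 / s) * u) \<partial>lborel)"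
    by (rule lborel_integral_real_affine) (use s in simp)
  also have "(\<integral>u. std_normal_density (s + (1 / s) * u) *\<^sub>R indicator {s + w / s<..} (s + (1 / s) * u) \<partial>lborel)
      = (\<integral>u. std_normal_density s * (indicator {w<..} u * exp (- u - u\<^sup>2 / (2 * s\<^sup>2))) \<partial>lborel)"
  proof (rule Bochner_Integration.integral_cong)
    fix u
    have "std_normal_density (s + (1 / s) * u) = std_normal_density s * exp (- u - u\<^sup>2 / (2 * s\<^sup>2))"
    proof -
      have "- (s + (1 / s) * u)\<^sup>2 / 2 = - s\<^sup>2 / 2 + (- u - u\<^sup>2 / (2 * s\<^sup>2))"
        using s by (simp add: power2_eq_square field_simps)
      then show ?thesis unfolding std_normal_density_def by (simp only: exp_add mult.assoc)
    qed
    moreover have "(indicator {s + w / s<..} (s + (1 / s) * u) :: real) = indicator {w<..} u"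
      using s by (simp add: indicator_def divide_less_cancel)
    ultimately show "std_normal_density (s + (1 / s) * u) *\<^sub>R indicator {s + w / s<..} (s + (1 / s) * u)
        = std_normal_density s * (indicator {w<..} u * exp (- u - u\<^sup>2 / (2 * s\<^sup>2)))" by simp
  qed simp
  also have "\<dots> = std_normal_density s * (\<integral>u. indicator {w<..} u * exp (- u - u\<^sup>2 / (2 * s\<^sup>2)) \<partial>lborel)"
    by (rule integral_mult_right_zero)
  finally have "gauss_tail (s + w / s) = 1 / s * (std_normal_density s * (\<integral>u. indicator {w<..} u * exp (- u - u\<^sup>2 / (2 * s\<^sup>2)) \<partial>lborel))"
    using s by simp
  moreover have "std_normal_density s > 0" by (simp add: normal_density_pos)
  ultimately show ?thesis using s by simp
qed

lemma exp_tail_has_integral: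
  assumes "0 \<le> v"
  shows "integrable lborel (\<lambda>u::real. indicator {v<..} u * exp (- u))"
    and "(\<integral>u. indicator {v<..} u * exp (- u) \<partial>lborel) = exp (- v)"
proof -
  interpret E: prob_space "density lborel (exponential_density 1)" by (rule prob_space_exponential_density) simp
  have e: "exponential_density 1 u *\<^sub>R indicator {v<..} u = (indicator {v<..} u * exp (- u) :: real)" for u
    using assms by (auto simp: exponential_density_def indicator_def)
  have "integrable (density lborel (exponential_density 1)) (indicator {v<..} :: real \<Rightarrow> real)"
    by (rule E.integrable_const_bound[of _ 1]) (auto simp: indicator_def)
  then have "integrable lborel (\<lambda>u. exponential_density 1 u *\<^sub>R indicator {v<..} u :: real)"
    by (subst (asm) integrable_density) (auto simp: exponential_density_nonneg)
  then show "integrable lborel (\<lambda>u::real. indicator {v<..} u * exp (- u))" unfolding e .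
  have "distributed (density lborel (exponential_density 1)) lborel (\<lambda>x. x) (exponential_density 1)"
    by (auto simp: distributed_def distr_id2)
  then have "E.prob {u \<in> space (density lborel (exponential_density 1)). v < u} = exp (- v * 1)"
    by (rule E.exponential_distributedD_gt) (use assms in simp_all)
  then have P: "E.prob {v<..} = exp (- v)" by (simp add: greaterThan_def)
  have "(\<integral>u. indicator {v<..} u * exp (- u) \<partial>lborel) = (\<integral>u. exponential_density 1 u *\<^sub>R indicator {v<..} u \<partial>lborel)"
    by (simp only: e)
  also have "\<dots> = (\<integral>u. indicator {v<..} u \<partial>density lborel (exponential_density 1))"
    by (rule integral_density[symmetric]) (auto simp: exponential_density_nonneg)
  also have "\<dots> = E.prob {v<..}" by simp
  finally show "(\<integral>u. indicator {v<..} u * exp (- u) \<partial>lborel) = exp (- v)" unfolding P .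
qed

text \<open>In the integral of the previous lemma the quadratic term disappears as \<open>s\<close> grows, and \<open>exp (- u)\<close>
  dominates. The level \<open>w\<close> may vary along with \<open>s\<close>.\<close>

lemma gauss_tail_asymp:
  fixes s w :: "nat \<Rightarrow> real"
  assumes s: "filterlim s at_top sequentially" and w: "w \<longlonglongrightarrow> v" and wn: "\<And>n. 0 \<le> w n"
  shows "(\<lambda>n. s n * gauss_tail (s n + w n / s n) / std_normal_density (s n)) \<longlonglongrightarrow> exp (- v)"
proof -
  have v: "0 \<le> v" using w wn by (intro LIMSEQ_le_const) auto
  have "(\<lambda>n. \<integral>u. indicator {w n<..} u * exp (- u - u\<^sup>2 / (2 * (s n)\<^sup>2)) \<partial>lborel)
      \<longlonglongrightarrow> (\<integral>u. indicator {v<..} u * exp (- u) \<partial>lborel)"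
  proof (rule integral_dominated_convergence[where w = "\<lambda>u. indicator {0<..} u * exp (- u)"])
    show "integrable lborel (\<lambda>u::real. indicator {0<..} u * exp (- u))" by (rule exp_tail_has_integral) simp
    have "AE u in lborel. u \<noteq> v" by (rule AE_lborel_singleton)
    then show "AE u in lborel. (\<lambda>n. indicator {w n<..} u * exp (- u - u\<^sup>2 / (2 * (s n)\<^sup>2)))
        \<longlonglongrightarrow> indicator {v<..} u * exp (- u)"
    proof eventually_elim
      case (elim u)
      have "\<forall>\<^sub>F n in sequentially. (indicator {w n<..} u :: real) = indicator {v<..} u"
      proof (cases "u < v")
        case True
        then have "\<forall>\<^sub>F n in sequentially. u < w n" using w by (intro order_tendstoD) auto
        then show ?thesis by eventually_elim (use True in \<open>auto simp: indicator_def\<close>)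
      next
        case False
        then have "v < u" using elim by simp
        then have "\<forall>\<^sub>F n in sequentially. w n < u" using w by (intro order_tendstoD) auto
        then show ?thesis by eventually_elim (use \<open>v < u\<close> in \<open>auto simp: indicator_def\<close>)
      qed
      then have 1: "(\<lambda>n. indicator {w n<..} u :: real) \<longlonglongrightarrow> indicator {v<..} u" by (rule tendsto_eventually)
      have "filterlim (\<lambda>n. 2 * (s n)\<^sup>2) at_top sequentially"
        by (intro filterlim_tendsto_pos_mult_at_top[OF tendsto_const] filterlim_pow_at_top s) auto
      then have "(\<lambda>n. u\<^sup>2 / (2 * (s n)\<^sup>2)) \<longlonglongrightarrow> 0"
        by (intro tendsto_divide_0[OF tendsto_const] filterlim_at_top_imp_at_infinity)
      then have "(\<lambda>n. exp (- u - u\<^sup>2 / (2 * (s n)\<^sup>2))) \<longlonglongrightarrow> exp (- u - 0)" by (intro tendsto_intros)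
      from tendsto_mult[OF 1 this] show ?case by simp
    qed
    show "AE u in lborel. norm (indicator {w n<..} u * exp (- u - u\<^sup>2 / (2 * (s n)\<^sup>2))) \<le> indicator {0<..} u * exp (- u)" for n
    proof (rule AE_I2)
      fix u :: real
      have "exp (- u - u\<^sup>2 / (2 * (s n)\<^sup>2)) \<le> exp (- u)" by simp
      then show "norm (indicator {w n<..} u * exp (- u - u\<^sup>2 / (2 * (s n)\<^sup>2))) \<le> indicator {0<..} u * exp (- u)"
        using wn[of n] by (auto simp: indicator_def)
    qed
  qed auto
  moreover have "\<forall>\<^sub>F n in sequentially. (\<integral>u. indicator {w n<..} u * exp (- u - u\<^sup>2 / (2 * (s n)\<^sup>2)) \<partial>lborel)
      = s n * gauss_tail (s n + w n / s n) / std_normal_density (s n)"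
    using filterlim_at_top_dense[THEN iffD1, OF s, THEN spec, of 0]
    by eventually_elim (simp only: gauss_tail_integral)
  ultimately show ?thesis using exp_tail_has_integral(2)[OF v] by (simp add: filterlim_cong)
qed

lemma gauss_tail_pos: "0 < gauss_tail x"
proof -
  interpret N: prob_space std_normal_distribution by (rule prob_space_normal_density) simp
  have "emeasure std_normal_distribution {x<..} \<noteq> 0"
  proof
    assume "emeasure std_normal_distribution {x<..} = 0"
    then have "{x<..} \<in> null_sets std_normal_distribution" by auto
    then have "AE y in lborel. y \<in> {x<..} \<longrightarrow> std_normal_density y = 0"
      by (subst (asm) null_sets_density_iff) auto
    then have "AE y in lborel. y \<notin> {x<..}"
      by eventually_elim (use normal_density_pos[of 1 0] in \<open>auto simp: less_le\<close>)
    then have "{x<..} \<in> null_sets lborel" by (subst (asm) AE_iff_null_sets[symmetric]) auto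
    then have "{x<..<x + 1} \<in> null_sets lborel" by (rule null_sets_subset) auto
    then show False by (simp add: null_sets_def)
  qed
  then have "N.prob {x<..} \<noteq> 0" by (simp add: N.emeasure_eq_measure)
  then show ?thesis unfolding gauss_tail_def by (simp add: less_le)
qed

text \<open>Given that a standard Gaussian variable exceeds \<open>s\<close>, its overshoot times \<open>s\<close> is asymptotically
  exponential.\<close>

lemma gauss_tail_ratio:
  fixes s w :: "nat \<Rightarrow> real"
  assumes s: "filterlim s at_top sequentially" and w: "w \<longlonglongrightarrow> v" and wn: "\<And>n. 0 \<le> w n"
  shows "(\<lambda>n. gauss_tail (s n + w n / s n) / gauss_tail (s n)) \<longlonglongrightarrow> exp (- v)"
proof -
  have "(\<lambda>n. s n * gauss_tail (s n + 0 / s n) / std_normal_density (s n)) \<longlonglongrightarrow> exp (- 0)"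
    by (rule gauss_tail_asymp[OF s tendsto_const]) simp
  from tendsto_divide[OF gauss_tail_asymp[OF s w wn] this]
  have "(\<lambda>n. (s n * gauss_tail (s n + w n / s n) / std_normal_density (s n)) / (s n * gauss_tail (s n) / std_normal_density (s n)))
      \<longlonglongrightarrow> exp (- v)" by simp
  moreover have "\<forall>\<^sub>F n in sequentially. (s n * gauss_tail (s n + w n / s n) / std_normal_density (s n)) / (s n * gauss_tail (s n) / std_normal_density (s n))
     = gauss_tail (s n + w n / s n) / gauss_tail (s n)"
    using filterlim_at_top_dense[THEN iffD1, OF s, THEN spec, of 0]
  proof eventually_elim
    case (elim n)
    have "std_normal_density (s n) > 0" by (simp add: normal_density_pos)
    then show ?case using elim by (simp add: field_simps)
  qed
  ultimately show ?thesis by (simp add: filterlim_cong)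
qed

lemma gauss_tail_dominates:
  fixes s :: "nat \<Rightarrow> real"
  assumes s: "filterlim s at_top sequentially" and r: "1 < r"
  shows "(\<lambda>n. exp (- r * (s n)\<^sup>2 / 2) / gauss_tail (s n)) \<longlonglongrightarrow> 0"
proof -
  have "(\<lambda>n. s n * gauss_tail (s n + 0 / s n) / std_normal_density (s n)) \<longlonglongrightarrow> exp (- 0)"
    by (rule gauss_tail_asymp[OF s tendsto_const]) simp
  moreover have "(\<lambda>n. sqrt (2 * pi) * (s n * exp (- ((r - 1) / 2) * (s n)\<^sup>2))) \<longlonglongrightarrow> 0"
  proof -
    define q where "q = (r - 1) / 2"
    have "q > 0" using r by (simp add: q_def)
    then have "((\<lambda>x. sqrt (2 * pi) * (x * exp (- q * x\<^sup>2))) \<longlongrightarrow> 0) at_top" by real_asymp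
    then show ?thesis unfolding q_def by (rule filterlim_compose[OF _ s])
  qed
  ultimately have "(\<lambda>n. sqrt (2 * pi) * (s n * exp (- ((r - 1) / 2) * (s n)\<^sup>2)) / (s n * gauss_tail (s n + 0 / s n) / std_normal_density (s n))) \<longlonglongrightarrow> 0 / exp (- 0)"
    by (intro tendsto_divide) auto
  moreover have "\<forall>\<^sub>F n in sequentially. sqrt (2 * pi) * (s n * exp (- ((r - 1) / 2) * (s n)\<^sup>2)) / (s n * gauss_tail (s n + 0 / s n) / std_normal_density (s n))
     = exp (- r * (s n)\<^sup>2 / 2) / gauss_tail (s n)"
    using filterlim_at_top_dense[THEN iffD1, OF s, THEN spec, of 0]
  proof eventually_elim
    case (elim n)
    have "exp (- ((r - 1) / 2) * (s n)\<^sup>2) * exp (- (s n)\<^sup>2 / 2) = exp (- r * (s n)\<^sup>2 / 2)"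
      by (simp add: exp_add[symmetric] field_simps)
    then show ?case using elim gauss_tail_pos[of "s n"] by (simp add: std_normal_density_def field_simps)
  qed
  ultimately show ?thesis by (simp add: filterlim_cong)
qed

lemma gauss_tail_isCont: "isCont gauss_tail x"
proof -
  interpret N: real_distribution std_normal_distribution by (rule real_dist_normal_dist)
  have eq: "gauss_tail = (\<lambda>x. 1 - cdf std_normal_distribution x)"
  proof
    fix x
    have "{x<..} = space std_normal_distribution - {..x}" by auto
    then show "gauss_tail x = 1 - cdf std_normal_distribution x"
      unfolding gauss_tail_def cdf_def using N.prob_compl[of "{..x}"] by simp
  qed
  have "isCont (cdf std_normal_distribution) x"
    by (simp add: N.isCont_cdf measure_def emeasure_density nn_integral_null_set emeasure_lborel_singleton)
  then show ?thesis unfolding eq by (intro isCont_diff continuous_const)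
qed

lemma (in prob_space) distr_normal_eq_scaled:
  assumes "distributed M lborel Z (normal_density 0 \<sigma>)" and \<sigma>: "0 < \<sigma>"
  shows "distr M borel Z = distr std_normal_distribution borel (\<lambda>z. \<sigma> * z)"
proof -
  interpret N: prob_space std_normal_distribution by (rule prob_space_normal_density) simp
  have "distributed std_normal_distribution lborel (\<lambda>x. x) std_normal_density"
    by (auto simp: distributed_def distr_id2)
  then have "distributed std_normal_distribution lborel (\<lambda>x. 0 + \<sigma> * x) (normal_density (0 + \<sigma> * 0) (\<bar>\<sigma>\<bar> * 1))"
    by (rule N.normal_density_affine) (use \<sigma> in auto)
  then have "distr std_normal_distribution lborel (\<lambda>z. \<sigma> * z) = density lborel (normal_density 0 \<sigma>)"
    using \<sigma> by (simp add: distributed_def)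
  moreover have "distr M lborel Z = density lborel (normal_density 0 \<sigma>)"
    using assms by (simp add: distributed_def)
  ultimately have "distr M lborel Z = distr std_normal_distribution lborel (\<lambda>z. \<sigma> * z)" by simp
  then show ?thesis by (simp cong: distr_cong)
qed

text \<open>Both sides have the same characteristic function, by dominated convergence along \<open>S n\<close> and
  along \<open>\<sigma> n\<close>.\<close>

lemma (in prob_space) gaussian_limit_law:
  assumes S: "\<And>n. 0 < n \<Longrightarrow> distributed M lborel (S n) (normal_density 0 (\<sigma> n))"
    and \<sigma>: "\<And>n. 0 < n \<Longrightarrow> 0 < \<sigma> n" "\<sigma> \<longlonglongrightarrow> \<sigma>0"
    and Z[measurable]: "Z \<in> borel_measurable M" and lim: "AE \<omega> in M. (\<lambda>n. S n \<omega>) \<longlonglongrightarrow> Z \<omega>"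
  shows "distr M borel Z = distr std_normal_distribution borel (\<lambda>z. \<sigma>0 * z)"
proof (rule Levy_uniqueness)
  interpret N: prob_space std_normal_distribution by (rule prob_space_normal_density) simp
  show "real_distribution (distr M borel Z)" by (rule real_distribution_distr) simp
  show "real_distribution (distr std_normal_distribution borel (\<lambda>z. \<sigma>0 * z))" by (rule N.real_distribution_distr) simp
  have Sm[measurable]: "S (Suc n) \<in> borel_measurable M" for n
    using S[of "Suc n"] by (auto simp: distributed_def)
  show "char (distr M borel Z) = char (distr std_normal_distribution borel (\<lambda>z. \<sigma>0 * z))"
  proof
    fix t
    have "(\<lambda>n. \<integral>\<omega>. iexp (t * S (Suc n) \<omega>) \<partial>M) \<longlonglongrightarrow> (\<integral>\<omega>. iexp (t * Z \<omega>) \<partial>M)"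
    proof (rule integral_dominated_convergence[where w = "\<lambda>_. 1"])
      show "AE \<omega> in M. (\<lambda>n. iexp (t * S (Suc n) \<omega>)) \<longlonglongrightarrow> iexp (t * Z \<omega>)"
        using lim
      proof eventually_elim
        case (elim \<omega>)
        then have "(\<lambda>n. S (Suc n) \<omega>) \<longlonglongrightarrow> Z \<omega>" by (rule LIMSEQ_Suc)
        then show ?case by (intro tendsto_intros)
      qed
    qed auto
    moreover have "(\<integral>\<omega>. iexp (t * S (Suc n) \<omega>) \<partial>M) = (\<integral>z. iexp (t * (\<sigma> (Suc n) * z)) \<partial>std_normal_distribution)" for n
    proof -
      have "(\<integral>\<omega>. iexp (t * S (Suc n) \<omega>) \<partial>M) = (\<integral>x. iexp (t * x) \<partial>distr M borel (S (Suc n)))"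
        by (rule integral_distr[symmetric]) auto
      also have "distr M borel (S (Suc n)) = distr std_normal_distribution borel (\<lambda>z. \<sigma> (Suc n) * z)"
        by (rule distr_normal_eq_scaled[OF S \<sigma>(1)]) auto
      also have "(\<integral>x. iexp (t * x) \<partial>\<dots>) = (\<integral>z. iexp (t * (\<sigma> (Suc n) * z)) \<partial>std_normal_distribution)"
        by (rule integral_distr) auto
      finally show ?thesis .
    qed
    moreover have "(\<lambda>n. \<integral>z. iexp (t * (\<sigma> (Suc n) * z)) \<partial>std_normal_distribution) \<longlonglongrightarrow> (\<integral>z. iexp (t * (\<sigma>0 * z)) \<partial>std_normal_distribution)"
    proof (rule integral_dominated_convergence[where w = "\<lambda>_. 1"])
      show "AE z in std_normal_distribution. (\<lambda>n. iexp (t * (\<sigma> (Suc n) * z))) \<longlonglongrightarrow> iexp (t * (\<sigma>0 * z))"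
        by (intro AE_I2 tendsto_intros LIMSEQ_Suc[OF \<sigma>(2)])
    qed auto
    ultimately have "(\<integral>\<omega>. iexp (t * Z \<omega>) \<partial>M) = (\<integral>z. iexp (t * (\<sigma>0 * z)) \<partial>std_normal_distribution)"
      by (simp add: LIMSEQ_unique)
    then show "char (distr M borel Z) t = char (distr std_normal_distribution borel (\<lambda>z. \<sigma>0 * z)) t"
      by (simp add: char_def integral_distr)
  qed
qed

section \<open>Bounds for the exit event at a fixed noise level\<close>

text \<open>The discounted solution minus the initial value is the almost sure limit of \<open>e\<close> times the Gaussian noise
  sums over \<open>{0..T}\<close>.\<close>

lemma (in prob_space) terminal_law:
  assumes W: "standard_wiener M W" and X: "solves_linear M lam e W X" and X0: "AE \<omega> in M. X 0 \<omega> = x0"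
    and pos: "0 < lam" "0 < e" "0 < T"
  shows "prob {\<omega>\<in>space M. y < exp (- lam * T) * X T \<omega>}
    = gauss_tail ((y - x0) / (e * sqrt ((1 - exp (- 2 * lam * T)) / (2 * lam))))"
proof -
  define \<sigma> where "\<sigma> = sqrt ((1 - exp (- 2 * lam * T)) / (2 * lam))"
  define Z where "Z \<omega> = (exp (- lam * T) * X T \<omega> - X 0 \<omega>) / e" for \<omega>
  interpret N: prob_space std_normal_distribution by (rule prob_space_normal_density) simp
  have \<sigma>: "0 < \<sigma>" using pos by (simp add: \<sigma>_def)
  have Xm[measurable]: "X T \<in> borel_measurable M" "X 0 \<in> borel_measurable M"
    using solves_linearD(1)[OF X] pos by auto
  have Zm[measurable]: "Z \<in> borel_measurable M" unfolding Z_def by measurable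
  have law: "distr M borel Z = distr std_normal_distribution borel (\<lambda>z. \<sigma> * z)"
  proof (rule gaussian_limit_law)
    show "distributed M lborel (noise_sum W lam T n 0) (normal_density 0 (sqrt (noise_var lam T n 0)))" if "0 < n" for n
      by (rule noise_sum_normal[OF W pos(3) that])
    show "0 < sqrt (noise_var lam T n 0)" if "0 < n" for n
      using noise_var_pos[OF pos(3) that] by simp
    show "(\<lambda>n. sqrt (noise_var lam T n 0)) \<longlonglongrightarrow> \<sigma>"
      unfolding \<sigma>_def by (intro tendsto_real_sqrt noise_var_tendsto) (use pos in auto)
    show "AE \<omega> in M. (\<lambda>n. noise_sum W lam T n 0 \<omega>) \<longlonglongrightarrow> Z \<omega>"
      using noise_sum_tendsto[OF X less_imp_le[OF pos(3)]]
    proof eventually_elim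
      case (elim \<omega>)
      then have "(\<lambda>n. e * noise_sum W lam T n 0 \<omega> / e) \<longlonglongrightarrow> Z \<omega>"
        unfolding Z_def by (intro tendsto_divide tendsto_const) (use pos in auto)
      then show ?case using pos by simp
    qed
  qed (rule Zm)
  have "prob {\<omega>\<in>space M. y < exp (- lam * T) * X T \<omega>} = prob {\<omega>\<in>space M. (y - x0) / e < Z \<omega>}"
  proof (rule measure_eq_AE)
    show "AE \<omega> in M. (\<omega> \<in> {\<omega>\<in>space M. y < exp (- lam * T) * X T \<omega>}) = (\<omega> \<in> {\<omega>\<in>space M. (y - x0) / e < Z \<omega>})"
      using X0 by eventually_elim (use pos in \<open>simp add: Z_def divide_less_cancel\<close>)
  qed measurable
  also have "\<dots> = measure (distr M borel Z) {(y - x0) / e<..}"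
    by (subst measure_distr) (auto simp: vimage_def Int_def conj_commute)
  also have "\<dots> = N.prob {z. (y - x0) / e < \<sigma> * z}"
    unfolding law by (subst measure_distr) (auto simp: vimage_def)
  also have "{z. (y - x0) / e < \<sigma> * z} = {(y - x0) / (e * \<sigma>)<..}"
    using \<sigma> pos by (auto simp: field_simps)
  finally show ?thesis unfolding gauss_tail_def \<sigma>_def .
qed

text \<open>If neither level has been hit first, neither has been hit at all, and the intermediate value
  theorem keeps the path between them.\<close>

lemma hits_first_dichotomy:
  fixes x :: "real \<Rightarrow> real"
  assumes cont: "continuous_on {0..} x" and x0: "qm < x 0" "x 0 < qp" and T: "0 \<le> T"
    and no: "\<not> hits_first x qp qm T" "\<not> hits_first x qm qp T"
  shows "qm < x T \<and> x T < qp"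
proof -
  let ?Y = "\<lambda>t (u::unit). x t"
  have ne: "qm \<noteq> qp" using x0 by auto
  have no_hit: "x t \<notin> {qm, qp}" if t: "0 \<le> t" "t \<le> T" for t
  proof (rule hitting_time_cases[where Y = ?Y and \<omega> = "()" and S = "{qm, qp}"])
    fix s assume s: "hitting_time ?Y {qm, qp} () = ereal s" "0 \<le> s" "x s \<in> {qm, qp}" "\<And>t. 0 \<le> t \<Longrightarrow> t < s \<Longrightarrow> x t \<notin> {qm, qp}"
    have "\<not> s \<le> T"
    proof
      assume "s \<le> T"
      have ne_other: "x r \<noteq> (if x s = qp then qm else qp)" if "r \<in> {0..s}" for r
        using s(3) s(4)[of r] that ne by (cases "r = s") auto
      have "hits_first x qp qm T \<or> hits_first x qm qp T"
      proof (cases "x s = qp")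
        case True
        have "hits_first x qp qm T" unfolding hits_first_def
          by (rule bexI[of _ s]) (use ne_other True s(2) \<open>s \<le> T\<close> in auto)
        then show ?thesis ..
      next
        case False
        have "hits_first x qm qp T" unfolding hits_first_def
          by (rule bexI[of _ s]) (use ne_other False s(2,3) \<open>s \<le> T\<close> in auto)
        then show ?thesis ..
      qed
      then show False using no by simp
    qed
    then show ?thesis using s(4)[of t] t by auto
  qed (use cont t in auto)
  have cT: "continuous_on {0..T} x" by (rule continuous_on_subset[OF cont]) auto
  show ?thesis
  proof (intro conjI; rule ccontr)
    assume "\<not> qm < x T"
    then obtain t where "0 \<le> t" "t \<le> T" "x t = qm"
      using IVT2'[of x T qm 0, OF _ _ T cT] x0 by auto
    then show False using no_hit[of t] by auto
  next
    assume "\<not> x T < qp"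
    then obtain t where "0 \<le> t" "t \<le> T" "x t = qp"
      using IVT'[of x 0 qp T, OF _ _ T cT] x0 by auto
    then show False using no_hit[of t] by auto
  qed
qed

text \<open>With the notation of the proof, \<open>Y = exp (-lam \<tau>) (qp + e Np)\<close> on exit at \<open>qp\<close>, and \<open>e \<bar>Np\<bar> > \<delta>\<close> has
  conditional probability at most \<open>2 d\<close>. So \<open>Y\<close> can be replaced by \<open>exp (-lam \<tau>) (qp - \<delta>)\<close> and
  \<open>exp (-lam \<tau>) (qp + \<delta>)\<close>. For the upper bound the two other ways to make \<open>Y\<close> positive are counted:
  exit at \<open>qm\<close>, after which the noise has to outweigh \<open>\<bar>qm\<bar>\<close>, and no exit by time \<open>T\<close>, in which case \<open>Y\<close>
  is within \<open>\<eta>\<close> of \<open>0\<close>.\<close>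

lemma (in prob_space) exit_bounds_horizon:
  fixes X W :: "real \<Rightarrow> 'a \<Rightarrow> real"
  assumes W: "standard_wiener M W" and X: "solves_linear M lam e W X" and X0: "AE \<omega> in M. X 0 \<omega> = x0"
    and pos: "0 < lam" "0 < e" "0 < T" and q: "qm < x0" "x0 < 0" "0 < qp"
    and y: "0 \<le> y" and \<delta>: "0 < \<delta>"
  defines "\<tau> \<equiv> \<lambda>\<omega>. real_of_ereal (hitting_time X {qm, qp} \<omega>)"
    and "CT \<equiv> {\<omega>\<in>space M. hits_first (\<lambda>t. X t \<omega>) qp qm T}"
    and "Y \<equiv> \<lambda>\<omega>. exp (- lam * T) * X T \<omega>"
    and "d \<equiv> exp (- lam * (\<delta> / e)\<^sup>2)"
    and "\<eta> \<equiv> exp (- lam * T) * max \<bar>qm\<bar> qp"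
  shows "prob {\<omega>\<in>CT. y < exp (- lam * \<tau> \<omega>) * (qp - \<delta>)} \<le> prob {\<omega>\<in>space M. y < Y \<omega>} + prob CT * d"
    and "prob {\<omega>\<in>space M. y < Y \<omega>} \<le> prob {\<omega>\<in>CT. y < exp (- lam * \<tau> \<omega>) * (qp + \<delta>)} + prob CT * d
      + exp (- lam * (qm / e)\<^sup>2) + (prob {\<omega>\<in>space M. - \<eta> < Y \<omega>} - prob {\<omega>\<in>space M. \<eta> < Y \<omega>})"
proof -
  have ne: "qp \<noteq> qm" "qm \<noteq> qp" using q by auto
  have [measurable]: "\<tau> \<in> borel_measurable M" unfolding \<tau>_def by (rule hitting_time_measurable(2)[OF X ne(2)])
  have [measurable]: "X T \<in> borel_measurable M" using solves_linearD(1)[OF X, of T] pos by simp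
  have Ym[measurable]: "Y \<in> borel_measurable M" unfolding Y_def by measurable
  have CT[measurable]: "CT \<in> events" unfolding CT_def
    by (rule hits_first_measurable) (use solves_linearD[OF X] in auto)
  define DT where "DT = {\<omega>\<in>space M. hits_first (\<lambda>t. X t \<omega>) qm qp T}"
  have DT[measurable]: "DT \<in> events" unfolding DT_def
    by (rule hits_first_measurable) (use solves_linearD[OF X] in auto)
  define Np where "Np \<omega> = (exp (lam * \<tau> \<omega>) * Y \<omega> - qp) / e" for \<omega>
  define Nm where "Nm \<omega> = (exp (lam * \<tau> \<omega>) * Y \<omega> - qm) / e" for \<omega>
  have Npm[measurable]: "Np \<in> borel_measurable M" "Nm \<in> borel_measurable M"
    unfolding Np_def Nm_def by measurable
  have comm: "{qp, qm} = {qm, qp}" by auto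
  have CTsub: "CT \<subseteq> space M" "DT \<subseteq> space M" by (auto simp: CT_def DT_def)
  have tailp: "prob {\<omega>\<in>CT. \<delta> / e < sg * Np \<omega>} \<le> prob CT * d" if "\<bar>sg\<bar> = 1" for sg
    using overshoot_tail[OF W X X0 pos divide_nonneg_nonneg[OF less_imp_le[OF \<delta>] less_imp_le[OF pos(2)]] ne(1) that]
    unfolding CT_def d_def Np_def Y_def \<tau>_def comm by (simp only: mem_Collect_eq conj_assoc)
  have tailm: "prob {\<omega>\<in>DT. - qm / e < Nm \<omega>} \<le> exp (- lam * (qm / e)\<^sup>2)"
  proof -
    have c0: "0 \<le> - qm / e" using q pos by (simp add: divide_nonpos_pos)
    have "prob {\<omega>\<in>DT. - qm / e < Nm \<omega>} \<le> prob DT * exp (- lam * (- qm / e)\<^sup>2)"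
      using overshoot_tail[OF W X X0 pos c0 ne(2) abs_one]
      unfolding DT_def Nm_def Y_def \<tau>_def by (simp only: mem_Collect_eq conj_assoc mult_1)
    also have "\<dots> \<le> 1 * exp (- lam * (- qm / e)\<^sup>2)" by (rule mult_right_mono) auto
    finally show ?thesis by simp
  qed
  have ee: "exp (- lam * \<tau> \<omega>) * exp (lam * \<tau> \<omega>) = 1" for \<omega> by (simp flip: exp_add)
  have YNp: "Y \<omega> = exp (- lam * \<tau> \<omega>) * (qp + e * Np \<omega>)" for \<omega>
    using pos ee[of \<omega>] by (simp add: Np_def mult.assoc[symmetric])
  have YNm: "Y \<omega> = exp (- lam * \<tau> \<omega>) * (qm + e * Nm \<omega>)" for \<omega>
    using pos ee[of \<omega>] by (simp add: Nm_def mult.assoc[symmetric])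
  have m1: "{\<omega>\<in>CT. y < exp (- lam * \<tau> \<omega>) * (qp - \<delta>)} \<in> events"
    "{\<omega>\<in>CT. y < exp (- lam * \<tau> \<omega>) * (qp + \<delta>)} \<in> events" "{\<omega>\<in>CT. \<delta> / e < sg * Np \<omega>} \<in> events"
    "{\<omega>\<in>DT. - qm / e < Nm \<omega>} \<in> events" for sg
  proof -
    have *: "{\<omega>\<in>A. P \<omega>} \<in> events" if "A \<in> events" "{\<omega>\<in>space M. P \<omega>} \<in> events" for A P
    proof -
      have "{\<omega>\<in>A. P \<omega>} = A \<inter> {\<omega>\<in>space M. P \<omega>}" using sets.sets_into_space[OF that(1)] by auto
      then show ?thesis using that by auto
    qed
    show "{\<omega>\<in>CT. y < exp (- lam * \<tau> \<omega>) * (qp - \<delta>)} \<in> events"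
    "{\<omega>\<in>CT. y < exp (- lam * \<tau> \<omega>) * (qp + \<delta>)} \<in> events" "{\<omega>\<in>CT. \<delta> / e < sg * Np \<omega>} \<in> events"
    "{\<omega>\<in>DT. - qm / e < Nm \<omega>} \<in> events"
      by (rule *, measurable)+
  qed
  have m2: "{\<omega>\<in>space M. y < Y \<omega>} \<in> events" "{\<omega>\<in>space M. - \<eta> < Y \<omega>} \<in> events" "{\<omega>\<in>space M. \<eta> < Y \<omega>} \<in> events"
    by measurable
  have "prob {\<omega>\<in>CT. y < exp (- lam * \<tau> \<omega>) * (qp - \<delta>)}
      \<le> prob ({\<omega>\<in>space M. y < Y \<omega>} \<union> {\<omega>\<in>CT. \<delta> / e < - 1 * Np \<omega>})"
  proof (rule finite_measure_mono)
    show "{\<omega>\<in>CT. y < exp (- lam * \<tau> \<omega>) * (qp - \<delta>)} \<subseteq> {\<omega>\<in>space M. y < Y \<omega>} \<union> {\<omega>\<in>CT. \<delta> / e < - 1 * Np \<omega>}"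
    proof (intro subsetI, rule ccontr)
      fix \<omega> assume \<omega>: "\<omega> \<in> {\<omega>\<in>CT. y < exp (- lam * \<tau> \<omega>) * (qp - \<delta>)}"
        and "\<omega> \<notin> {\<omega>\<in>space M. y < Y \<omega>} \<union> {\<omega>\<in>CT. \<delta> / e < - 1 * Np \<omega>}"
      then have "Y \<omega> \<le> y" "- Np \<omega> \<le> \<delta> / e" using CTsub by auto
      then have "- \<delta> \<le> e * Np \<omega>" using pos by (simp add: field_simps)
      then have "exp (- lam * \<tau> \<omega>) * (qp - \<delta>) \<le> Y \<omega>" unfolding YNp by (intro mult_left_mono) auto
      then show False using \<omega> \<open>Y \<omega> \<le> y\<close> by auto
    qed
  qed (use m1 m2 in \<open>intro sets.Un\<close>)
  also have "\<dots> \<le> prob {\<omega>\<in>space M. y < Y \<omega>} + prob {\<omega>\<in>CT. \<delta> / e < - 1 * Np \<omega>}"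
    by (rule measure_Un_le[OF m2(1) m1(3)])
  also have "\<dots> \<le> prob {\<omega>\<in>space M. y < Y \<omega>} + prob CT * d"
    using tailp[of "- 1"] by simp
  finally show "prob {\<omega>\<in>CT. y < exp (- lam * \<tau> \<omega>) * (qp - \<delta>)} \<le> prob {\<omega>\<in>space M. y < Y \<omega>} + prob CT * d" .
  let ?R = "{\<omega>\<in>space M. - \<eta> < Y \<omega>} - {\<omega>\<in>space M. \<eta> < Y \<omega>}"
  let ?U = "({\<omega>\<in>CT. y < exp (- lam * \<tau> \<omega>) * (qp + \<delta>)} \<union> {\<omega>\<in>CT. \<delta> / e < 1 * Np \<omega>}) \<union> {\<omega>\<in>DT. - qm / e < Nm \<omega>} \<union> ?R"
  have "prob {\<omega>\<in>space M. y < Y \<omega>} \<le> prob ?U"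
  proof (rule finite_measure_mono_AE)
    show "AE \<omega> in M. \<omega> \<in> {\<omega>\<in>space M. y < Y \<omega>} \<longrightarrow> \<omega> \<in> ?U"
      using X0
    proof (eventually_elim, intro impI)
      fix \<omega> assume x0: "X 0 \<omega> = x0" and \<omega>: "\<omega> \<in> {\<omega>\<in>space M. y < Y \<omega>}"
      have cont: "continuous_on {0..} (\<lambda>t. X t \<omega>)" using solves_linearD(2)[OF X] \<omega> by auto
      consider "\<omega> \<in> CT" | "\<omega> \<in> DT" | "\<omega> \<notin> CT" "\<omega> \<notin> DT" by blast
      then show "\<omega> \<in> ?U"
      proof cases
        case 1
        have "y < exp (- lam * \<tau> \<omega>) * (qp + \<delta>)" if "\<not> \<delta> / e < Np \<omega>"
        proof -
          have "e * Np \<omega> \<le> \<delta>" using that pos by (simp add: field_simps)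
          then have "Y \<omega> \<le> exp (- lam * \<tau> \<omega>) * (qp + \<delta>)" unfolding YNp by (intro mult_left_mono) auto
          then show ?thesis using \<omega> by auto
        qed
        then show ?thesis using 1 by auto
      next
        case 2
        have "0 < Y \<omega>" using \<omega> y by auto
        then have "0 < qm + e * Nm \<omega>" unfolding YNm by (simp add: zero_less_mult_iff)
        then have "- qm / e < Nm \<omega>" using pos by (simp add: field_simps)
        then show ?thesis using 2 by auto
      next
        case 3
        then have "qm < X T \<omega> \<and> X T \<omega> < qp"
          using \<omega> x0 q pos by (intro hits_first_dichotomy[OF cont]) (auto simp: CT_def DT_def)
        then have "\<bar>X T \<omega>\<bar> < max \<bar>qm\<bar> qp" by auto
        then have "\<bar>Y \<omega>\<bar> < \<eta>" unfolding Y_def \<eta>_def by (simp add: abs_mult)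
        then show ?thesis using \<omega> by auto
      qed
    qed
  qed (use m1 m2 in \<open>intro sets.Un sets.Diff\<close>)
  also have "\<dots> \<le> prob {\<omega>\<in>CT. y < exp (- lam * \<tau> \<omega>) * (qp + \<delta>)} + prob {\<omega>\<in>CT. \<delta> / e < 1 * Np \<omega>}
      + prob {\<omega>\<in>DT. - qm / e < Nm \<omega>} + prob ?R"
    using m1 m2 by (intro order_trans[OF measure_Un_le] add_right_mono) (auto intro!: sets.Un)
  also have "prob ?R = prob {\<omega>\<in>space M. - \<eta> < Y \<omega>} - prob {\<omega>\<in>space M. \<eta> < Y \<omega>}"
  proof (rule finite_measure_Diff)
    have "0 \<le> \<eta>" using q by (simp add: \<eta>_def)
    then show "{\<omega>\<in>space M. \<eta> < Y \<omega>} \<subseteq> {\<omega>\<in>space M. - \<eta> < Y \<omega>}" by auto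
  qed (use m2 in auto)
  finally show "prob {\<omega>\<in>space M. y < Y \<omega>} \<le> prob {\<omega>\<in>CT. y < exp (- lam * \<tau> \<omega>) * (qp + \<delta>)} + prob CT * d
      + exp (- lam * (qm / e)\<^sup>2) + (prob {\<omega>\<in>space M. - \<eta> < Y \<omega>} - prob {\<omega>\<in>space M. \<eta> < Y \<omega>})"
    using tailp[of 1] tailm by linarith
qed

lemma hits_first_limit:
  fixes X :: "real \<Rightarrow> 'w \<Rightarrow> real"
  assumes cont: "\<And>\<omega>. \<omega> \<in> space M \<Longrightarrow> continuous_on {0..} (\<lambda>t. X t \<omega>)" and ne: "qm \<noteq> qp"
  defines "\<tau> \<equiv> hitting_time X {qm, qp}"
  shows "{\<omega>\<in>space M. \<tau> \<omega> < \<infinity> \<and> X (real_of_ereal (\<tau> \<omega>)) \<omega> = qp}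
    = (\<Union>n. {\<omega>\<in>space M. hits_first (\<lambda>t. X t \<omega>) qp qm (real (Suc n))})" (is "?C = (\<Union>n. ?E n)")
    and "incseq (\<lambda>n. {\<omega>\<in>space M. hits_first (\<lambda>t. X t \<omega>) qp qm (real (Suc n))})"
proof -
  have comm: "{qp, qm} = {qm, qp}" by auto
  have iff: "hits_first (\<lambda>t. X t \<omega>) qp qm t \<longleftrightarrow> \<tau> \<omega> \<le> ereal t \<and> X (real_of_ereal (\<tau> \<omega>)) \<omega> = qp"
    if "\<omega> \<in> space M" for \<omega> t
    using hits_first_iff_hitting_time[where Y = X and \<omega> = \<omega>, OF cont[OF that] ne[symmetric]] unfolding comm \<tau>_def .
  have "\<tau> \<omega> < \<infinity> \<longleftrightarrow> (\<exists>n. \<tau> \<omega> \<le> ereal (real (Suc n)))" for \<omega>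
  proof (cases "\<tau> \<omega>")
    case (real r)
    obtain n where "r \<le> real n" using real_arch_simple by blast
    then have "r \<le> real (Suc n)" by simp
    then show ?thesis using real by auto
  qed auto
  then show "?C = (\<Union>n. ?E n)" using iff by auto
  show "incseq ?E"
    unfolding incseq_def hits_first_def by fastforce
qed

text \<open>The horizon tends to infinity. The term for late exits disappears, because it is the
  probability that a Gaussian variable is in an interval that shrinks to a point. With \<open>y = 0\<close> the bounds
  compare the probability of exit at \<open>qp\<close> with a Gaussian tail.\<close>

lemma (in prob_space) exit_bounds:
  fixes X W :: "real \<Rightarrow> 'a \<Rightarrow> real"
  assumes W: "standard_wiener M W" and X: "solves_linear M lam e W X" and X0: "AE \<omega> in M. X 0 \<omega> = x0"
    and pos: "0 < lam" "0 < e" and q: "qm < x0" "x0 < 0" "0 < qp"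
    and y: "0 \<le> y" and \<delta>: "0 < \<delta>"
  defines "\<tau> \<equiv> \<lambda>\<omega>. real_of_ereal (hitting_time X {qm, qp} \<omega>)"
    and "C \<equiv> {\<omega>\<in>space M. hitting_time X {qm, qp} \<omega> < \<infinity> \<and> X (real_of_ereal (hitting_time X {qm, qp} \<omega>)) \<omega> = qp}"
    and "d \<equiv> exp (- lam * (\<delta> / e)\<^sup>2)"
  shows "prob {\<omega>\<in>C. y < exp (- lam * \<tau> \<omega>) * (qp - \<delta>)} \<le> gauss_tail ((y - x0) * sqrt (2 * lam) / e) + prob C * d"
    and "gauss_tail ((y - x0) * sqrt (2 * lam) / e) \<le> prob {\<omega>\<in>C. y < exp (- lam * \<tau> \<omega>) * (qp + \<delta>)} + prob C * d
      + exp (- lam * (qm / e)\<^sup>2)"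
proof -
  have ne: "qm \<noteq> qp" using q by auto
  define T where "T n = real (Suc n)" for n
  have Tpos: "0 < T n" for n by (simp add: T_def)
  define CT where "CT n = {\<omega>\<in>space M. hits_first (\<lambda>t. X t \<omega>) qp qm (T n)}" for n
  have C: "C = (\<Union>n. CT n)" and inc: "incseq CT"
    using hits_first_limit[of M X qm qp, OF solves_linearD(2)[OF X] ne] unfolding C_def CT_def T_def by auto
  have [measurable]: "\<tau> \<in> borel_measurable M" unfolding \<tau>_def by (rule hitting_time_measurable(2)[OF X ne])
  have CTm[measurable]: "CT n \<in> events" for n unfolding CT_def
    by (rule hits_first_measurable) (use solves_linearD[OF X] in auto)
  have Cm[measurable]: "C \<in> events" unfolding C by measurable
  have le: "CT n \<subseteq> C" for n unfolding C by auto
  have sub: "{\<omega>\<in>A. P \<omega>} \<in> events" if "A \<in> events" "{\<omega>\<in>space M. P \<omega>} \<in> events" for A P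
  proof -
    have "{\<omega>\<in>A. P \<omega>} = A \<inter> {\<omega>\<in>space M. P \<omega>}" using sets.sets_into_space[OF that(1)] by auto
    then show ?thesis using that by auto
  qed
  have PC: "prob (CT n) * d \<le> prob C * d" for n
    by (intro mult_right_mono finite_measure_mono le) (auto simp: d_def)
  define \<sigma> where "\<sigma> n = sqrt ((1 - exp (- 2 * lam * T n)) / (2 * lam))" for n
  define K where "K = max \<bar>qm\<bar> qp"
  define \<eta> where "\<eta> n = exp (- lam * T n) * K" for n
  have G: "prob {\<omega>\<in>space M. z < exp (- lam * T n) * X (T n) \<omega>} = gauss_tail ((z - x0) / (e * \<sigma> n))" for z n
    using terminal_law[OF W X X0 pos Tpos] unfolding \<sigma>_def .
  have expT: "(\<lambda>n. exp (- c * T n)) \<longlonglongrightarrow> 0" if "0 < c" for c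
    unfolding T_def using that by real_asymp
  have \<sigma>lim: "\<sigma> \<longlonglongrightarrow> 1 / sqrt (2 * lam)"
  proof -
    have "(\<lambda>n. sqrt ((1 - exp (- (2 * lam) * T n)) / (2 * lam))) \<longlonglongrightarrow> sqrt ((1 - 0) / (2 * lam))"
      by (intro tendsto_intros expT) (use pos in auto)
    then show ?thesis by (simp add: \<sigma>_def[abs_def] real_sqrt_divide)
  qed
  have glim: "(\<lambda>n. gauss_tail ((z n - x0) / (e * \<sigma> n))) \<longlonglongrightarrow> gauss_tail ((z0 - x0) * sqrt (2 * lam) / e)"
    if "z \<longlonglongrightarrow> z0" for z z0
  proof -
    have "(\<lambda>n. (z n - x0) / (e * \<sigma> n)) \<longlonglongrightarrow> (z0 - x0) / (e * (1 / sqrt (2 * lam)))"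
      by (intro tendsto_intros that \<sigma>lim) (use pos in auto)
    then show ?thesis by (intro isCont_tendsto_compose[OF gauss_tail_isCont]) (simp add: field_simps)
  qed
  have \<eta>lim: "\<eta> \<longlonglongrightarrow> 0"
    using tendsto_mult[OF expT[OF pos(1)] tendsto_const[of K]] by (simp add: \<eta>_def[abs_def])
  have L1: "(\<lambda>n. prob {\<omega>\<in>CT n. y < exp (- lam * \<tau> \<omega>) * (qp - \<delta>)}) \<longlonglongrightarrow> prob (\<Union>n. {\<omega>\<in>CT n. y < exp (- lam * \<tau> \<omega>) * (qp - \<delta>)})"
  proof (rule finite_Lim_measure_incseq)
    show "range (\<lambda>n. {\<omega>\<in>CT n. y < exp (- lam * \<tau> \<omega>) * (qp - \<delta>)}) \<subseteq> events"
      using sub[OF CTm] by auto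
    show "incseq (\<lambda>n. {\<omega>\<in>CT n. y < exp (- lam * \<tau> \<omega>) * (qp - \<delta>)})"
      using inc unfolding incseq_def by blast
  qed
  have UC: "(\<Union>n. {\<omega>\<in>CT n. y < exp (- lam * \<tau> \<omega>) * (qp - \<delta>)}) = {\<omega>\<in>C. y < exp (- lam * \<tau> \<omega>) * (qp - \<delta>)}"
    unfolding C by auto
  have L2: "(\<lambda>n. gauss_tail ((y - x0) / (e * \<sigma> n)) + prob C * d) \<longlonglongrightarrow> gauss_tail ((y - x0) * sqrt (2 * lam) / e) + prob C * d"
    by (intro tendsto_add glim tendsto_const)
  have le1: "prob {\<omega>\<in>CT n. y < exp (- lam * \<tau> \<omega>) * (qp - \<delta>)} \<le> gauss_tail ((y - x0) / (e * \<sigma> n)) + prob C * d" for n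
    using exit_bounds_horizon(1)[OF W X X0 pos Tpos q y \<delta>, of n] PC[of n]
    unfolding G \<tau>_def CT_def[symmetric] d_def[symmetric] by linarith
  show "prob {\<omega>\<in>C. y < exp (- lam * \<tau> \<omega>) * (qp - \<delta>)} \<le> gauss_tail ((y - x0) * sqrt (2 * lam) / e) + prob C * d"
    by (rule LIMSEQ_le[OF L1[unfolded UC] L2]) (use le1 in blast)
  have le2: "gauss_tail ((y - x0) / (e * \<sigma> n)) \<le> prob {\<omega>\<in>C. y < exp (- lam * \<tau> \<omega>) * (qp + \<delta>)} + prob C * d
      + exp (- lam * (qm / e)\<^sup>2) + (gauss_tail ((- \<eta> n - x0) / (e * \<sigma> n)) - gauss_tail ((\<eta> n - x0) / (e * \<sigma> n)))" for n
  proof -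
    have "prob {\<omega>\<in>CT n. y < exp (- lam * \<tau> \<omega>) * (qp + \<delta>)} \<le> prob {\<omega>\<in>C. y < exp (- lam * \<tau> \<omega>) * (qp + \<delta>)}"
      by (rule finite_measure_mono) (use le[of n] sub[OF Cm] in auto)
    then show ?thesis
      using exit_bounds_horizon(2)[OF W X X0 pos Tpos q y \<delta>, of n] PC[of n]
      unfolding G \<tau>_def CT_def[symmetric] d_def[symmetric] K_def[symmetric] \<eta>_def[symmetric] by linarith
  qed
  have L3: "(\<lambda>n. prob {\<omega>\<in>C. y < exp (- lam * \<tau> \<omega>) * (qp + \<delta>)} + prob C * d
      + exp (- lam * (qm / e)\<^sup>2) + (gauss_tail ((- \<eta> n - x0) / (e * \<sigma> n)) - gauss_tail ((\<eta> n - x0) / (e * \<sigma> n))))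
      \<longlonglongrightarrow> prob {\<omega>\<in>C. y < exp (- lam * \<tau> \<omega>) * (qp + \<delta>)} + prob C * d + exp (- lam * (qm / e)\<^sup>2)
        + (gauss_tail ((- 0 - x0) * sqrt (2 * lam) / e) - gauss_tail ((0 - x0) * sqrt (2 * lam) / e))"
    by (intro tendsto_add tendsto_diff tendsto_const glim tendsto_minus \<eta>lim)
  have "gauss_tail ((y - x0) * sqrt (2 * lam) / e) \<le> prob {\<omega>\<in>C. y < exp (- lam * \<tau> \<omega>) * (qp + \<delta>)} + prob C * d
      + exp (- lam * (qm / e)\<^sup>2) + (gauss_tail ((- 0 - x0) * sqrt (2 * lam) / e) - gauss_tail ((0 - x0) * sqrt (2 * lam) / e))"
    by (rule LIMSEQ_le[OF glim[OF tendsto_const[of y]] L3]) (use le2 in blast)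
  then show "gauss_tail ((y - x0) * sqrt (2 * lam) / e) \<le> prob {\<omega>\<in>C. y < exp (- lam * \<tau> \<omega>) * (qp + \<delta>)} + prob C * d
      + exp (- lam * (qm / e)\<^sup>2)" by simp
qed

section \<open>The law of the exit time on the rare event\<close>

text \<open>The bounds of the previous section, read as a squeeze: \<open>P\<close> is the probability of the rare event,
  \<open>F\<close> the probability of the rare event and a large value, \<open>d\<close> and \<open>er\<close> are the error terms. First
  \<open>P\<close> is compared with the Gaussian tail, then \<open>F\<close> with \<open>P\<close>.\<close>

lemma conditional_tail_limit:
  fixes s d er P F wm wp :: "nat \<Rightarrow> real"
  assumes s: "filterlim s at_top sequentially"
    and er: "(\<lambda>n. er n / gauss_tail (s n)) \<longlonglongrightarrow> 0" and d: "d \<longlonglongrightarrow> 0" "\<And>n. 0 \<le> d n"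
    and wm: "wm \<longlonglongrightarrow> v" "\<And>n. 0 \<le> wm n" and wp: "wp \<longlonglongrightarrow> v" "\<And>n. 0 \<le> wp n"
    and P1: "\<And>n. P n \<le> gauss_tail (s n) + P n * d n"
    and P2: "\<And>n. gauss_tail (s n) \<le> P n + P n * d n + er n"
    and F1: "\<And>n. F n \<le> gauss_tail (s n + wm n / s n) + P n * d n"
    and F2: "\<And>n. gauss_tail (s n + wp n / s n) \<le> F n + P n * d n + er n"
  shows "\<forall>\<^sub>F n in sequentially. 0 < P n" and "(\<lambda>n. F n / P n) \<longlonglongrightarrow> exp (- v)"
proof -
  define G where "G n = gauss_tail (s n)" for n
  have G: "0 < G n" for n by (simp add: G_def gauss_tail_pos)
  define p where "p n = P n / G n" for n
  have P: "P n = p n * G n" for n using G[of n] by (simp add: p_def)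
  have er': "(\<lambda>n. er n / G n) \<longlonglongrightarrow> 0" using er by (simp add: G_def)
  have u: "p n \<le> 1 + p n * d n" for n
  proof -
    have "p n * G n \<le> (1 + p n * d n) * G n" using P1[of n] unfolding G_def[symmetric] P by (simp add: algebra_simps)
    then show ?thesis using G[of n] by simp
  qed
  have l: "1 \<le> p n + p n * d n + er n / G n" for n
  proof -
    have "1 * G n \<le> (p n + p n * d n + er n / G n) * G n"
      using P2[of n] G[of n] unfolding G_def[symmetric] P by (simp add: algebra_simps)
    then show ?thesis using G[of n] by (simp only: mult_le_cancel_right_pos)
  qed
  have plim: "p \<longlonglongrightarrow> 1"
  proof (rule tendsto_sandwich)
    have ev: "\<forall>\<^sub>F n in sequentially. d n < 1" using d(1) by (rule order_tendstoD) simp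
    show "\<forall>\<^sub>F n in sequentially. (1 - er n / G n) / (1 + d n) \<le> p n"
    proof (rule always_eventually, rule allI)
      fix n
      have "1 - er n / G n \<le> p n * (1 + d n)" using l[of n] by (simp add: algebra_simps)
      then show "(1 - er n / G n) / (1 + d n) \<le> p n"
        using d(2)[of n] by (subst pos_divide_le_eq) auto
    qed
    show "\<forall>\<^sub>F n in sequentially. p n \<le> 1 / (1 - d n)"
      using ev
    proof eventually_elim
      case (elim n)
      have "p n * (1 - d n) \<le> 1" using u[of n] by (simp add: algebra_simps)
      then show ?case using elim by (subst pos_le_divide_eq) auto
    qed
    show "(\<lambda>n. (1 - er n / G n) / (1 + d n)) \<longlonglongrightarrow> 1"
      using tendsto_divide[OF tendsto_diff[OF tendsto_const[of 1] er'] tendsto_add[OF tendsto_const[of 1] d(1)]] by simp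
    show "(\<lambda>n. 1 / (1 - d n)) \<longlonglongrightarrow> 1"
      using tendsto_divide[OF tendsto_const[of 1] tendsto_diff[OF tendsto_const[of 1] d(1)]] by simp
  qed
  have "\<forall>\<^sub>F n in sequentially. 0 < p n" using plim by (rule order_tendstoD) simp
  then show Ppos: "\<forall>\<^sub>F n in sequentially. 0 < P n"
    by eventually_elim (use G P in simp)
  have rm: "(\<lambda>n. gauss_tail (s n + wm n / s n) / G n) \<longlonglongrightarrow> exp (- v)"
    unfolding G_def by (rule gauss_tail_ratio[OF s wm])
  have rp: "(\<lambda>n. gauss_tail (s n + wp n / s n) / G n) \<longlonglongrightarrow> exp (- v)"
    unfolding G_def by (rule gauss_tail_ratio[OF s wp])
  show "(\<lambda>n. F n / P n) \<longlonglongrightarrow> exp (- v)"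
  proof (rule tendsto_sandwich)
    show "\<forall>\<^sub>F n in sequentially. (gauss_tail (s n + wp n / s n) / G n - er n / G n) / p n - d n \<le> F n / P n"
      using Ppos
    proof eventually_elim
      case (elim n)
      have "(gauss_tail (s n + wp n / s n) / G n - er n / G n) / p n - d n
          = (gauss_tail (s n + wp n / s n) - P n * d n - er n) / P n"
        using elim G[of n] by (simp add: p_def field_simps)
      also have "\<dots> \<le> F n / P n" using F2[of n] elim by (intro divide_right_mono) auto
      finally show ?case .
    qed
    show "\<forall>\<^sub>F n in sequentially. F n / P n \<le> (gauss_tail (s n + wm n / s n) / G n) / p n + d n"
      using Ppos
    proof eventually_elim
      case (elim n)
      have "F n / P n \<le> (gauss_tail (s n + wm n / s n) + P n * d n) / P n"
        using F1[of n] elim by (intro divide_right_mono) auto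
      also have "\<dots> = (gauss_tail (s n + wm n / s n) / G n) / p n + d n"
        using elim G[of n] by (simp add: p_def field_simps)
      finally show ?case .
    qed
    show "(\<lambda>n. (gauss_tail (s n + wp n / s n) / G n - er n / G n) / p n - d n) \<longlonglongrightarrow> exp (- v)"
      using tendsto_diff[OF tendsto_divide[OF tendsto_diff[OF rp er'] plim] d(1)] by simp
    show "(\<lambda>n. (gauss_tail (s n + wm n / s n) / G n) / p n + d n) \<longlonglongrightarrow> exp (- v)"
      using tendsto_add[OF tendsto_divide[OF rm plim] d(1)] by simp
  qed
qed

text \<open>The Gaussian level is \<open>s = \<bar>x0\<bar> sqrt (2 lam) / e\<close>. A value \<open>y = e\<^sup>2 w / (2 lam \<bar>x0\<bar>)\<close> raises it to
  \<open>s + w / s\<close>, which is the scale of the exponential overshoot. The error term for exit at \<open>qm\<close>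
  is \<open>exp (- (qm / x0)\<^sup>2 s\<^sup>2 / 2)\<close>, and \<open>qm < x0 < 0\<close> makes it small compared with the Gaussian tail at \<open>s\<close>.\<close>

lemma (in prob_space) exit_time_law:
  fixes W :: "real \<Rightarrow> 'a \<Rightarrow> real" and X :: "nat \<Rightarrow> real \<Rightarrow> 'a \<Rightarrow> real"
  assumes W: "standard_wiener M W" and X: "\<And>n. solves_linear M lam (e n) W (X n)"
    and X0: "\<And>n. AE \<omega> in M. X n 0 \<omega> = x0"
    and lam: "0 < lam" and q: "qm < x0" "x0 < 0" "0 < qp" and e: "\<And>n. 0 < e n" "e \<longlonglongrightarrow> 0" and v: "0 \<le> v"
  defines "\<tau> \<equiv> \<lambda>n \<omega>. real_of_ereal (hitting_time (X n) {qm, qp} \<omega>)"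
    and "C \<equiv> \<lambda>n. {\<omega>\<in>space M. hitting_time (X n) {qm, qp} \<omega> < \<infinity> \<and> X n (real_of_ereal (hitting_time (X n) {qm, qp} \<omega>)) \<omega> = qp}"
  shows "\<forall>\<^sub>F n in sequentially. 0 < prob (C n)"
    and "(\<lambda>n. prob {\<omega>\<in>C n. v < 2 * lam * \<bar>x0\<bar> * qp / (e n)\<^sup>2 * exp (- lam * \<tau> n \<omega>)} / prob (C n)) \<longlonglongrightarrow> exp (- v)"
proof -
  define s where "s n = \<bar>x0\<bar> * sqrt (2 * lam) / e n" for n
  \<comment> \<open>Any choice with \<open>0 < \<delta> n < qp\<close>, \<open>\<delta> n\<close> tending to \<open>0\<close> and \<open>\<delta> n / e n\<close> tending to infinity works.\<close>
  define \<delta> where "\<delta> n = qp * sqrt (e n) / (1 + sqrt (e n))" for n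
  define d where "d n = exp (- lam * (\<delta> n / e n)\<^sup>2)" for n
  define er where "er n = exp (- lam * (qm / e n)\<^sup>2)" for n
  \<comment> \<open>With \<open>w = wm\<close> the event \<open>y < exp (-lam \<tau>) (qp - \<delta>)\<close> is the event of the claim; \<open>wp\<close> does the same for \<open>qp + \<delta>\<close>.\<close>
  define wm where "wm n = v * (qp - \<delta> n) / qp" for n
  define wp where "wp n = v * (qp + \<delta> n) / qp" for n
  have er0: "filterlim e (at_right 0) sequentially"
    using e by (intro filterlim_atI' tendsto_imp_filterlim_at_right) (auto intro: always_eventually)
  have slim: "filterlim s at_top sequentially"
  proof -
    define c where "c = \<bar>x0\<bar> * sqrt (2 * lam)"
    have "0 < c" unfolding c_def by (rule mult_pos_pos) (use q lam in auto)
    then have "filterlim (\<lambda>y. c / y) at_top (at_right 0)" by real_asymp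
    then show ?thesis unfolding s_def c_def by (rule filterlim_compose[OF _ er0])
  qed
  have \<delta>lim: "\<delta> \<longlonglongrightarrow> 0"
  proof -
    have "((\<lambda>y. qp * sqrt y / (1 + sqrt y)) \<longlongrightarrow> 0) (at_right 0)" by real_asymp
    then show ?thesis unfolding \<delta>_def by (rule filterlim_compose[OF _ er0])
  qed
  have dlim: "d \<longlonglongrightarrow> 0"
  proof -
    have "((\<lambda>y. exp (- lam * (qp * sqrt y / (1 + sqrt y) / y)\<^sup>2)) \<longlongrightarrow> 0) (at_right 0)"
      using lam q by real_asymp
    then show ?thesis unfolding d_def \<delta>_def by (rule filterlim_compose[OF _ er0])
  qed
  have \<delta>: "0 < \<delta> n" "\<delta> n < qp" for n
    using e(1)[of n] q by (auto simp: \<delta>_def field_simps add_pos_pos)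
  have erlim: "(\<lambda>n. er n / gauss_tail (s n)) \<longlonglongrightarrow> 0"
  proof -
    have "1 < (qm / x0)\<^sup>2" using q by (intro one_less_power) (auto simp: less_divide_eq)
    then have "(\<lambda>n. exp (- (qm / x0)\<^sup>2 * (s n)\<^sup>2 / 2) / gauss_tail (s n)) \<longlonglongrightarrow> 0"
      by (rule gauss_tail_dominates[OF slim])
    moreover have "exp (- (qm / x0)\<^sup>2 * (s n)\<^sup>2 / 2) = er n" for n
      using q lam by (simp add: er_def s_def power_mult_distrib power_divide)
    ultimately show ?thesis by simp
  qed
  have arg: "((e n)\<^sup>2 * w / (2 * lam * \<bar>x0\<bar>) - x0) * sqrt (2 * lam) / e n = s n + w / s n" for w n
  proof -
    define S where "S = sqrt (2 * lam)"
    have S: "0 < S" using lam by (simp add: S_def)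
    have r: "2 * lam = S * S" using lam by (simp add: S_def)
    show ?thesis unfolding s_def S_def[symmetric] unfolding r
      using q S e(1)[of n] by (simp add: field_simps power2_eq_square)
  qed
  define P where "P n = prob (C n)" for n
  define F where "F n = prob {\<omega>\<in>C n. v < 2 * lam * \<bar>x0\<bar> * qp / (e n)\<^sup>2 * exp (- lam * \<tau> n \<omega>)}" for n
  have wmp: "0 \<le> wm n" "0 \<le> wp n" for n using \<delta>[of n] v q by (auto simp: wm_def wp_def)
  have ym: "0 \<le> (e n)\<^sup>2 * w / (2 * lam * \<bar>x0\<bar>)" if "0 \<le> w" for w n using that lam by simp
  have b1: "prob {\<omega>\<in>C n. y < exp (- lam * \<tau> n \<omega>) * (qp - \<delta> n)}
      \<le> gauss_tail ((y - x0) * sqrt (2 * lam) / e n) + prob (C n) * d n" if "0 \<le> y" for y n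
    using exit_bounds(1)[OF W X[of n] X0[of n] lam e(1)[of n] q that \<delta>(1)[of n]]
    unfolding C_def \<tau>_def d_def .
  have b2: "gauss_tail ((y - x0) * sqrt (2 * lam) / e n)
      \<le> prob {\<omega>\<in>C n. y < exp (- lam * \<tau> n \<omega>) * (qp + \<delta> n)} + prob (C n) * d n + er n" if "0 \<le> y" for y n
    using exit_bounds(2)[OF W X[of n] X0[of n] lam e(1)[of n] q that \<delta>(1)[of n]]
    unfolding C_def \<tau>_def d_def er_def .
  have scale: "a * v / k < E \<longleftrightarrow> v < k / a * E" if "0 < k" "0 < a" for a k E :: real
    using that by (simp add: field_simps)
  have kp: "0 < 2 * lam * \<bar>x0\<bar> * qp" by (intro mult_pos_pos) (use lam q in auto)
  have setm: "{\<omega>\<in>C n. (e n)\<^sup>2 * wm n / (2 * lam * \<bar>x0\<bar>) < exp (- lam * \<tau> n \<omega>) * (qp - \<delta> n)}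
      = {\<omega>\<in>C n. v < 2 * lam * \<bar>x0\<bar> * qp / (e n)\<^sup>2 * exp (- lam * \<tau> n \<omega>)}" for n
  proof -
    have "(e n)\<^sup>2 * wm n / (2 * lam * \<bar>x0\<bar>) < E * (qp - \<delta> n) \<longleftrightarrow> v < 2 * lam * \<bar>x0\<bar> * qp / (e n)\<^sup>2 * E" for E
    proof -
      have "(e n)\<^sup>2 * wm n / (2 * lam * \<bar>x0\<bar>) = ((e n)\<^sup>2 * v / (2 * lam * \<bar>x0\<bar> * qp)) * (qp - \<delta> n)"
        using q by (simp add: wm_def field_simps)
      then have "(e n)\<^sup>2 * wm n / (2 * lam * \<bar>x0\<bar>) < E * (qp - \<delta> n) \<longleftrightarrow> (e n)\<^sup>2 * v / (2 * lam * \<bar>x0\<bar> * qp) < E"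
        by (simp only: mult_less_cancel_right_pos[of "qp - \<delta> n"] diff_gt_0_iff_gt \<delta>(2)[of n])
      also have "\<dots> \<longleftrightarrow> v < 2 * lam * \<bar>x0\<bar> * qp / (e n)\<^sup>2 * E"
        by (rule scale[OF kp]) (use e(1)[of n] in simp)
      finally show ?thesis .
    qed
    then show ?thesis by simp
  qed
  have setp: "{\<omega>\<in>C n. (e n)\<^sup>2 * wp n / (2 * lam * \<bar>x0\<bar>) < exp (- lam * \<tau> n \<omega>) * (qp + \<delta> n)}
      = {\<omega>\<in>C n. v < 2 * lam * \<bar>x0\<bar> * qp / (e n)\<^sup>2 * exp (- lam * \<tau> n \<omega>)}" for n
  proof -
    have "(e n)\<^sup>2 * wp n / (2 * lam * \<bar>x0\<bar>) < E * (qp + \<delta> n) \<longleftrightarrow> v < 2 * lam * \<bar>x0\<bar> * qp / (e n)\<^sup>2 * E" for E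
    proof -
      have "(e n)\<^sup>2 * wp n / (2 * lam * \<bar>x0\<bar>) = ((e n)\<^sup>2 * v / (2 * lam * \<bar>x0\<bar> * qp)) * (qp + \<delta> n)"
        using q by (simp add: wp_def field_simps)
      then have "(e n)\<^sup>2 * wp n / (2 * lam * \<bar>x0\<bar>) < E * (qp + \<delta> n) \<longleftrightarrow> (e n)\<^sup>2 * v / (2 * lam * \<bar>x0\<bar> * qp) < E"
        by (simp only: mult_less_cancel_right_pos[of "qp + \<delta> n"] add_pos_pos \<delta>(1)[of n] q(3))
      also have "\<dots> \<longleftrightarrow> v < 2 * lam * \<bar>x0\<bar> * qp / (e n)\<^sup>2 * E"
        by (rule scale[OF kp]) (use e(1)[of n] in simp)
      finally show ?thesis .
    qed
    then show ?thesis by simp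
  qed
  have P1: "P n \<le> gauss_tail (s n) + P n * d n" for n
    using b1[of 0 n] arg[of n 0] \<delta>(2)[of n] by (simp add: P_def)
  have P2: "gauss_tail (s n) \<le> P n + P n * d n + er n" for n
    using b2[of 0 n] arg[of n 0] \<delta>(1)[of n] q by (simp add: P_def add_pos_pos)
  have F1: "F n \<le> gauss_tail (s n + wm n / s n) + P n * d n" for n
    using b1[OF ym[OF wmp(1)], of n n n] unfolding arg setm P_def F_def .
  have F2: "gauss_tail (s n + wp n / s n) \<le> F n + P n * d n + er n" for n
    using b2[OF ym[OF wmp(2)], of n n n] unfolding arg setp P_def F_def .
  have wmlim: "wm \<longlonglongrightarrow> v" and wplim: "wp \<longlonglongrightarrow> v"
  proof -
    have "(\<lambda>n. v * (qp - \<delta> n) / qp) \<longlonglongrightarrow> v * (qp - 0) / qp" "(\<lambda>n. v * (qp + \<delta> n) / qp) \<longlonglongrightarrow> v * (qp + 0) / qp"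
      by (intro tendsto_intros \<delta>lim; use q in simp)+
    then show "wm \<longlonglongrightarrow> v" "wp \<longlonglongrightarrow> v" using q by (simp_all add: wm_def[abs_def] wp_def[abs_def])
  qed
  have d0: "0 \<le> d n" for n by (simp add: d_def)
  note res = conditional_tail_limit[OF slim erlim dlim d0 wmlim wmp(1) wplim wmp(2) P1 P2 F1 F2]
  show "\<forall>\<^sub>F n in sequentially. 0 < prob (C n)" using res(1) unfolding P_def .
  show "(\<lambda>n. prob {\<omega>\<in>C n. v < 2 * lam * \<bar>x0\<bar> * qp / (e n)\<^sup>2 * exp (- lam * \<tau> n \<omega>)} / prob (C n)) \<longlonglongrightarrow> exp (- v)"
    using res(2) unfolding P_def F_def .
qed

section \<open>Independence of the exit and the stable coordinate\<close>

lemma (in prob_space) integral_uniform_measure: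
  fixes f :: "'a \<Rightarrow> real"
  assumes A: "A \<in> events" "0 < prob A" and f: "f \<in> borel_measurable M"
  shows "(\<integral>\<omega>. f \<omega> \<partial>uniform_measure M A) = (\<integral>\<omega>. indicator A \<omega> * f \<omega> \<partial>M) / prob A"
proof -
  have "uniform_measure M A = density M (\<lambda>\<omega>. ennreal (indicator A \<omega> / prob A))"
    unfolding uniform_measure_def
  proof (rule density_cong)
    show "AE \<omega> in M. indicator A \<omega> / emeasure M A = ennreal (indicator A \<omega> / prob A)"
      using A(2) by (auto simp: emeasure_eq_measure indicator_def divide_ennreal[symmetric] ennreal_0[symmetric] simp del: ennreal_0)
  qed (use A in auto)
  then have "(\<integral>\<omega>. f \<omega> \<partial>uniform_measure M A) = (\<integral>\<omega>. (indicator A \<omega> / prob A) *\<^sub>R f \<omega> \<partial>M)"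
    using A f by (simp add: integral_density)
  also have "\<dots> = (\<integral>\<omega>. (indicator A \<omega> * f \<omega>) / prob A \<partial>M)" by simp
  also have "\<dots> = (\<integral>\<omega>. indicator A \<omega> * f \<omega> \<partial>M) / prob A" by (rule integral_divide_zero)
  finally show ?thesis .
qed

text \<open>The three-fold independence of \<open>A\<close>, \<open>U\<close> and \<open>Z\<close> says that, conditionally on \<open>A\<close>, the pair \<open>(U, Z)\<close> has
  the product of the unconditional laws.\<close>

lemma (in prob_space) integral_product_on_event:
  fixes g :: "real \<times> real \<Rightarrow> real"
  assumes A: "A \<in> events" and U[measurable]: "U \<in> borel_measurable M" and Z[measurable]: "Z \<in> borel_measurable M"
    and ind: "\<And>B D. B \<in> sets borel \<Longrightarrow> D \<in> sets borel \<Longrightarrow>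
      prob (A \<inter> {\<omega>\<in>space M. U \<omega> \<in> B \<and> Z \<omega> \<in> D})
        = prob A * (prob {\<omega>\<in>space M. U \<omega> \<in> B} * prob {\<omega>\<in>space M. Z \<omega> \<in> D})"
    and g[measurable]: "g \<in> borel_measurable (borel \<Otimes>\<^sub>M borel)"
  shows "(\<integral>\<omega>. indicator A \<omega> * g (U \<omega>, Z \<omega>) \<partial>M) = prob A * (\<integral>p. g p \<partial>(distr M borel U \<Otimes>\<^sub>M distr M borel Z))"
proof (cases "prob A = 0")
  case True
  then have "AE \<omega> in M. \<omega> \<notin> A" using A by (simp add: AE_iff_null_sets[symmetric] null_sets_def emeasure_eq_measure)
  then have "AE \<omega> in M. indicator A \<omega> * g (U \<omega>, Z \<omega>) = 0" by eventually_elim simp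
  then have "(\<integral>\<omega>. indicator A \<omega> * g (U \<omega>, Z \<omega>) \<partial>M) = 0" by (rule integral_eq_zero_AE)
  then show ?thesis using True by simp
next
  case False
  then have pA: "0 < prob A" by (simp add: less_le)
  let ?Q = "uniform_measure M A"
  interpret Q: prob_space ?Q
    by (rule prob_space_uniform_measure) (use False in \<open>auto simp: emeasure_eq_measure\<close>)
  have [measurable_cong]: "sets ?Q = sets M" by simp
  interpret DU: prob_space "distr M borel U" by (rule prob_space_distr) simp
  interpret DZ: prob_space "distr M borel Z" by (rule prob_space_distr) simp
  have "distr M borel U \<Otimes>\<^sub>M distr M borel Z = distr ?Q (borel \<Otimes>\<^sub>M borel) (\<lambda>\<omega>. (U \<omega>, Z \<omega>))"
  proof (rule pair_measure_eqI)
    show "sets (distr M borel U \<Otimes>\<^sub>M distr M borel Z) = sets (distr ?Q (borel \<Otimes>\<^sub>M borel) (\<lambda>\<omega>. (U \<omega>, Z \<omega>)))"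
      by (simp cong: sets_pair_measure_cong)
    fix B D assume BD: "B \<in> sets (distr M borel U)" "D \<in> sets (distr M borel Z)"
    then have [measurable]: "B \<in> sets borel" "D \<in> sets borel" by auto
    have Q: "Q.prob {\<omega>\<in>space M. U \<omega> \<in> B \<and> Z \<omega> \<in> D} = prob {\<omega>\<in>space M. U \<omega> \<in> B} * prob {\<omega>\<in>space M. Z \<omega> \<in> D}"
      by (subst measure_uniform_measure) (use A pA ind[of B D] in \<open>auto simp: emeasure_eq_measure\<close>)
    have "emeasure (distr ?Q (borel \<Otimes>\<^sub>M borel) (\<lambda>\<omega>. (U \<omega>, Z \<omega>))) (B \<times> D) = emeasure ?Q {\<omega>\<in>space M. U \<omega> \<in> B \<and> Z \<omega> \<in> D}"
      by (subst emeasure_distr) (auto intro!: arg_cong2[where f = emeasure])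
    also have "\<dots> = ennreal (prob {\<omega>\<in>space M. U \<omega> \<in> B} * prob {\<omega>\<in>space M. Z \<omega> \<in> D})"
      unfolding Q.emeasure_eq_measure Q ..
    also have "\<dots> = emeasure (distr M borel U) B * emeasure (distr M borel Z) D"
      by (subst (1 2) emeasure_distr) (auto simp: emeasure_eq_measure ennreal_mult vimage_def Int_def conj_commute)
    finally show "emeasure (distr M borel U) B * emeasure (distr M borel Z) D = emeasure (distr ?Q (borel \<Otimes>\<^sub>M borel) (\<lambda>\<omega>. (U \<omega>, Z \<omega>))) (B \<times> D)" ..
  qed (unfold_locales)
  then have "(\<integral>p. g p \<partial>(distr M borel U \<Otimes>\<^sub>M distr M borel Z)) = (\<integral>\<omega>. g (U \<omega>, Z \<omega>) \<partial>?Q)"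
    by (simp add: integral_distr)
  also have "\<dots> = (\<integral>\<omega>. indicator A \<omega> * g (U \<omega>, Z \<omega>) \<partial>M) / prob A"
    by (rule integral_uniform_measure[OF A pA]) measurable
  finally show ?thesis using pA by simp
qed

lemma sample_path_component: "0 \<le> s \<Longrightarrow> sample_path W \<omega> s = W s \<omega>"
  by (simp add: sample_path_def)

lemma path_space_component:
  "0 \<le> s \<Longrightarrow> (\<lambda>p. p s) \<in> measurable path_space borel"
  unfolding path_space_def by (rule measurable_component_singleton) simp

text \<open>The events for which this holds form a \<sigma>-algebra that contains the generators of the filtration.
  It is needed because independence of the noises is a statement about whole paths.\<close>

lemma filtration_event_path:
  fixes W :: "real \<Rightarrow> 'w \<Rightarrow> real"
  assumes Wm: "\<And>s. 0 \<le> s \<Longrightarrow> W s \<in> borel_measurable M" and pm: "sample_path W \<in> measurable M path_space"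
    and A: "A \<in> sets (driving_filtration M (\<lambda>_. y) W t)"
  shows "\<exists>S\<in>sets path_space. AE \<omega> in M. \<omega> \<in> A \<longleftrightarrow> sample_path W \<omega> \<in> S"
proof -
  let ?G = "{(\<lambda>_. y) -` A \<inter> space M | A. A \<in> sets borel} \<union>
        {W s -` A \<inter> space M | s A. 0 \<le> s \<and> s \<le> t \<and> A \<in> sets borel} \<union> null_sets M"
  have G: "?G \<subseteq> Pow (space M)" by (auto dest: sets.sets_into_space)
  have "A \<in> sigma_sets (space M) ?G"
    using A unfolding driving_filtration_def by (simp only: sets_measure_of[OF G])
  then show ?thesis
  proof (induction rule: sigma_sets.induct)
    case (Basic a)
    then consider B where "a = (\<lambda>_. y) -` B \<inter> space M" | s B where "a = W s -` B \<inter> space M" "0 \<le> s" "B \<in> sets borel"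
      | "a \<in> null_sets M" by blast
    then show ?case
    proof cases
      case 1
      show ?thesis
      proof (cases "y \<in> B")
        case True
        show ?thesis by (rule bexI[of _ "space path_space"]) (use 1 True measurable_space[OF pm] in auto)
      next
        case False
        show ?thesis by (rule bexI[of _ "{}"]) (use 1 False in auto)
      qed
    next
      case 2
      show ?thesis
      proof (rule bexI)
        show "(\<lambda>p. p s) -` B \<inter> space path_space \<in> sets path_space"
          by (rule measurable_sets[OF path_space_component[OF 2(2)] 2(3)])
        show "AE \<omega> in M. \<omega> \<in> a \<longleftrightarrow> sample_path W \<omega> \<in> (\<lambda>p. p s) -` B \<inter> space path_space"
          using measurable_space[OF pm] by (intro AE_I2) (auto simp: 2(1) sample_path_component[OF 2(2)])
      qed
    next
      case 3
      then have "AE \<omega> in M. \<omega> \<notin> a" by (rule AE_not_in)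
      then show ?thesis by (intro bexI[of _ "{}"]) auto
    qed
  next
    case Empty
    show ?case by (rule bexI[of _ "{}"]) auto
  next
    case (Compl a)
    then obtain S where S: "S \<in> sets path_space" "AE \<omega> in M. \<omega> \<in> a \<longleftrightarrow> sample_path W \<omega> \<in> S" by blast
    have "AE \<omega> in M. \<omega> \<in> space M - a \<longleftrightarrow> sample_path W \<omega> \<in> space path_space - S"
      using S(2) AE_space
    proof eventually_elim
      case (elim \<omega>)
      then show ?case using measurable_space[OF pm elim(2)] by simp
    qed
    then show ?case by (rule bexI) (rule sets.compl_sets[OF S(1)])
  next
    case (Union a)
    then obtain S where S: "\<And>i. S i \<in> sets path_space" "\<And>i. AE \<omega> in M. \<omega> \<in> a i \<longleftrightarrow> sample_path W \<omega> \<in> S i"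
      by metis
    have "AE \<omega> in M. \<forall>i. \<omega> \<in> a i \<longleftrightarrow> sample_path W \<omega> \<in> S i" using S(2) by (simp add: AE_all_countable)
    then have "AE \<omega> in M. \<omega> \<in> (\<Union>i. a i) \<longleftrightarrow> sample_path W \<omega> \<in> (\<Union>i. S i)" by eventually_elim auto
    then show ?case by (rule bexI) (use S(1) in \<open>intro sets.countable_UN, auto\<close>)
  qed
qed

text \<open>Both hypotheses of independence are used in turn: \<open>\<xi>\<close> is split off from the pair of paths, then the
  two paths are separated. For this the events about the single paths are pulled back to the space
  of paths in the plane.\<close>

lemma (in prob_space) exit_independent_of_transverse:
  fixes W1 W2 :: "real \<Rightarrow> 'a \<Rightarrow> real"
  assumes W: "standard_wiener M W1" "standard_wiener M W2"
    and i12: "indep_elements M path_space (sample_path W1) path_space (sample_path W2)"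
    and i0: "indep_elements M borel \<xi> path_space (sample_path (\<lambda>t \<omega>. (W1 t \<omega>, W2 t \<omega>)))"
    and A: "A \<in> sets (driving_filtration M (\<lambda>_. y) W1 t)" and T: "0 \<le> T"
    and B: "B \<in> sets borel" and D: "D \<in> sets borel"
  shows "prob (A \<inter> {\<omega>\<in>space M. \<xi> \<omega> \<in> B \<and> noise_sum W2 b T n k \<omega> \<in> D})
    = prob A * (prob {\<omega>\<in>space M. \<xi> \<omega> \<in> B} * prob {\<omega>\<in>space M. noise_sum W2 b T n k \<omega> \<in> D})"
proof -
  have Wm: "W1 s \<in> borel_measurable M" "W2 s \<in> borel_measurable M" if "0 \<le> s" for s
    using W that unfolding standard_wiener_def by auto
  have pm: "sample_path W1 \<in> measurable M path_space" "sample_path W2 \<in> measurable M path_space"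
    "\<xi> \<in> borel_measurable M" "sample_path (\<lambda>t \<omega>. (W1 t \<omega>, W2 t \<omega>)) \<in> measurable M path_space"
    using i12 i0 unfolding indep_elements_def by auto
  have Am: "A \<in> events" using A driving_filtration_generators(2)[of W1, OF Wm(1)] by blast
  obtain S1 where S1: "S1 \<in> sets path_space" "AE \<omega> in M. \<omega> \<in> A \<longleftrightarrow> sample_path W1 \<omega> \<in> S1"
    using filtration_event_path[OF Wm(1) pm(1) A] by blast
  define F where "F p = (\<Sum>i=k..<n. exp (- b * (T * real i / real n)) * (p (T * real (Suc i) / real n) - p (T * real i / real n)))"
    for p :: "real \<Rightarrow> real"
  have t0: "0 \<le> T * real i / real n" for i using T by simp
  have Fm: "F \<in> borel_measurable path_space"
    unfolding F_def by (intro borel_measurable_sum borel_measurable_times borel_measurable_const borel_measurable_diff path_space_component t0)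
  have FZ: "F (sample_path W2 \<omega>) = noise_sum W2 b T n k \<omega>" for \<omega>
    unfolding F_def noise_sum_def by (simp only: sample_path_component[OF t0])
  define S2 where "S2 = F -` D \<inter> space path_space"
  have S2: "S2 \<in> sets path_space" unfolding S2_def by (rule measurable_sets[OF Fm D])
  let ?A1 = "sample_path W1 -` S1 \<inter> space M" and ?A2 = "sample_path W2 -` S2 \<inter> space M"
  let ?X = "\<xi> -` B \<inter> space M"
  have A2: "?A2 = {\<omega>\<in>space M. noise_sum W2 b T n k \<omega> \<in> D}"
    unfolding S2_def using measurable_space[OF pm(2)] FZ by auto
  have ev: "?A1 \<in> events" "?A2 \<in> events" "?X \<in> events"
    using measurable_sets[OF pm(1) S1(1)] measurable_sets[OF pm(2) S2] measurable_sets[OF pm(3) B] by auto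
  have p12: "prob (?A1 \<inter> ?A2) = prob ?A1 * prob ?A2"
    using i12 S1(1) S2 unfolding indep_elements_def by (blast intro: indep_setD)
  let ?P = "path_space :: (real \<Rightarrow> real \<times> real) measure"
  have proj: "(\<lambda>p. \<lambda>t\<in>{0..}. fst (p t)) \<in> measurable ?P path_space" "(\<lambda>p. \<lambda>t\<in>{0..}. snd (p t)) \<in> measurable ?P path_space"
  proof -
    have c: "(\<lambda>p. p t) \<in> measurable ?P borel" if "t \<in> {0..}" for t :: real
      by (rule path_space_component) (use that in simp)
    have "(\<lambda>p. fst (p t)) \<in> borel_measurable ?P" "(\<lambda>p. snd (p t)) \<in> borel_measurable ?P" if "t \<in> {0..}" for t :: real
      by (rule measurable_compose[OF c[OF that]], simp add: borel_prod[symmetric])+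
    then show "(\<lambda>p. \<lambda>t\<in>{0..}. fst (p t)) \<in> measurable ?P path_space" "(\<lambda>p. \<lambda>t\<in>{0..}. snd (p t)) \<in> measurable ?P path_space"
      unfolding path_space_def[where ?'a = real] by (auto intro!: measurable_restrict)
  qed
  define S where "S = ((\<lambda>p. \<lambda>t\<in>{0..}. fst (p t)) -` S1 \<inter> space ?P) \<inter> ((\<lambda>p. \<lambda>t\<in>{0..}. snd (p t)) -` S2 \<inter> space ?P)"
  have S: "S \<in> sets ?P" unfolding S_def
    by (intro sets.Int measurable_sets[OF proj(1) S1(1)] measurable_sets[OF proj(2) S2])
  have pS: "sample_path (\<lambda>t \<omega>. (W1 t \<omega>, W2 t \<omega>)) -` S \<inter> space M = ?A1 \<inter> ?A2"
  proof -
    have "(\<lambda>t\<in>{0..}. fst (sample_path (\<lambda>t \<omega>. (W1 t \<omega>, W2 t \<omega>)) \<omega> t)) = sample_path W1 \<omega>"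
      "(\<lambda>t\<in>{0..}. snd (sample_path (\<lambda>t \<omega>. (W1 t \<omega>, W2 t \<omega>)) \<omega> t)) = sample_path W2 \<omega>" for \<omega>
      by (auto simp: sample_path_def fun_eq_iff)
    then show ?thesis unfolding S_def using measurable_space[OF pm(4)] by auto
  qed
  have "prob (?X \<inter> (sample_path (\<lambda>t \<omega>. (W1 t \<omega>, W2 t \<omega>)) -` S \<inter> space M))
      = prob ?X * prob (sample_path (\<lambda>t \<omega>. (W1 t \<omega>, W2 t \<omega>)) -` S \<inter> space M)"
    using i0 S B unfolding indep_elements_def by (blast intro: indep_setD)
  then have p3: "prob (?X \<inter> (?A1 \<inter> ?A2)) = prob ?X * (prob ?A1 * prob ?A2)" unfolding pS p12 .
  have AA: "AE \<omega> in M. \<omega> \<in> A \<longleftrightarrow> \<omega> \<in> ?A1" using S1(2) AE_space by eventually_elim auto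
  have X_eq: "{\<omega>\<in>space M. \<xi> \<omega> \<in> B} = ?X" by auto
  have "prob (A \<inter> {\<omega>\<in>space M. \<xi> \<omega> \<in> B \<and> noise_sum W2 b T n k \<omega> \<in> D}) = prob (A \<inter> (?X \<inter> ?A2))"
    unfolding A2 by (rule arg_cong[where f = prob]) auto
  also have "\<dots> = prob (?X \<inter> (?A1 \<inter> ?A2))"
    by (rule measure_eq_AE) (use AA Am ev in auto)
  also have "\<dots> = prob A * (prob ?X * prob ?A2)"
  proof -
    have "prob A = prob ?A1" by (rule measure_eq_AE) (use AA Am ev in auto)
    then show ?thesis unfolding p3 by simp
  qed
  finally show ?thesis unfolding X_eq A2 .
qed

section \<open>The stable coordinate at the exit time\<close>

text \<open>The mean of \<open>f\<close> at the rescaled stable coordinate at the fixed time \<open>t\<close>: \<open>\<rho>\<close> is the law of the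
  initial value, the second factor carries the noise, and \<open>c\<close> and \<open>d\<close> absorb the powers of the noise
  level.\<close>

definition transverse_mean :: "(real \<Rightarrow> real) \<Rightarrow> real \<Rightarrow> real \<Rightarrow> real \<Rightarrow> real measure \<Rightarrow> real \<Rightarrow> real" where
  "transverse_mean f c d mu \<rho> t =
     (\<integral>p. f (c * exp (- mu * t) * fst p + d * sqrt ((1 - exp (- 2 * mu * t)) / (2 * mu)) * snd p)
       \<partial>(\<rho> \<Otimes>\<^sub>M std_normal_distribution))"

lemma prob_space_pair_std_normal:
  assumes "prob_space \<rho>"
  shows "prob_space (\<rho> \<Otimes>\<^sub>M std_normal_distribution)"
proof -
  interpret R: prob_space \<rho> by fact
  interpret N: prob_space std_normal_distribution by (rule prob_space_normal_density) simp
  interpret P: pair_prob_space \<rho> std_normal_distribution ..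
  show ?thesis by unfold_locales
qed

lemma product_integral_tendsto:
  fixes f :: "real \<Rightarrow> real" and a b :: "nat \<Rightarrow> real"
  assumes \<rho>: "prob_space \<rho>" "sets \<rho> = sets borel" and f: "continuous_on UNIV f" "\<And>x. \<bar>f x\<bar> \<le> B"
    and a: "a \<longlonglongrightarrow> a0" and b: "b \<longlonglongrightarrow> b0"
  shows "(\<lambda>n. \<integral>p. f (a n * fst p + b n * snd p) \<partial>(\<rho> \<Otimes>\<^sub>M std_normal_distribution))
    \<longlonglongrightarrow> (\<integral>p. f (a0 * fst p + b0 * snd p) \<partial>(\<rho> \<Otimes>\<^sub>M std_normal_distribution))"
proof -
  interpret P: prob_space "\<rho> \<Otimes>\<^sub>M std_normal_distribution" by (rule prob_space_pair_std_normal[OF \<rho>(1)])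
  have [measurable_cong]: "sets \<rho> = sets borel" by fact
  have [measurable]: "f \<in> borel_measurable borel" by (rule borel_measurable_continuous_onI[OF f(1)])
  have cont: "isCont f x" for x using f(1) by (simp add: continuous_on_eq_continuous_at)
  show ?thesis
  proof (rule integral_dominated_convergence[where w = "\<lambda>_. B"])
    show "AE p in \<rho> \<Otimes>\<^sub>M std_normal_distribution. (\<lambda>n. f (a n * fst p + b n * snd p)) \<longlonglongrightarrow> f (a0 * fst p + b0 * snd p)"
      by (intro AE_I2 isCont_tendsto_compose[OF cont] tendsto_intros a b)
  qed (use f(2) in auto)
qed

lemma transverse_mean_tendsto:
  assumes \<rho>: "prob_space \<rho>" "sets \<rho> = sets borel" and f: "continuous_on UNIV f" "\<And>x. \<bar>f x\<bar> \<le> B"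
    and mu: "0 < mu" and u: "u \<longlonglongrightarrow> t"
  shows "(\<lambda>n. transverse_mean f c d mu \<rho> (u n)) \<longlonglongrightarrow> transverse_mean f c d mu \<rho> t"
  unfolding transverse_mean_def
  by (rule product_integral_tendsto[OF \<rho> f]; intro tendsto_intros u) (use mu in auto)

lemma transverse_mean_bound:
  assumes \<rho>: "prob_space \<rho>" "sets \<rho> = sets borel" and f: "continuous_on UNIV f" "\<And>x. \<bar>f x\<bar> \<le> B"
  shows "\<bar>transverse_mean f c d mu \<rho> t\<bar> \<le> B"
proof -
  interpret P: prob_space "\<rho> \<Otimes>\<^sub>M std_normal_distribution" by (rule prob_space_pair_std_normal[OF \<rho>(1)])
  have [measurable_cong]: "sets \<rho> = sets borel" by fact
  have [measurable]: "f \<in> borel_measurable borel" by (rule borel_measurable_continuous_onI[OF f(1)])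
  let ?h = "\<lambda>p. f (c * exp (- mu * t) * fst p + d * sqrt ((1 - exp (- 2 * mu * t)) / (2 * mu)) * snd p)"
  have "\<bar>\<integral>p. ?h p \<partial>(\<rho> \<Otimes>\<^sub>M std_normal_distribution)\<bar> \<le> (\<integral>p. \<bar>?h p\<bar> \<partial>(\<rho> \<Otimes>\<^sub>M std_normal_distribution))"
    by (rule integral_abs_bound)
  also have "\<dots> \<le> (\<integral>p. B \<partial>(\<rho> \<Otimes>\<^sub>M std_normal_distribution))"
    by (rule integral_mono) (use f(2) in \<open>auto intro!: P.integrable_const_bound[of _ B]\<close>)
  finally show ?thesis unfolding transverse_mean_def by (simp add: P.prob_space)
qed

lemma (in prob_space) noise_sum_law:
  assumes W: "standard_wiener M W" and T: "0 \<le> T" and n: "0 < n"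
  shows "distr M borel (noise_sum W b T n 0) = distr std_normal_distribution borel (\<lambda>z. sqrt (noise_var b T n 0) * z)"
proof (cases "T = 0")
  case True
  interpret N: prob_space std_normal_distribution by (rule prob_space_normal_density) simp
  have "noise_sum W b T n 0 = (\<lambda>_. 0)" "noise_var b T n 0 = 0"
    using True by (auto simp: noise_sum_def noise_var_def)
  then show ?thesis by (simp add: distr_const N.distr_const)
next
  case False
  then have T: "0 < T" using T by simp
  show ?thesis
    by (rule distr_normal_eq_scaled[OF noise_sum_normal[OF W T n]]) (use noise_var_pos[OF T n] in simp)
qed

text \<open>The noise sums of the stable coordinate are Gaussian and independent of \<open>\<xi>\<close> and of \<open>A\<close>, so the
  identity holds with a noise sum in place of its limit; then the grid is refined.\<close>

lemma (in prob_space) transverse_integral: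
  fixes W1 W2 :: "real \<Rightarrow> 'a \<Rightarrow> real"
  assumes W: "standard_wiener M W1" "standard_wiener M W2"
    and i12: "indep_elements M path_space (sample_path W1) path_space (sample_path W2)"
    and i0: "indep_elements M borel \<xi> path_space (sample_path (\<lambda>t \<omega>. (W1 t \<omega>, W2 t \<omega>)))"
    and A: "A \<in> sets (driving_filtration M (\<lambda>_. y) W1 s)"
    and X: "solves_linear M (- mu) e W2 X" and X0: "AE \<omega> in M. X 0 \<omega> = c0 * \<xi> \<omega>"
    and mu: "0 < mu" and t: "0 \<le> t" and f: "continuous_on UNIV f" "\<And>x. \<bar>f x\<bar> \<le> B"
  shows "(\<integral>\<omega>. indicator A \<omega> * f (c * X t \<omega>) \<partial>M) = prob A * transverse_mean f (c * c0) (c * e) mu (distr M borel \<xi>) t"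
proof -
  have Wm: "W1 s \<in> borel_measurable M" "W2 s \<in> borel_measurable M" if "0 \<le> s" for s
    using W that unfolding standard_wiener_def by auto
  have Am[measurable]: "A \<in> events" using A driving_filtration_generators(2)[of W1, OF Wm(1)] by blast
  have \<xi>m[measurable]: "\<xi> \<in> borel_measurable M" using i0 unfolding indep_elements_def by simp
  have fm[measurable]: "f \<in> borel_measurable borel" by (rule borel_measurable_continuous_onI[OF f(1)])
  have cont: "isCont f x" for x using f(1) by (simp add: continuous_on_eq_continuous_at)
  define S where "S n = noise_sum W2 (- mu) t (Suc n) 0" for n
  define \<sigma> where "\<sigma> n = sqrt (noise_var (- mu) t (Suc n) 0)" for n
  have Sm[measurable]: "S n \<in> borel_measurable M" for n
    unfolding S_def noise_sum_def
    by (intro borel_measurable_sum borel_measurable_times borel_measurable_const borel_measurable_diff Wm) (use t in simp_all)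
  let ?\<rho> = "distr M borel \<xi>"
  have \<rho>: "prob_space ?\<rho>" by (rule prob_space_distr) simp
  interpret R: prob_space ?\<rho> by (rule \<rho>)
  interpret N: prob_space std_normal_distribution by (rule prob_space_normal_density) simp
  define g where "g p = f (c * exp (- mu * t) * (c0 * fst p + e * snd p))" for p
  have gm[measurable]: "g \<in> borel_measurable (borel \<Otimes>\<^sub>M borel)" unfolding g_def by measurable
  have "(\<lambda>n. \<integral>\<omega>. indicator A \<omega> * g (\<xi> \<omega>, S n \<omega>) \<partial>M) \<longlonglongrightarrow> (\<integral>\<omega>. indicator A \<omega> * f (c * X t \<omega>) \<partial>M)"
  proof (rule integral_dominated_convergence[where w = "\<lambda>_. B"])
    show "(\<lambda>\<omega>. indicator A \<omega> * f (c * X t \<omega>)) \<in> borel_measurable M"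
      using solves_linearD(1)[OF X t] by measurable
    show "AE \<omega> in M. (\<lambda>n. indicator A \<omega> * g (\<xi> \<omega>, S n \<omega>)) \<longlonglongrightarrow> indicator A \<omega> * f (c * X t \<omega>)"
      using noise_sum_tendsto[OF X t] X0
    proof eventually_elim
      case (elim \<omega>)
      have "(\<lambda>n. e * S n \<omega>) \<longlonglongrightarrow> exp (- (- mu) * t) * X t \<omega> - c0 * \<xi> \<omega>"
        using LIMSEQ_Suc[OF elim(1)] elim(2) by (simp add: S_def)
      then have "(\<lambda>n. c * exp (- mu * t) * (c0 * \<xi> \<omega> + e * S n \<omega>)) \<longlonglongrightarrow> c * exp (- mu * t) * (c0 * \<xi> \<omega> + (exp (- (- mu) * t) * X t \<omega> - c0 * \<xi> \<omega>))"
        by (intro tendsto_intros)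
      moreover have "c * exp (- mu * t) * (c0 * \<xi> \<omega> + (exp (- (- mu) * t) * X t \<omega> - c0 * \<xi> \<omega>)) = c * X t \<omega>"
      proof -
        have "exp (- mu * t) * exp (- (- mu) * t) = 1" by (simp flip: exp_add)
        then have "c * (exp (- mu * t) * exp (- (- mu) * t)) * X t \<omega> = c * X t \<omega>" by (simp only: mult_1_right)
        then show ?thesis by (simp add: mult.assoc)
      qed
      ultimately have "(\<lambda>n. c * exp (- mu * t) * (c0 * \<xi> \<omega> + e * S n \<omega>)) \<longlonglongrightarrow> c * X t \<omega>" by (simp only:)
      then have "(\<lambda>n. g (\<xi> \<omega>, S n \<omega>)) \<longlonglongrightarrow> f (c * X t \<omega>)"
        unfolding g_def fst_conv snd_conv by (rule isCont_tendsto_compose[OF cont])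
      then show ?case by (intro tendsto_intros)
    qed
    show "AE \<omega> in M. norm (indicator A \<omega> * g (\<xi> \<omega>, S n \<omega>)) \<le> B" for n
    proof (rule AE_I2)
      fix \<omega>
      have "0 \<le> B" using f(2)[of 0] by linarith
      then show "norm (indicator A \<omega> * g (\<xi> \<omega>, S n \<omega>)) \<le> B" using f(2) by (auto simp: g_def indicator_def)
    qed
  qed auto
  moreover have "(\<integral>\<omega>. indicator A \<omega> * g (\<xi> \<omega>, S n \<omega>) \<partial>M)
      = prob A * (\<integral>p. f ((c * c0 * exp (- mu * t)) * fst p + (c * e * exp (- mu * t) * \<sigma> n) * snd p) \<partial>(?\<rho> \<Otimes>\<^sub>M std_normal_distribution))" for n
  proof -
    have "(\<integral>\<omega>. indicator A \<omega> * g (\<xi> \<omega>, S n \<omega>) \<partial>M) = prob A * (\<integral>p. g p \<partial>(?\<rho> \<Otimes>\<^sub>M distr M borel (S n)))"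
      by (rule integral_product_on_event[OF Am \<xi>m Sm _ gm]) (unfold S_def, rule exit_independent_of_transverse[OF W i12 i0 A t])
    also have "distr M borel (S n) = distr std_normal_distribution borel (\<lambda>z. \<sigma> n * z)"
      unfolding S_def \<sigma>_def by (rule noise_sum_law[OF W(2) t]) simp
    also have "?\<rho> \<Otimes>\<^sub>M distr std_normal_distribution borel (\<lambda>z. \<sigma> n * z)
        = distr ?\<rho> borel (\<lambda>x. x) \<Otimes>\<^sub>M distr std_normal_distribution borel (\<lambda>z. \<sigma> n * z)"
      by (simp add: distr_id2)
    also have "\<dots> = distr (?\<rho> \<Otimes>\<^sub>M std_normal_distribution) (borel \<Otimes>\<^sub>M borel) (\<lambda>(x, z). (x, \<sigma> n * z))"
    proof (rule pair_measure_distr)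
      interpret D: prob_space "distr std_normal_distribution borel (\<lambda>z. \<sigma> n * z)" by (rule N.prob_space_distr) simp
      show "sigma_finite_measure (distr std_normal_distribution borel (\<lambda>z. \<sigma> n * z))" by unfold_locales
    qed auto
    also have "(\<integral>p. g p \<partial>\<dots>) = (\<integral>p. g (case p of (x, z) \<Rightarrow> (x, \<sigma> n * z)) \<partial>(?\<rho> \<Otimes>\<^sub>M std_normal_distribution))"
      by (rule integral_distr) auto
    also have "\<dots> = (\<integral>p. f ((c * c0 * exp (- mu * t)) * fst p + (c * e * exp (- mu * t) * \<sigma> n) * snd p) \<partial>(?\<rho> \<Otimes>\<^sub>M std_normal_distribution))"
      by (rule Bochner_Integration.integral_cong) (auto simp: g_def algebra_simps)
    finally show ?thesis .
  qed
  moreover have "(\<lambda>n. prob A * (\<integral>p. f ((c * c0 * exp (- mu * t)) * fst p + (c * e * exp (- mu * t) * \<sigma> n) * snd p) \<partial>(?\<rho> \<Otimes>\<^sub>M std_normal_distribution)))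
      \<longlonglongrightarrow> prob A * transverse_mean f (c * c0) (c * e) mu ?\<rho> t"
    unfolding transverse_mean_def
  proof (rule tendsto_mult[OF tendsto_const], rule product_integral_tendsto[OF \<rho> _ f])
    have s: "sqrt ((1 - exp (- 2 * mu * t)) / (2 * mu)) = exp (- mu * t) * sqrt ((1 - exp (- 2 * (- mu) * t)) / (2 * (- mu)))"
    proof -
      have e2: "(exp (- mu * t))\<^sup>2 = exp (- 2 * mu * t)" by (simp add: exp_double[symmetric])
      have "exp (- 2 * mu * t) * exp (2 * mu * t) = 1" by (simp flip: exp_add)
      then have "(1 - exp (- 2 * mu * t)) / (2 * mu) = exp (- 2 * mu * t) * ((1 - exp (- 2 * (- mu) * t)) / (2 * (- mu)))"
        using mu by (simp add: field_simps)
      also have "\<dots> = (exp (- mu * t))\<^sup>2 * ((1 - exp (- 2 * (- mu) * t)) / (2 * (- mu)))" by (simp only: e2)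
      finally show ?thesis by (simp only: real_sqrt_mult real_sqrt_abs abs_exp_cancel)
    qed
    have "\<sigma> \<longlonglongrightarrow> sqrt ((1 - exp (- 2 * (- mu) * t)) / (2 * (- mu)))"
      unfolding \<sigma>_def by (intro tendsto_real_sqrt LIMSEQ_Suc[OF noise_var_tendsto]) (use mu t in auto)
    then have "(\<lambda>n. c * e * exp (- mu * t) * \<sigma> n) \<longlonglongrightarrow> c * e * exp (- mu * t) * sqrt ((1 - exp (- 2 * (- mu) * t)) / (2 * (- mu)))"
      by (intro tendsto_intros)
    then show "(\<lambda>n. c * e * exp (- mu * t) * \<sigma> n) \<longlonglongrightarrow> c * e * sqrt ((1 - exp (- 2 * mu * t)) / (2 * mu))"
      unfolding s by (simp only: mult.assoc)
  qed auto
  ultimately show ?thesis by (simp add: LIMSEQ_unique)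
qed

text \<open>At most one term of the sum is not zero, namely the value of \<open>g\<close> at the rounded exit time.\<close>

lemma exit_cell_sum:
  fixes X :: "real \<Rightarrow> 'w \<Rightarrow> real" and g :: "real \<Rightarrow> real"
  assumes cont: "continuous_on {0..} (\<lambda>t. X t \<omega>)" and \<omega>: "\<omega> \<in> space M" and ab: "a \<noteq> b" and T: "0 < T"
    and g: "\<And>u t. (\<And>n. 0 \<le> u n) \<Longrightarrow> 0 \<le> t \<Longrightarrow> u \<longlonglongrightarrow> t \<Longrightarrow> (\<lambda>n. g (u n)) \<longlonglongrightarrow> g t"
  shows "(\<lambda>n. \<Sum>k\<le>Suc n. indicator (exit_cell M X a b T (Suc n) k) \<omega> * g (T * real k / real (Suc n)))
    \<longlonglongrightarrow> indicator {\<omega>\<in>space M. hits_first (\<lambda>t. X t \<omega>) a b T} \<omega> * g (real_of_ereal (hitting_time X {a, b} \<omega>))"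
proof (cases "hits_first (\<lambda>t. X t \<omega>) a b T")
  case False
  then show ?thesis by (simp add: exit_cell_def)
next
  case True
  obtain s where s: "hitting_time X {a, b} \<omega> = ereal s" "0 \<le> s" "s \<le> T"
  proof (rule hits_firstD[where X = X and \<omega> = \<omega> and a = a and b = b and T = T])
    show "continuous_on {0..} (\<lambda>t. X t \<omega>)" by (rule cont)
  qed (use ab True in simp_all)
  have "(\<Sum>k\<le>Suc n. indicator (exit_cell M X a b T (Suc n) k) \<omega> * g (T * real k / real (Suc n)))
      = g (T * real (grid_index T (Suc n) s) / real (Suc n))" for n
  proof -
    have "(\<Sum>k\<le>Suc n. indicator (exit_cell M X a b T (Suc n) k) \<omega> * g (T * real k / real (Suc n)))
        = (\<Sum>k\<le>Suc n. if k = grid_index T (Suc n) s then g (T * real k / real (Suc n)) else 0)"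
      by (rule sum.cong) (use True s \<omega> in \<open>auto simp: exit_cell_def indicator_def\<close>)
    then show ?thesis using grid_index_bounds(1)[OF T _ s(2,3), of "Suc n"] by (simp add: sum.delta)
  qed
  moreover have "(\<lambda>n. g (T * real (grid_index T (Suc n) s) / real (Suc n))) \<longlonglongrightarrow> g s"
    by (rule g[OF _ s(2) LIMSEQ_Suc[OF grid_index_tendsto[OF T s(2,3)]]]) (use T in simp)
  ultimately show ?thesis using True s \<omega> by simp
qed

text \<open>On each cell the exit time, rounded up, is a constant, and the previous lemma applies because the
  cell is determined by the noise of the unstable coordinate. Refining the grid removes the rounding,
  as paths and \<open>K\<close> are continuous; a growing horizon exhausts the exit event.\<close>

lemma (in prob_space) exit_position_integral:
  fixes W1 W2 X1 X2 :: "real \<Rightarrow> 'a \<Rightarrow> real" and c :: real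
  assumes W: "standard_wiener M W1" "standard_wiener M W2"
    and i12: "indep_elements M path_space (sample_path W1) path_space (sample_path W2)"
    and i0: "indep_elements M borel \<xi> path_space (sample_path (\<lambda>t \<omega>. (W1 t \<omega>, W2 t \<omega>)))"
    and X1: "solves_linear M lam e W1 X1" and X10: "AE \<omega> in M. X1 0 \<omega> = x0"
    and X2: "solves_linear M (- mu) e W2 X2" and X20: "AE \<omega> in M. X2 0 \<omega> = c0 * \<xi> \<omega>"
    and mu: "0 < mu" and ne: "qm \<noteq> qp" and f: "continuous_on UNIV f" "\<And>x. \<bar>f x\<bar> \<le> B"
    and X2\<tau>: "(\<lambda>\<omega>. X2 (real_of_ereal (hitting_time X1 {qm, qp} \<omega>)) \<omega>) \<in> borel_measurable M"
  defines "\<tau> \<equiv> \<lambda>\<omega>. real_of_ereal (hitting_time X1 {qm, qp} \<omega>)"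
    and "C \<equiv> {\<omega>\<in>space M. hitting_time X1 {qm, qp} \<omega> < \<infinity> \<and> X1 (real_of_ereal (hitting_time X1 {qm, qp} \<omega>)) \<omega> = qp}"
    and "K \<equiv> transverse_mean f (c * c0) (c * e) mu (distr M borel \<xi>)"
  shows "(\<integral>\<omega>. indicator C \<omega> * f (c * X2 (\<tau> \<omega>) \<omega>) \<partial>M) = (\<integral>\<omega>. indicator C \<omega> * K (\<tau> \<omega>) \<partial>M)"
proof -
  have comm: "{qp, qm} = {qm, qp}" by auto
  have B0: "0 \<le> B" using f(2)[of 0] by linarith
  have \<xi>m[measurable]: "\<xi> \<in> borel_measurable M" using i0 unfolding indep_elements_def by simp
  have \<rho>: "prob_space (distr M borel \<xi>)" by (rule prob_space_distr) simp
  have Klim: "(\<lambda>n. K (u n)) \<longlonglongrightarrow> K t" if "u \<longlonglongrightarrow> t" for u t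
    unfolding K_def by (rule transverse_mean_tendsto[OF \<rho> _ f mu that]) simp
  have KB: "\<bar>K t\<bar> \<le> B" for t unfolding K_def by (rule transverse_mean_bound[OF \<rho> _ f]) simp
  have Kcont: "continuous_on UNIV K"
    by (simp add: continuous_on_sequentially comp_def Klim)
  have Km[measurable]: "K \<in> borel_measurable borel" by (rule borel_measurable_continuous_onI[OF Kcont])
  have fm[measurable]: "f \<in> borel_measurable borel" by (rule borel_measurable_continuous_onI[OF f(1)])
  have cont: "isCont f x" for x using f(1) by (simp add: continuous_on_eq_continuous_at)
  have \<tau>m[measurable]: "\<tau> \<in> borel_measurable M" unfolding \<tau>_def by (rule hitting_time_measurable(2)[OF X1 ne])
  have X2\<tau>m[measurable]: "(\<lambda>\<omega>. X2 (\<tau> \<omega>) \<omega>) \<in> borel_measurable M" using X2\<tau> unfolding \<tau>_def .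
  define E where "E T = {\<omega>\<in>space M. hits_first (\<lambda>t. X1 t \<omega>) qp qm T}" for T
  have Em[measurable]: "E T \<in> events" for T
    unfolding E_def by (rule hits_first_measurable) (use solves_linearD[OF X1] in auto)
  have horizon: "(\<integral>\<omega>. indicator (E T) \<omega> * f (c * X2 (\<tau> \<omega>) \<omega>) \<partial>M) = (\<integral>\<omega>. indicator (E T) \<omega> * K (\<tau> \<omega>) \<partial>M)"
    if T: "0 < T" for T
  proof -
    define A where "A n k = exit_cell M X1 qp qm T (Suc n) k" for n k
    define t where "t n k = T * real k / real (Suc n)" for n k
    have t0: "0 \<le> t n k" for n k using T by (simp add: t_def)
    have filt: "A n k \<in> sets (driving_filtration M (\<lambda>_. 0) W1 (t n k))" if "k \<le> Suc n" for n k
      unfolding A_def t_def by (rule exit_cell_adapted[OF W(1) X1 X10 ne[symmetric] T _ that]) simp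
    have Wm: "W1 s \<in> borel_measurable M" if "0 \<le> s" for s
      using W that unfolding standard_wiener_def by auto
    have Am[measurable]: "A n k \<in> events" if "k \<le> Suc n" for n k
      using filt[OF that] driving_filtration_generators(2)[of W1, OF Wm] by blast
    have one: "\<bar>\<Sum>k\<le>Suc n. indicator (A n k) \<omega> * h k\<bar> \<le> B" if h: "\<And>k. \<bar>h k\<bar> \<le> B" for n \<omega> and h :: "nat \<Rightarrow> real"
    proof -
      let ?j = "grid_index T (Suc n) (real_of_ereal (hitting_time X1 {qp, qm} \<omega>))"
      have "\<bar>indicator (A n k) \<omega> * h k\<bar> \<le> (if k = ?j then B else 0)" for k
        using h[of k] B0 by (auto simp: A_def exit_cell_def indicator_def)
      then have "\<bar>\<Sum>k\<le>Suc n. indicator (A n k) \<omega> * h k\<bar> \<le> (\<Sum>k\<le>Suc n. if k = ?j then B else 0)"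
        by (intro order_trans[OF sum_abs sum_mono])
      also have "\<dots> \<le> B" using B0 by (simp add: sum.delta)
      finally show ?thesis .
    qed
    have Xm: "X2 (t n k) \<in> borel_measurable M" for n k by (rule solves_linearD(1)[OF X2 t0])
    have L: "(\<lambda>n. \<integral>\<omega>. (\<Sum>k\<le>Suc n. indicator (A n k) \<omega> * f (c * X2 (t n k) \<omega>)) \<partial>M)
        \<longlonglongrightarrow> (\<integral>\<omega>. indicator (E T) \<omega> * f (c * X2 (\<tau> \<omega>) \<omega>) \<partial>M)"
    proof (rule integral_dominated_convergence[where w = "\<lambda>_. B"])
      show "(\<lambda>\<omega>. \<Sum>k\<le>Suc n. indicator (A n k) \<omega> * f (c * X2 (t n k) \<omega>)) \<in> borel_measurable M" for n
        using Xm by (intro borel_measurable_sum) auto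
      show "AE \<omega> in M. (\<lambda>n. \<Sum>k\<le>Suc n. indicator (A n k) \<omega> * f (c * X2 (t n k) \<omega>)) \<longlonglongrightarrow> indicator (E T) \<omega> * f (c * X2 (\<tau> \<omega>) \<omega>)"
      proof (rule AE_I2)
        fix \<omega> assume \<omega>: "\<omega> \<in> space M"
        show "(\<lambda>n. \<Sum>k\<le>Suc n. indicator (A n k) \<omega> * f (c * X2 (t n k) \<omega>)) \<longlonglongrightarrow> indicator (E T) \<omega> * f (c * X2 (\<tau> \<omega>) \<omega>)"
          unfolding A_def t_def E_def \<tau>_def comm[symmetric]
        proof (rule exit_cell_sum[where g = "\<lambda>t. f (c * X2 t \<omega>)" and X = X1 and \<omega> = \<omega> and M = M, OF solves_linearD(2)[OF X1 \<omega>] \<omega> ne[symmetric] T])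
          fix u t assume u: "\<And>n. 0 \<le> u n" "0 \<le> t" "u \<longlonglongrightarrow> (t::real)"
          have "(\<lambda>n. X2 (u n) \<omega>) \<longlonglongrightarrow> X2 t \<omega>"
            using continuous_on_tendsto_compose[OF solves_linearD(2)[OF X2 \<omega>] u(3)] u(1,2) by simp
          then show "(\<lambda>n. f (c * X2 (u n) \<omega>)) \<longlonglongrightarrow> f (c * X2 t \<omega>)"
            by (intro isCont_tendsto_compose[OF cont] tendsto_intros)
        qed
      qed
      show "AE \<omega> in M. norm (\<Sum>k\<le>Suc n. indicator (A n k) \<omega> * f (c * X2 (t n k) \<omega>)) \<le> B" for n
        unfolding real_norm_def by (intro AE_I2 one f(2))
    qed auto
    have R: "(\<lambda>n. \<integral>\<omega>. (\<Sum>k\<le>Suc n. indicator (A n k) \<omega> * K (t n k)) \<partial>M)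
        \<longlonglongrightarrow> (\<integral>\<omega>. indicator (E T) \<omega> * K (\<tau> \<omega>) \<partial>M)"
    proof (rule integral_dominated_convergence[where w = "\<lambda>_. B"])
      show "(\<lambda>\<omega>. \<Sum>k\<le>Suc n. indicator (A n k) \<omega> * K (t n k)) \<in> borel_measurable M" for n
        by (intro borel_measurable_sum) auto
      show "AE \<omega> in M. (\<lambda>n. \<Sum>k\<le>Suc n. indicator (A n k) \<omega> * K (t n k)) \<longlonglongrightarrow> indicator (E T) \<omega> * K (\<tau> \<omega>)"
        unfolding A_def t_def E_def \<tau>_def comm[symmetric]
      proof (rule AE_I2)
        fix \<omega> assume \<omega>: "\<omega> \<in> space M"
        show "(\<lambda>n. \<Sum>k\<le>Suc n. indicator (exit_cell M X1 qp qm T (Suc n) k) \<omega> * K (T * real k / real (Suc n)))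
          \<longlonglongrightarrow> indicator {\<omega>\<in>space M. hits_first (\<lambda>t. X1 t \<omega>) qp qm T} \<omega> * K (real_of_ereal (hitting_time X1 {qp, qm} \<omega>))"
          by (rule exit_cell_sum[where g = K and X = X1 and \<omega> = \<omega> and M = M, OF solves_linearD(2)[OF X1 \<omega>] \<omega> ne[symmetric] T Klim])
      qed
      show "AE \<omega> in M. norm (\<Sum>k\<le>Suc n. indicator (A n k) \<omega> * K (t n k)) \<le> B" for n
        unfolding real_norm_def by (intro AE_I2 one KB)
    qed auto
    have "(\<integral>\<omega>. (\<Sum>k\<le>Suc n. indicator (A n k) \<omega> * f (c * X2 (t n k) \<omega>)) \<partial>M)
        = (\<integral>\<omega>. (\<Sum>k\<le>Suc n. indicator (A n k) \<omega> * K (t n k)) \<partial>M)" for n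
    proof -
      have i: "integrable M (\<lambda>\<omega>. indicator (A n k) \<omega> * f (c * X2 (t n k) \<omega>))" if "k \<le> Suc n" for k
        using Xm Am[OF that] f(2) B0 by (intro integrable_const_bound[of _ B]) (auto simp: indicator_def)
      have i2: "integrable M (\<lambda>\<omega>. indicator (A n k) \<omega> * K (t n k))" if "k \<le> Suc n" for k
        using Am[OF that] KB B0 by (intro integrable_const_bound[of _ B]) (auto simp: indicator_def)
      have "(\<integral>\<omega>. (\<Sum>k\<le>Suc n. indicator (A n k) \<omega> * f (c * X2 (t n k) \<omega>)) \<partial>M)
          = (\<Sum>k\<le>Suc n. \<integral>\<omega>. indicator (A n k) \<omega> * f (c * X2 (t n k) \<omega>) \<partial>M)"
        by (rule Bochner_Integration.integral_sum) (use i in auto)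
      also have "\<dots> = (\<Sum>k\<le>Suc n. \<integral>\<omega>. indicator (A n k) \<omega> * K (t n k) \<partial>M)"
      proof (rule sum.cong[OF refl])
        fix k assume "k \<in> {..Suc n}"
        then have k: "k \<le> Suc n" by simp
        show "(\<integral>\<omega>. indicator (A n k) \<omega> * f (c * X2 (t n k) \<omega>) \<partial>M) = (\<integral>\<omega>. indicator (A n k) \<omega> * K (t n k) \<partial>M)"
          using transverse_integral[OF W i12 i0 filt[OF k] X2 X20 mu t0 f] Am[OF k] by (simp add: K_def)
      qed
      also have "\<dots> = (\<integral>\<omega>. (\<Sum>k\<le>Suc n. indicator (A n k) \<omega> * K (t n k)) \<partial>M)"
        by (rule Bochner_Integration.integral_sum[symmetric]) (rule i2, simp)
      finally show ?thesis .
    qed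
    then show ?thesis using L R by (simp add: LIMSEQ_unique)
  qed
  have C: "C = (\<Union>n. E (real (Suc n)))" and inc: "incseq (\<lambda>n. E (real (Suc n)))"
    using hits_first_limit[of M X1 qm qp, OF solves_linearD(2)[OF X1] ne] unfolding C_def E_def by auto
  have Cm[measurable]: "C \<in> events" unfolding C by measurable
  have lim: "(\<lambda>n. \<integral>\<omega>. indicator (E (real (Suc n))) \<omega> * h \<omega> \<partial>M) \<longlonglongrightarrow> (\<integral>\<omega>. indicator C \<omega> * h \<omega> \<partial>M)"
    if h[measurable]: "h \<in> borel_measurable M" and hB: "\<And>\<omega>. \<bar>h \<omega>\<bar> \<le> B" for h
  proof (rule integral_dominated_convergence[where w = "\<lambda>_. B"])
    have "(\<lambda>n. indicator (E (real (Suc n))) \<omega> :: real) \<longlonglongrightarrow> indicator C \<omega>" for \<omega>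
      unfolding C by (rule LIMSEQ_indicator_incseq[OF inc])
    then show "AE \<omega> in M. (\<lambda>n. indicator (E (real (Suc n))) \<omega> * h \<omega>) \<longlonglongrightarrow> indicator C \<omega> * h \<omega>"
      by (intro AE_I2 tendsto_intros)
    show "AE \<omega> in M. norm (indicator (E (real (Suc n))) \<omega> * h \<omega>) \<le> B" for n
      using hB B0 by (intro AE_I2) (auto simp: indicator_def)
  qed auto
  have "(\<lambda>n. \<integral>\<omega>. indicator (E (real (Suc n))) \<omega> * f (c * X2 (\<tau> \<omega>) \<omega>) \<partial>M) \<longlonglongrightarrow> (\<integral>\<omega>. indicator C \<omega> * f (c * X2 (\<tau> \<omega>) \<omega>) \<partial>M)"
    by (rule lim) (use f(2) in auto)
  moreover have "(\<lambda>n. \<integral>\<omega>. indicator (E (real (Suc n))) \<omega> * K (\<tau> \<omega>) \<partial>M) \<longlonglongrightarrow> (\<integral>\<omega>. indicator C \<omega> * K (\<tau> \<omega>) \<partial>M)"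
    by (rule lim) (use KB in auto)
  ultimately show ?thesis using horizon by (simp add: LIMSEQ_unique)
qed

section \<open>Passage to the limit\<close>

text \<open>Skorohod's theorem represents both weakly convergent sequences by sequences that converge
  pointwise, and the inner and the outer integral converge by dominated convergence. A positive
  limit of the first sequence keeps the arguments of the powers positive.\<close>

lemma mixture_limit:
  fixes f :: "real \<Rightarrow> real" and a b e :: "nat \<Rightarrow> real"
  assumes \<nu>: "\<And>n. real_distribution (\<nu> n)" "real_distribution \<nu>0" "weak_conv_m \<nu> \<nu>0" and pos: "AE v in \<nu>0. 0 < v"
    and \<rho>: "\<And>n. real_distribution (\<rho> n)" "real_distribution \<rho>0" "weak_conv_m \<rho> \<rho>0"
    and f: "continuous_on UNIV f" "\<And>x. \<bar>f x\<bar> \<le> B"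
    and a: "a \<longlonglongrightarrow> a0" and b: "b \<longlonglongrightarrow> b0" and e: "e \<longlonglongrightarrow> 0" and k: "0 < k" and p: "0 < p" and mu: "0 < mu"
  shows "(\<lambda>n. \<integral>v. (\<integral>q. f (a n * (v / k) powr p * fst q
        + b n * sqrt ((1 - ((e n)\<^sup>2 * v / k) powr (2 * p)) / (2 * mu)) * snd q) \<partial>(\<rho> n \<Otimes>\<^sub>M std_normal_distribution)) \<partial>\<nu> n)
    \<longlonglongrightarrow> (\<integral>v. (\<integral>q. f (a0 * (v / k) powr p * fst q + b0 * (1 / sqrt (2 * mu)) * snd q) \<partial>(\<rho>0 \<Otimes>\<^sub>M std_normal_distribution)) \<partial>\<nu>0)"
proof -
  obtain \<Omega>1 :: "real measure" and Y and Y0 where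
    O1: "prob_space \<Omega>1" and Ym[measurable]: "\<And>n. Y n \<in> borel_measurable \<Omega>1" and Yd: "\<And>n. distr \<Omega>1 borel (Y n) = \<nu> n"
    and Y0m: "Y0 \<in> measurable \<Omega>1 lborel" and Y0d: "distr \<Omega>1 borel Y0 = \<nu>0"
    and Yl: "\<And>x. x \<in> space \<Omega>1 \<Longrightarrow> (\<lambda>n. Y n x) \<longlonglongrightarrow> Y0 x"
    using Skorohod[OF \<nu>] by blast
  obtain \<Omega>2 :: "real measure" and U and U0 where
    O2: "prob_space \<Omega>2" and Um[measurable]: "\<And>n. U n \<in> borel_measurable \<Omega>2" and Ud: "\<And>n. distr \<Omega>2 borel (U n) = \<rho> n"
    and U0m: "U0 \<in> measurable \<Omega>2 lborel" and U0d: "distr \<Omega>2 borel U0 = \<rho>0"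
    and Ul: "\<And>x. x \<in> space \<Omega>2 \<Longrightarrow> (\<lambda>n. U n x) \<longlonglongrightarrow> U0 x"
    using Skorohod[OF \<rho>] by blast
  have Y0[measurable]: "Y0 \<in> borel_measurable \<Omega>1" and U0[measurable]: "U0 \<in> borel_measurable \<Omega>2"
    using Y0m U0m by simp_all
  interpret O1: prob_space \<Omega>1 by (rule O1)
  interpret O2: prob_space \<Omega>2 by (rule O2)
  interpret N: prob_space std_normal_distribution by (rule prob_space_normal_density) simp
  let ?P = "\<Omega>2 \<Otimes>\<^sub>M std_normal_distribution"
  interpret P: prob_space ?P by (rule prob_space_pair_std_normal[OF O2])
  have fm[measurable]: "f \<in> borel_measurable borel" by (rule borel_measurable_continuous_onI[OF f(1)])
  have cont: "isCont f x" for x using f(1) by (simp add: continuous_on_eq_continuous_at)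
  have inner: "(\<integral>q. f (c * fst q + d * snd q) \<partial>(distr \<Omega>2 borel u \<Otimes>\<^sub>M std_normal_distribution))
      = (\<integral>q. f (c * u (fst q) + d * snd q) \<partial>?P)" if [measurable]: "u \<in> borel_measurable \<Omega>2" for u c d
  proof -
    have "distr \<Omega>2 borel u \<Otimes>\<^sub>M std_normal_distribution = distr \<Omega>2 borel u \<Otimes>\<^sub>M distr std_normal_distribution borel (\<lambda>z. z)"
      by (simp add: distr_id2)
    also have "\<dots> = distr ?P (borel \<Otimes>\<^sub>M borel) (\<lambda>(x, z). (u x, z))"
    proof (rule pair_measure_distr)
      interpret D: prob_space "distr std_normal_distribution borel (\<lambda>z. z)" by (rule N.prob_space_distr) simp
      show "sigma_finite_measure (distr std_normal_distribution borel (\<lambda>z. z))" by unfold_locales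
    qed auto
    finally show ?thesis by (simp add: integral_distr case_prod_beta)
  qed
  have outer: "(\<integral>v. (\<integral>q. f (c v * fst q + d v * snd q) \<partial>(distr \<Omega>2 borel u \<Otimes>\<^sub>M std_normal_distribution)) \<partial>distr \<Omega>1 borel y)
      = (\<integral>\<omega>. (\<integral>q. f (c (y \<omega>) * u (fst q) + d (y \<omega>) * snd q) \<partial>?P) \<partial>\<Omega>1)"
    if [measurable]: "u \<in> borel_measurable \<Omega>2" "y \<in> borel_measurable \<Omega>1" "c \<in> borel_measurable borel" "d \<in> borel_measurable borel"
    for u y c d
    unfolding inner[OF that(1)] by (rule integral_distr) measurable
  define c where "c n v = a n * (v / k) powr p" for n v
  define d where "d n v = b n * sqrt ((1 - ((e n)\<^sup>2 * v / k) powr (2 * p)) / (2 * mu))" for n v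
  define c0 where "c0 v = a0 * (v / k) powr p" for v
  define d0 :: "real \<Rightarrow> real" where "d0 v = b0 * (1 / sqrt (2 * mu))" for v
  have cm[measurable]: "c n \<in> borel_measurable borel" "d n \<in> borel_measurable borel" "c0 \<in> borel_measurable borel" "d0 \<in> borel_measurable borel" for n
    unfolding c_def d_def c0_def d0_def by measurable
  have Y0pos: "AE \<omega> in \<Omega>1. 0 < Y0 \<omega>" using pos unfolding Y0d[symmetric] by (subst (asm) AE_distr_iff) auto
  have "(\<lambda>n. \<integral>\<omega>. (\<integral>q. f (c n (Y n \<omega>) * U n (fst q) + d n (Y n \<omega>) * snd q) \<partial>?P) \<partial>\<Omega>1)
      \<longlonglongrightarrow> (\<integral>\<omega>. (\<integral>q. f (c0 (Y0 \<omega>) * U0 (fst q) + d0 (Y0 \<omega>) * snd q) \<partial>?P) \<partial>\<Omega>1)"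
  proof (rule integral_dominated_convergence[where w = "\<lambda>_. B"])
    show "AE \<omega> in \<Omega>1. (\<lambda>n. \<integral>q. f (c n (Y n \<omega>) * U n (fst q) + d n (Y n \<omega>) * snd q) \<partial>?P)
        \<longlonglongrightarrow> (\<integral>q. f (c0 (Y0 \<omega>) * U0 (fst q) + d0 (Y0 \<omega>) * snd q) \<partial>?P)"
      using Y0pos AE_space
    proof eventually_elim
      case (elim \<omega>)
      note yl = Yl[OF elim(2)]
      have ypos: "\<forall>\<^sub>F n in sequentially. 0 < Y n \<omega>" using yl elim(1) by (rule order_tendstoD)
      have "(\<lambda>n. c n (Y n \<omega>)) \<longlonglongrightarrow> c0 (Y0 \<omega>)"
        unfolding c_def c0_def by (intro tendsto_mult a tendsto_powr tendsto_divide yl tendsto_const) (use elim k in auto)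
      moreover have "(\<lambda>n. d n (Y n \<omega>)) \<longlonglongrightarrow> d0 (Y0 \<omega>)"
      proof -
        have "(\<lambda>n. (e n)\<^sup>2 * Y n \<omega> / k) \<longlonglongrightarrow> 0\<^sup>2 * Y0 \<omega> / k"
          by (intro tendsto_intros e yl) (use k in auto)
        then have z: "(\<lambda>n. (e n)\<^sup>2 * Y n \<omega> / k) \<longlonglongrightarrow> 0" by simp
        have "(\<lambda>n. ((e n)\<^sup>2 * Y n \<omega> / k) powr (2 * p)) \<longlonglongrightarrow> 0 powr (2 * p)"
        proof (rule tendsto_powr'[OF z tendsto_const])
          have "\<forall>\<^sub>F n in sequentially. 0 \<le> (e n)\<^sup>2 * Y n \<omega> / k"
            using ypos by eventually_elim (use k in simp)
          then show "0 \<noteq> (0::real) \<or> 0 < 2 * p \<and> (\<forall>\<^sub>F n in sequentially. 0 \<le> (e n)\<^sup>2 * Y n \<omega> / k)"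
            using p by simp
        qed
        then have "(\<lambda>n. d n (Y n \<omega>)) \<longlonglongrightarrow> b0 * sqrt ((1 - 0 powr (2 * p)) / (2 * mu))"
          unfolding d_def by (intro tendsto_mult b tendsto_real_sqrt tendsto_divide tendsto_diff tendsto_const) (use mu in auto)
        then show ?thesis by (simp add: d0_def real_sqrt_divide)
      qed
      ultimately show ?case
      proof (intro integral_dominated_convergence[where w = "\<lambda>_. B"])
        assume C: "(\<lambda>n. c n (Y n \<omega>)) \<longlonglongrightarrow> c0 (Y0 \<omega>)" and D: "(\<lambda>n. d n (Y n \<omega>)) \<longlonglongrightarrow> d0 (Y0 \<omega>)"
        show "AE q in ?P. (\<lambda>n. f (c n (Y n \<omega>) * U n (fst q) + d n (Y n \<omega>) * snd q))
            \<longlonglongrightarrow> f (c0 (Y0 \<omega>) * U0 (fst q) + d0 (Y0 \<omega>) * snd q)"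
        proof (rule AE_I2)
          fix q assume "q \<in> space ?P"
          then have "fst q \<in> space \<Omega>2" by (auto simp: space_pair_measure)
          then show "(\<lambda>n. f (c n (Y n \<omega>) * U n (fst q) + d n (Y n \<omega>) * snd q))
            \<longlonglongrightarrow> f (c0 (Y0 \<omega>) * U0 (fst q) + d0 (Y0 \<omega>) * snd q)"
            by (intro isCont_tendsto_compose[OF cont] tendsto_add tendsto_mult C D Ul tendsto_const)
        qed
      qed (use f(2) in auto)
    qed
    show "AE \<omega> in \<Omega>1. norm (\<integral>q. f (c n (Y n \<omega>) * U n (fst q) + d n (Y n \<omega>) * snd q) \<partial>?P) \<le> B" for n
    proof (rule AE_I2)
      fix \<omega>
      let ?h = "\<lambda>q. f (c n (Y n \<omega>) * U n (fst q) + d n (Y n \<omega>) * snd q)"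
      have "\<bar>\<integral>q. ?h q \<partial>?P\<bar> \<le> (\<integral>q. \<bar>?h q\<bar> \<partial>?P)" by (rule integral_abs_bound)
      also have "\<dots> \<le> (\<integral>q. B \<partial>?P)"
        by (rule integral_mono) (use f(2) in \<open>auto intro!: P.integrable_const_bound[of _ B]\<close>)
      finally show "norm (\<integral>q. ?h q \<partial>?P) \<le> B" by (simp add: P.prob_space)
    qed
  qed auto
  then show ?thesis
    unfolding outer[OF Um Ym cm(1,2), symmetric] outer[OF U0 Y0 cm(3,4), symmetric] Yd Ud Y0d U0d
    unfolding c_def d_def c0_def d0_def .
qed

text \<open>The random time is rounded up to the grid of mesh \<open>1 / Suc n\<close>, where countably many values are
  taken.\<close>

lemma path_evaluation_measurable:
  fixes X :: "real \<Rightarrow> 'w \<Rightarrow> real"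
  assumes X: "solves_linear M b e W X" and \<tau>[measurable]: "\<tau> \<in> borel_measurable M" and \<tau>0: "\<And>\<omega>. 0 \<le> \<tau> \<omega>"
  shows "(\<lambda>\<omega>. X (\<tau> \<omega>) \<omega>) \<in> borel_measurable M"
proof (rule borel_measurable_LIMSEQ_metric)
  define j where "j n \<omega> = nat \<lceil>real (Suc n) * \<tau> \<omega>\<rceil>" for n \<omega>
  have jm: "j n \<in> measurable M (count_space UNIV)" for n unfolding j_def by measurable
  show "(\<lambda>\<omega>. X (real (j n \<omega>) / real (Suc n)) \<omega>) \<in> borel_measurable M" for n
  proof (rule measurable_compose_countable[where f = "\<lambda>i \<omega>. X (real i / real (Suc n)) \<omega>", OF _ jm])
    show "(\<lambda>\<omega>. X (real i / real (Suc n)) \<omega>) \<in> borel_measurable M" for i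
      by (rule solves_linearD(1)[OF X]) simp
  qed
  fix \<omega> assume \<omega>: "\<omega> \<in> space M"
  have "(\<lambda>n. real (j n \<omega>) / real (Suc n)) \<longlonglongrightarrow> \<tau> \<omega>"
  proof (rule tendsto_sandwich[of "\<lambda>_. \<tau> \<omega>" _ _ "\<lambda>n. \<tau> \<omega> + 1 / real (Suc n)"])
    have jr: "real (j n \<omega>) = of_int \<lceil>real (Suc n) * \<tau> \<omega>\<rceil>" for n
    proof -
      have "0 \<le> real (Suc n) * \<tau> \<omega>" by (rule mult_nonneg_nonneg[OF of_nat_0_le_iff \<tau>0])
      then have "0 \<le> \<lceil>real (Suc n) * \<tau> \<omega>\<rceil>" by linarith
      then show ?thesis unfolding j_def by (rule of_nat_nat)
    qed
    show "\<forall>\<^sub>F n in sequentially. \<tau> \<omega> \<le> real (j n \<omega>) / real (Suc n)"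
      by (intro always_eventually allI) (simp only: jr pos_le_divide_eq of_nat_0_less_iff zero_less_Suc mult.commute[of "\<tau> \<omega>"] le_of_int_ceiling)
    have "real (j n \<omega>) / real (Suc n) \<le> \<tau> \<omega> + 1 / real (Suc n)" for n
    proof -
      have "real (j n \<omega>) \<le> real (Suc n) * \<tau> \<omega> + 1" unfolding jr by (rule of_int_ceiling_le_add_one)
      then have "real (j n \<omega>) / real (Suc n) \<le> (real (Suc n) * \<tau> \<omega> + 1) / real (Suc n)" by (rule divide_right_mono) simp
      then show ?thesis by (simp only: add_divide_distrib nonzero_mult_div_cancel_left of_nat_eq_0_iff nat.simps) simp
    qed
    then show "\<forall>\<^sub>F n in sequentially. real (j n \<omega>) / real (Suc n) \<le> \<tau> \<omega> + 1 / real (Suc n)" by simp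
    show "(\<lambda>n. \<tau> \<omega> + 1 / real (Suc n)) \<longlonglongrightarrow> \<tau> \<omega>" by real_asymp
  qed simp
  then show "(\<lambda>n. X (real (j n \<omega>) / real (Suc n)) \<omega>) \<longlonglongrightarrow> X (\<tau> \<omega>) \<omega>"
    by (rule continuous_on_tendsto_compose[OF solves_linearD(2)[OF X \<omega>]])
       (auto intro: \<tau>0 always_eventually)
qed

lemma hitting_time_nonneg: "0 \<le> real_of_ereal (hitting_time Y S \<omega>)"
  unfolding hitting_time_def by (intro real_of_ereal_pos Inf_greatest) auto

lemma strong_solution_components:
  fixes W1 W2 :: "real \<Rightarrow> 'w \<Rightarrow> real" and X :: "real \<Rightarrow> 'w \<Rightarrow> real \<times> real"
  assumes W: "\<And>t. 0 \<le> t \<Longrightarrow> W1 t \<in> borel_measurable M" "\<And>t. 0 \<le> t \<Longrightarrow> W2 t \<in> borel_measurable M"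
    and Y: "Y0 \<in> borel_measurable M"
    and X: "strong_solution M (\<lambda>(y1, y2). (lam * y1, - mu * y2)) e (\<lambda>t \<omega>. (W1 t \<omega>, W2 t \<omega>)) (\<lambda>\<omega>. (x1, Y0 \<omega>)) X"
  shows "solves_linear M lam e W1 (\<lambda>t \<omega>. fst (X t \<omega>))" and "solves_linear M (- mu) e W2 (\<lambda>t \<omega>. snd (X t \<omega>))"
    and "AE \<omega> in M. fst (X 0 \<omega>) = x1" and "AE \<omega> in M. snd (X 0 \<omega>) = Y0 \<omega>"
proof -
  let ?W = "\<lambda>t \<omega>. (W1 t \<omega>, W2 t \<omega>)" and ?Y = "\<lambda>\<omega>. (x1, Y0 \<omega>)"
  have Xm: "X t \<in> borel_measurable M" if t: "0 \<le> t" for t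
  proof -
    let ?N = "driving_filtration M ?Y ?W t"
    let ?G = "{?Y -` A \<inter> space M | A. A \<in> sets borel} \<union>
        {?W s -` A \<inter> space M | s A. 0 \<le> s \<and> s \<le> t \<and> A \<in> sets borel} \<union> null_sets M"
    have G: "?G \<subseteq> Pow (space M)" by (auto dest: sets.sets_into_space)
    have Ym: "?Y \<in> borel_measurable M" using Y by measurable
    have Wm: "?W s \<in> borel_measurable M" if "0 \<le> s" for s using W[OF that] by measurable
    have "?G \<subseteq> sets M"
    proof (intro Un_least subsetI)
      fix S assume "S \<in> {?Y -` A \<inter> space M | A. A \<in> sets borel}"
      then show "S \<in> sets M" using measurable_sets[OF Ym] by blast
    next
      fix S assume "S \<in> {?W s -` A \<inter> space M | s A. 0 \<le> s \<and> s \<le> t \<and> A \<in> sets borel}"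
      then obtain s A where "S = ?W s -` A \<inter> space M" "0 \<le> s" "A \<in> sets borel" by blast
      then show "S \<in> sets M" using measurable_sets[OF Wm[of s]] by simp
    qed auto
    then have "sets ?N \<subseteq> sets M"
      unfolding driving_filtration_def sets_measure_of[OF G] by (rule sets.sigma_sets_subset)
    moreover have "space ?N = space M" unfolding driving_filtration_def by (rule space_measure_of[OF G])
    moreover have "X t \<in> borel_measurable ?N" using X t unfolding strong_solution_def by blast
    ultimately show ?thesis using subsetD[OF measurable_mono[OF order_refl refl, of ?N M borel]] by blast
  qed
  have cont: "continuous_on {0..} (\<lambda>t. X t \<omega>)" if "\<omega> \<in> space M" for \<omega>
    using X that unfolding strong_solution_def by blast
  have init: "AE \<omega> in M. X 0 \<omega> = (x1, Y0 \<omega>)" using X unfolding strong_solution_def by blast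
  then show "AE \<omega> in M. fst (X 0 \<omega>) = x1" "AE \<omega> in M. snd (X 0 \<omega>) = Y0 \<omega>" by (eventually_elim, simp)+
  have eq: "AE \<omega> in M. \<forall>t\<ge>0. (\<lambda>s. (\<lambda>(y1, y2). (lam * y1, - mu * y2)) (X s \<omega>)) absolutely_integrable_on {0..t} \<and>
        X t \<omega> = X 0 \<omega> + integral {0..t} (\<lambda>s. (\<lambda>(y1, y2). (lam * y1, - mu * y2)) (X s \<omega>)) + e *\<^sub>R (W1 t \<omega>, W2 t \<omega>)"
    using X unfolding strong_solution_def by blast
  have lin: "h (X t \<omega>) = h (X 0 \<omega>) + integral {0..t} (\<lambda>s. h (case X s \<omega> of (y1, y2) \<Rightarrow> (lam * y1, - mu * y2))) + e * h (W1 t \<omega>, W2 t \<omega>)"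
    if h: "bounded_linear h" and *: "(\<lambda>s. (\<lambda>(y1, y2). (lam * y1, - mu * y2)) (X s \<omega>)) absolutely_integrable_on {0..t} \<and>
        X t \<omega> = X 0 \<omega> + integral {0..t} (\<lambda>s. (\<lambda>(y1, y2). (lam * y1, - mu * y2)) (X s \<omega>)) + e *\<^sub>R (W1 t \<omega>, W2 t \<omega>)"
    for h :: "real \<times> real \<Rightarrow> real" and t \<omega>
  proof -
    interpret bounded_linear h by (rule h)
    let ?v = "\<lambda>s. case X s \<omega> of (y1, y2) \<Rightarrow> (lam * y1, - mu * y2)"
    have "?v integrable_on {0..t}" using *[THEN conjunct1] by (rule set_lebesgue_integral_eq_integral(1))
    then have I: "integral {0..t} (\<lambda>s. h (?v s)) = h (integral {0..t} ?v)"
      using integral_linear[OF _ h] by (simp add: comp_def)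
    have "h (X t \<omega>) = h (X 0 \<omega> + integral {0..t} ?v + e *\<^sub>R (W1 t \<omega>, W2 t \<omega>))"
      by (rule arg_cong[where f = h, OF *[THEN conjunct2]])
    then show ?thesis unfolding I by (simp only: add scale real_scaleR_def)
  qed
  show "solves_linear M lam e W1 (\<lambda>t \<omega>. fst (X t \<omega>))"
    unfolding solves_linear_def
  proof (intro conjI allI impI ballI)
    show "(\<lambda>\<omega>. fst (X t \<omega>)) \<in> borel_measurable M" if "0 \<le> t" for t
      by (rule measurable_compose[OF Xm[OF that]]) (simp add: borel_prod[symmetric])
    show "continuous_on {0..} (\<lambda>t. fst (X t \<omega>))" if "\<omega> \<in> space M" for \<omega>
      by (rule continuous_on_fst[OF cont[OF that]])
    show "AE \<omega> in M. \<forall>t\<ge>0. fst (X t \<omega>) = fst (X 0 \<omega>) + integral {0..t} (\<lambda>s. lam * fst (X s \<omega>)) + e * W1 t \<omega>"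
      using eq
    proof (eventually_elim, intro allI impI)
      fix \<omega> and t :: real assume "0 \<le> t" and all: "\<forall>t\<ge>0. (\<lambda>s. (\<lambda>(y1, y2). (lam * y1, - mu * y2)) (X s \<omega>)) absolutely_integrable_on {0..t} \<and>
        X t \<omega> = X 0 \<omega> + integral {0..t} (\<lambda>s. (\<lambda>(y1, y2). (lam * y1, - mu * y2)) (X s \<omega>)) + e *\<^sub>R (W1 t \<omega>, W2 t \<omega>)"
      from lin[OF bounded_linear_fst all[THEN spec, THEN mp, OF \<open>0 \<le> t\<close>]]
      show "fst (X t \<omega>) = fst (X 0 \<omega>) + integral {0..t} (\<lambda>s. lam * fst (X s \<omega>)) + e * W1 t \<omega>"
        by (simp only: case_prod_beta fst_conv)
    qed
  qed
  show "solves_linear M (- mu) e W2 (\<lambda>t \<omega>. snd (X t \<omega>))"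
    unfolding solves_linear_def
  proof (intro conjI allI impI ballI)
    show "(\<lambda>\<omega>. snd (X t \<omega>)) \<in> borel_measurable M" if "0 \<le> t" for t
      by (rule measurable_compose[OF Xm[OF that]]) (simp add: borel_prod[symmetric])
    show "continuous_on {0..} (\<lambda>t. snd (X t \<omega>))" if "\<omega> \<in> space M" for \<omega>
      by (rule continuous_on_snd[OF cont[OF that]])
    show "AE \<omega> in M. \<forall>t\<ge>0. snd (X t \<omega>) = snd (X 0 \<omega>) + integral {0..t} (\<lambda>s. - mu * snd (X s \<omega>)) + e * W2 t \<omega>"
      using eq
    proof (eventually_elim, intro allI impI)
      fix \<omega> and t :: real assume "0 \<le> t" and all: "\<forall>t\<ge>0. (\<lambda>s. (\<lambda>(y1, y2). (lam * y1, - mu * y2)) (X s \<omega>)) absolutely_integrable_on {0..t} \<and>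
        X t \<omega> = X 0 \<omega> + integral {0..t} (\<lambda>s. (\<lambda>(y1, y2). (lam * y1, - mu * y2)) (X s \<omega>)) + e *\<^sub>R (W1 t \<omega>, W2 t \<omega>)"
      from lin[OF bounded_linear_snd all[THEN spec, THEN mp, OF \<open>0 \<le> t\<close>]]
      show "snd (X t \<omega>) = snd (X 0 \<omega>) + integral {0..t} (\<lambda>s. - mu * snd (X s \<omega>)) + e * W2 t \<omega>"
        by (simp only: case_prod_beta snd_conv)
    qed
  qed
qed

text \<open>On exit, the variable \<open>V = k e\<^sup>-\<^sup>2 exp (-lam \<tau>)\<close> carries the randomness of the exit time, and
  \<open>exp (-mu \<tau>)\<close> is \<open>(e\<^sup>2 V / k)\<close> to the power \<open>mu / lam\<close>. So the integral is a mixture over \<open>V\<close> to which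
  \<open>mixture_limit\<close> applies, with powers of \<open>e\<close> as coefficients; the choice of \<open>\<beta>\<close> makes both exponents
  nonnegative, and a coefficient survives in the limit if its exponent is \<open>0\<close>.\<close>

lemma (in prob_space) conditional_exit_limit:
  fixes W1 W2 :: "real \<Rightarrow> 'a \<Rightarrow> real" and X1 X2 :: "nat \<Rightarrow> real \<Rightarrow> 'a \<Rightarrow> real" and \<xi> :: "nat \<Rightarrow> 'a \<Rightarrow> real"
    and e :: "nat \<Rightarrow> real" and f :: "real \<Rightarrow> real"
  assumes W: "standard_wiener M W1" "standard_wiener M W2"
    and i12: "indep_elements M path_space (sample_path W1) path_space (sample_path W2)"
    and i0: "\<And>n. indep_elements M borel (\<xi> n) path_space (sample_path (\<lambda>t \<omega>. (W1 t \<omega>, W2 t \<omega>)))"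
    and X1: "\<And>n. solves_linear M lam (e n) W1 (X1 n)" and X10: "\<And>n. AE \<omega> in M. X1 n 0 \<omega> = x0"
    and X2: "\<And>n. solves_linear M (- mu) (e n) W2 (X2 n)" and X20: "\<And>n. AE \<omega> in M. X2 n 0 \<omega> = e n powr \<alpha> * \<xi> n \<omega>"
    and lam: "0 < lam" and mu: "0 < mu" and q: "qm < x0" "x0 < 0" "0 < qp" and e: "\<And>n. 0 < e n" "e \<longlonglongrightarrow> 0"
    and \<rho>0: "real_distribution \<rho>0" "weak_conv_m (\<lambda>n. distr M borel (\<xi> n)) \<rho>0"
    and \<nu>0: "real_distribution \<nu>0" "\<And>v. 0 \<le> v \<Longrightarrow> cdf \<nu>0 v = 1 - exp (- v)" "AE v in \<nu>0. 0 < v"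
    and f: "continuous_on UNIV f" "\<And>x. \<bar>f x\<bar> \<le> B" and \<beta>: "\<beta> = min 1 (2 * mu / lam + \<alpha>)"
  defines "\<tau> \<equiv> \<lambda>n \<omega>. real_of_ereal (hitting_time (X1 n) {qm, qp} \<omega>)"
    and "C \<equiv> \<lambda>n. {\<omega>\<in>space M. hitting_time (X1 n) {qm, qp} \<omega> < \<infinity> \<and> X1 n (real_of_ereal (hitting_time (X1 n) {qm, qp} \<omega>)) \<omega> = qp}"
    and "k \<equiv> 2 * lam * \<bar>x0\<bar> * qp"
  shows "(\<lambda>n. \<integral>\<omega>. f (1 / e n powr \<beta> * X2 n (\<tau> n \<omega>) \<omega>) \<partial>uniform_measure M (C n)) \<longlonglongrightarrow>
    (\<integral>v. (\<integral>r. f (of_bool (\<beta> = 2 * mu / lam + \<alpha>) * (v / k) powr (mu / lam) * fst r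
      + of_bool (\<beta> = 1) * (1 / sqrt (2 * mu)) * snd r) \<partial>(\<rho>0 \<Otimes>\<^sub>M std_normal_distribution)) \<partial>\<nu>0)"
proof -
  have ne: "qm \<noteq> qp" using q by auto
  have kp: "0 < k" unfolding k_def by (intro mult_pos_pos) (use lam q in auto)
  define p where "p = mu / lam"
  have p: "0 < p" using lam mu by (simp add: p_def)
  define V where "V n \<omega> = k / (e n)\<^sup>2 * exp (- lam * \<tau> n \<omega>)" for n \<omega>
  have Vpos: "0 < V n \<omega>" for n \<omega> unfolding V_def using kp e(1)[of n] by simp
  have fm[measurable]: "f \<in> borel_measurable borel" by (rule borel_measurable_continuous_onI[OF f(1)])
  have \<tau>m[measurable]: "\<tau> n \<in> borel_measurable M" for n
    unfolding \<tau>_def by (rule hitting_time_measurable(2)[OF X1 ne])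
  have Vm[measurable]: "V n \<in> borel_measurable M" for n unfolding V_def by measurable
  have X2\<tau>[measurable]: "(\<lambda>\<omega>. X2 n (\<tau> n \<omega>) \<omega>) \<in> borel_measurable M" for n
    by (rule path_evaluation_measurable[OF X2 \<tau>m]) (simp add: \<tau>_def hitting_time_nonneg)
  have \<xi>m[measurable]: "\<xi> n \<in> borel_measurable M" for n using i0[of n] unfolding indep_elements_def by simp
  have Cm[measurable]: "C n \<in> events" for n
  proof -
    have "{\<omega>\<in>space M. hits_first (\<lambda>t. X1 n t \<omega>) qp qm (real (Suc m))} \<in> events" for m
      by (rule hits_first_measurable) (use solves_linearD[OF X1] in auto)
    moreover have "C n = (\<Union>m. {\<omega>\<in>space M. hits_first (\<lambda>t. X1 n t \<omega>) qp qm (real (Suc m))})"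
      unfolding C_def by (rule hits_first_limit(1)[OF solves_linearD(2)[OF X1] ne])
    ultimately show ?thesis by (simp only: sets.countable_UN subset_iff image_iff) blast
  qed
  have law1: "\<forall>\<^sub>F n in sequentially. 0 < prob (C n)"
    using exit_time_law(1)[OF W(1) X1 X10 lam q e order_refl] unfolding C_def .
  have law2: "(\<lambda>n. prob {\<omega>\<in>C n. v < V n \<omega>} / prob (C n)) \<longlonglongrightarrow> exp (- v)" if "0 \<le> v" for v
    using exit_time_law(2)[OF W(1) X1 X10 lam q e that] unfolding C_def V_def \<tau>_def k_def .
  \<comment> \<open>The conditional measure is meaningful only if the exit event has positive probability, which is known for large \<open>n\<close>.\<close>
  obtain N0 where N0: "\<And>n. N0 \<le> n \<Longrightarrow> 0 < prob (C n)"
    using law1 unfolding eventually_sequentially by blast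
  let ?s = "\<lambda>n. n + N0"
  have PC: "0 < prob (C (?s n))" for n by (rule N0) simp
  let ?Q = "\<lambda>n. uniform_measure M (C (?s n))"
  have Q: "prob_space (?Q n)" for n
    by (rule prob_space_uniform_measure) (use PC[of n] in \<open>auto simp: emeasure_eq_measure\<close>)
  define \<nu> where "\<nu> n = distr (?Q n) borel (V (?s n))" for n
  have \<nu>: "real_distribution (\<nu> n)" for n
    unfolding \<nu>_def by (rule prob_space.real_distribution_distr[OF Q]) simp
  have weak: "weak_conv_m \<nu> \<nu>0"
    unfolding weak_conv_m_def weak_conv_def
  proof (intro allI impI)
    fix x :: real
    have cdf\<nu>: "cdf (\<nu> n) x = 1 - prob {\<omega>\<in>C (?s n). x < V (?s n) \<omega>} / prob (C (?s n))" for n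
    proof -
      interpret Q: prob_space "?Q n" by (rule Q)
      have m: "{\<omega>\<in>space M. x < V (?s n) \<omega>} \<in> events" by measurable
      have "cdf (\<nu> n) x = Q.prob {\<omega>\<in>space M. V (?s n) \<omega> \<le> x}"
        unfolding cdf_def \<nu>_def by (subst measure_distr) (auto intro!: arg_cong2[where f = measure])
      also have "\<dots> = Q.prob (space (?Q n) - {\<omega>\<in>space M. x < V (?s n) \<omega>})"
        by (rule arg_cong2[where f = measure]) auto
      also have "\<dots> = 1 - Q.prob {\<omega>\<in>space M. x < V (?s n) \<omega>}"
        by (rule Q.prob_compl) (use m in simp)
      also have "Q.prob {\<omega>\<in>space M. x < V (?s n) \<omega>} = prob (C (?s n) \<inter> {\<omega>\<in>space M. x < V (?s n) \<omega>}) / prob (C (?s n))"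
        by (rule measure_uniform_measure) (use m PC[of n] in \<open>auto simp: emeasure_eq_measure\<close>)
      also have "C (?s n) \<inter> {\<omega>\<in>space M. x < V (?s n) \<omega>} = {\<omega>\<in>C (?s n). x < V (?s n) \<omega>}"
        using sets.sets_into_space[OF Cm] by auto
      finally show ?thesis .
    qed
    show "(\<lambda>n. cdf (\<nu> n) x) \<longlonglongrightarrow> cdf \<nu>0 x"
    proof (cases "0 \<le> x")
      case True
      have "(\<lambda>n. 1 - prob {\<omega>\<in>C (?s n). x < V (?s n) \<omega>} / prob (C (?s n))) \<longlonglongrightarrow> 1 - exp (- x)"
        by (intro tendsto_diff tendsto_const LIMSEQ_ignore_initial_segment[OF law2[OF True]])
      then show ?thesis unfolding cdf\<nu> \<nu>0(2)[OF True] .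
    next
      case False
      interpret V0: real_distribution \<nu>0 by (rule \<nu>0(1))
      have "AE v in \<nu>0. v \<notin> {..x}" using \<nu>0(3) by eventually_elim (use False in auto)
      then have "{..x} \<in> null_sets \<nu>0" by (subst (asm) AE_iff_null_sets[symmetric]) auto
      then have "cdf \<nu>0 x = 0" by (simp add: cdf_def measure_def null_sets_def)
      moreover have "{\<omega>\<in>C (?s n). x < V (?s n) \<omega>} = C (?s n)" for n
      proof -
        have "x < V (?s n) \<omega>" for \<omega> using Vpos[of "?s n" \<omega>] False by linarith
        then show ?thesis by auto
      qed
      ultimately show ?thesis unfolding cdf\<nu> using PC by (simp add: less_le)
    qed
  qed
  define \<rho> where "\<rho> n = distr M borel (\<xi> (?s n))" for n
  have \<rho>: "real_distribution (\<rho> n)" for n unfolding \<rho>_def by (rule real_distribution_distr) simp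
  have weak\<rho>: "weak_conv_m \<rho> \<rho>0"
    using \<rho>0(2) unfolding weak_conv_m_def weak_conv_def \<rho>_def
    by (auto intro: LIMSEQ_ignore_initial_segment[where f = "\<lambda>n. cdf (distr M borel (\<xi> n)) _"])
  define a where "a n = e (?s n) powr (\<alpha> + 2 * p - \<beta>)" for n
  define b where "b n = e (?s n) powr (1 - \<beta>)" for n
  have es: "(\<lambda>n. e (?s n)) \<longlonglongrightarrow> 0" by (rule LIMSEQ_ignore_initial_segment[OF e(2)])
  have powlim: "(\<lambda>n. e (?s n) powr r) \<longlonglongrightarrow> of_bool (r = 0)" if "0 \<le> r" for r
  proof (cases "r = 0")
    case True
    then show ?thesis using e(1) by (simp add: less_imp_neq[symmetric])
  next
    case False
    have "(\<lambda>n. e (?s n) powr r) \<longlonglongrightarrow> 0 powr r"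
      by (rule tendsto_powr'[OF es tendsto_const]) (use that False e(1) in \<open>auto intro!: always_eventually less_imp_le\<close>)
    then show ?thesis using False by simp
  qed
  have alim: "a \<longlonglongrightarrow> of_bool (\<beta> = 2 * mu / lam + \<alpha>)"
  proof -
    have "a \<longlonglongrightarrow> of_bool (\<alpha> + 2 * p - \<beta> = 0)" unfolding a_def by (rule powlim) (simp add: \<beta> p_def)
    moreover have "(\<alpha> + 2 * p - \<beta> = 0) = (\<beta> = 2 * mu / lam + \<alpha>)" by (auto simp: p_def)
    ultimately show ?thesis by simp
  qed
  have blim: "b \<longlonglongrightarrow> of_bool (\<beta> = 1)"
  proof -
    have "b \<longlonglongrightarrow> of_bool (1 - \<beta> = 0)" unfolding b_def by (rule powlim) (simp add: \<beta>)
    moreover have "(1 - \<beta> = 0) = (\<beta> = 1)" by auto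
    ultimately show ?thesis by simp
  qed
  have main: "(\<integral>\<omega>. f (1 / e (?s n) powr \<beta> * X2 (?s n) (\<tau> (?s n) \<omega>) \<omega>) \<partial>?Q n)
      = (\<integral>v. (\<integral>r. f (a n * (v / k) powr p * fst r
        + b n * sqrt ((1 - ((e (?s n))\<^sup>2 * v / k) powr (2 * p)) / (2 * mu)) * snd r) \<partial>(\<rho> n \<Otimes>\<^sub>M std_normal_distribution)) \<partial>\<nu> n)"
    for n
  proof -
    let ?m = "?s n"
    let ?c = "1 / e ?m powr \<beta>"
    define \<Phi> where "\<Phi> v = (\<integral>r. f (a n * (v / k) powr p * fst r
        + b n * sqrt ((1 - ((e ?m)\<^sup>2 * v / k) powr (2 * p)) / (2 * mu)) * snd r) \<partial>(\<rho> n \<Otimes>\<^sub>M std_normal_distribution))" for v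
    define K where "K = transverse_mean f (?c * e ?m powr \<alpha>) (?c * e ?m) mu (distr M borel (\<xi> ?m))"
    interpret R: real_distribution "\<rho> n" by (rule \<rho>)
    interpret RN: prob_space "\<rho> n \<Otimes>\<^sub>M std_normal_distribution" by (rule prob_space_pair_std_normal[OF R.prob_space_axioms])
    have [measurable_cong]: "sets (\<rho> n) = sets borel" by (simp add: \<rho>_def)
    have \<Phi>m[measurable]: "\<Phi> \<in> borel_measurable borel" unfolding \<Phi>_def by measurable
    have em: "0 < e ?m" by (rule e(1))
    have K\<Phi>: "K (\<tau> ?m \<omega>) = \<Phi> (V ?m \<omega>)" for \<omega>
    proof -
      let ?t = "\<tau> ?m \<omega>"
      have v1: "(e ?m)\<^sup>2 * V ?m \<omega> / k = exp (- lam * ?t)" using em kp by (simp add: V_def)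
      have v2: "V ?m \<omega> / k = exp (- lam * ?t) / (e ?m)\<^sup>2" using em kp by (simp add: V_def)
      have p1: "exp (- lam * ?t) powr (2 * p) = exp (- 2 * mu * ?t)"
        unfolding powr_def using lam by (simp add: p_def)
      have p2: "(V ?m \<omega> / k) powr p = exp (- mu * ?t) * e ?m powr (- 2 * p)"
      proof -
        have "(exp (- lam * ?t) / (e ?m)\<^sup>2) powr p = exp (- lam * ?t) powr p / (e ?m)\<^sup>2 powr p"
          by (rule powr_divide)
        also have "exp (- lam * ?t) powr p = exp (- mu * ?t)" unfolding powr_def using lam by (simp add: p_def)
        also have "(e ?m)\<^sup>2 powr p = e ?m powr (2 * p)" using em by (simp add: powr_powr[symmetric] powr_numeral)
        finally show ?thesis unfolding v2 by (simp add: powr_minus divide_inverse)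
      qed
      have c1: "?c * e ?m powr \<alpha> * exp (- mu * ?t) = a n * (V ?m \<omega> / k) powr p"
      proof -
        have "e ?m powr (\<alpha> + 2 * p - \<beta>) * e ?m powr (- 2 * p) = e ?m powr (\<alpha> - \<beta>)" by (simp flip: powr_add)
        moreover have "?c * e ?m powr \<alpha> = e ?m powr (\<alpha> - \<beta>)" by (simp add: powr_diff)
        ultimately show ?thesis unfolding p2 a_def by (simp add: mult_ac)
      qed
      have c2: "?c * e ?m = b n" using em by (simp add: b_def powr_diff)
      show ?thesis
        unfolding K_def transverse_mean_def \<Phi>_def c1 c2 v1 p1 \<rho>_def ..
    qed
    have "(\<integral>\<omega>. f (?c * X2 ?m (\<tau> ?m \<omega>) \<omega>) \<partial>?Q n) = (\<integral>\<omega>. indicator (C ?m) \<omega> * f (?c * X2 ?m (\<tau> ?m \<omega>) \<omega>) \<partial>M) / prob (C ?m)"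
      by (rule integral_uniform_measure[OF Cm PC]) measurable
    also have "(\<integral>\<omega>. indicator (C ?m) \<omega> * f (?c * X2 ?m (\<tau> ?m \<omega>) \<omega>) \<partial>M) = (\<integral>\<omega>. indicator (C ?m) \<omega> * K (\<tau> ?m \<omega>) \<partial>M)"
      using exit_position_integral[where c = ?c, OF W i12 i0[of ?m] X1[of ?m] X10[of ?m] X2[of ?m] X20[of ?m] mu ne f
          X2\<tau>[of ?m, unfolded \<tau>_def]]
      unfolding C_def \<tau>_def K_def .
    also have "(\<integral>\<omega>. indicator (C ?m) \<omega> * K (\<tau> ?m \<omega>) \<partial>M) / prob (C ?m) = (\<integral>\<omega>. \<Phi> (V ?m \<omega>) \<partial>?Q n)"
      unfolding K\<Phi> by (rule integral_uniform_measure[OF Cm PC, symmetric]) measurable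
    also have "\<dots> = (\<integral>v. \<Phi> v \<partial>\<nu> n)"
      unfolding \<nu>_def by (rule integral_distr[symmetric]) auto
    finally show ?thesis unfolding \<Phi>_def .
  qed
  have "(\<lambda>n. \<integral>\<omega>. f (1 / e (?s n) powr \<beta> * X2 (?s n) (\<tau> (?s n) \<omega>) \<omega>) \<partial>?Q n) \<longlonglongrightarrow>
    (\<integral>v. (\<integral>r. f (of_bool (\<beta> = 2 * mu / lam + \<alpha>) * (v / k) powr p * fst r
      + of_bool (\<beta> = 1) * (1 / sqrt (2 * mu)) * snd r) \<partial>(\<rho>0 \<Otimes>\<^sub>M std_normal_distribution)) \<partial>\<nu>0)"
    unfolding main
    by (rule mixture_limit[OF \<nu> \<nu>0(1) weak \<nu>0(3) \<rho> \<rho>0(1) weak\<rho> f alim blim es kp p mu])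
  then show ?thesis unfolding p_def by (rule LIMSEQ_offset)
qed

text \<open>The iterated integral in the limit is an expectation, by independence of \<open>V\<close>, \<open>N\<close> and \<open>Z\<close>.\<close>

lemma (in prob_space) limit_law_integral:
  fixes V N Z :: "'a \<Rightarrow> real" and f :: "real \<Rightarrow> real"
  assumes ind: "indep_vars (\<lambda>_. borel) (\<lambda>i. [V, N, Z] ! i) {..<3}"
    and N: "distributed M lborel N std_normal_density"
    and f: "continuous_on UNIV f" "\<And>x. \<bar>f x\<bar> \<le> B"
  shows "(\<integral>v. (\<integral>r. f (c * (v / k) powr p * fst r + d * snd r) \<partial>(distr M borel Z \<Otimes>\<^sub>M std_normal_distribution)) \<partial>distr M borel V)
    = (\<integral>\<omega>. f (c * (V \<omega> powr p * Z \<omega> / k powr p) + d * N \<omega>) \<partial>M)"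
proof -
  have [measurable]: "f \<in> borel_measurable borel" by (rule borel_measurable_continuous_onI[OF f(1)])
  \<comment> \<open>\<open>indep_var\<close> relates variables with values in the same type, hence the dummy component.\<close>
  let ?V = "\<lambda>\<omega>. (V \<omega>, 0::real)"
  have iV: "indep_var (borel \<Otimes>\<^sub>M borel) ?V (borel \<Otimes>\<^sub>M borel) (\<lambda>\<omega>. (Z \<omega>, N \<omega>))"
  proof -
    have "indep_var (borel \<Otimes>\<^sub>M borel) ((\<lambda>g. (g 0, 0::real)) \<circ> (\<lambda>\<omega>. restrict (\<lambda>i. ([V, N, Z] ! i) \<omega>) {0::nat}))
        (borel \<Otimes>\<^sub>M borel) ((\<lambda>g. (g 2, g 1)) \<circ> (\<lambda>\<omega>. restrict (\<lambda>i. ([V, N, Z] ! i) \<omega>) {1, 2}))"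
      by (rule indep_var_compose[OF indep_var_restrict[OF ind]]) auto
    then show ?thesis by (simp add: comp_def)
  qed
  have iZ: "indep_var borel Z borel N"
  proof -
    have "indep_var borel ((\<lambda>g. g 2) \<circ> (\<lambda>\<omega>. restrict (\<lambda>i. ([V, N, Z] ! i) \<omega>) {2::nat}))
        borel ((\<lambda>g. g 1) \<circ> (\<lambda>\<omega>. restrict (\<lambda>i. ([V, N, Z] ! i) \<omega>) {1}))"
      by (rule indep_var_compose[OF indep_var_restrict[OF ind]]) auto
    then show ?thesis by (simp add: comp_def)
  qed
  have m[measurable]: "V \<in> borel_measurable M" "Z \<in> borel_measurable M" "N \<in> borel_measurable M"
    using measurable_compose[OF indep_var_rv1[OF iV] measurable_fst] indep_var_rv1[OF iZ] indep_var_rv2[OF iZ] by auto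
  have "distr M borel N = distr M lborel N" by (rule distr_cong) auto
  then have dN: "distr M borel N = std_normal_distribution" using N by (simp add: distributed_def)
  have ZN: "distr M borel Z \<Otimes>\<^sub>M std_normal_distribution = distr M (borel \<Otimes>\<^sub>M borel) (\<lambda>\<omega>. (Z \<omega>, N \<omega>))"
    using iZ unfolding indep_var_distribution_eq dN by simp
  let ?D = "distr M (borel \<Otimes>\<^sub>M borel) ?V" and ?R = "distr M (borel \<Otimes>\<^sub>M borel) (\<lambda>\<omega>. (Z \<omega>, N \<omega>))"
  have VZN: "?D \<Otimes>\<^sub>M ?R = distr M ((borel \<Otimes>\<^sub>M borel) \<Otimes>\<^sub>M (borel \<Otimes>\<^sub>M borel)) (\<lambda>\<omega>. (?V \<omega>, (Z \<omega>, N \<omega>)))"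
    using iV unfolding indep_var_distribution_eq by simp
  interpret DV: prob_space ?D by (rule prob_space_distr) simp
  interpret DZ: prob_space ?R by (rule prob_space_distr) simp
  interpret P: pair_prob_space ?D ?R ..
  define h where "h = (\<lambda>(v :: real \<times> real, r). f (c * (fst v / k) powr p * fst r + d * snd r))"
  have hm[measurable]: "h \<in> borel_measurable ((borel \<Otimes>\<^sub>M borel) \<Otimes>\<^sub>M (borel \<Otimes>\<^sub>M borel))" unfolding h_def by measurable
  have int: "integrable (?D \<Otimes>\<^sub>M ?R) h"
    by (rule P.integrable_const_bound[of _ B]) (use f(2) in \<open>auto simp: h_def\<close>)
  have "(\<integral>v. (\<integral>r. f (c * (v / k) powr p * fst r + d * snd r) \<partial>?R) \<partial>distr M borel V)
      = (\<integral>\<omega>. (\<integral>r. f (c * (V \<omega> / k) powr p * fst r + d * snd r) \<partial>?R) \<partial>M)"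
    by (rule integral_distr) measurable
  also have "\<dots> = (\<integral>v. (\<integral>r. h (v, r) \<partial>?R) \<partial>?D)"
    by (subst integral_distr) (auto simp: h_def)
  also have "\<dots> = (\<integral>x. h x \<partial>(?D \<Otimes>\<^sub>M ?R))"
    by (rule P.integral_fst'[OF int])
  also have "\<dots> = (\<integral>\<omega>. h (?V \<omega>, (Z \<omega>, N \<omega>)) \<partial>M)"
    unfolding VZN by (rule integral_distr) auto
  also have "\<dots> = (\<integral>\<omega>. f (c * (V \<omega> powr p * Z \<omega> / k powr p) + d * N \<omega>) \<partial>M)"
  proof (rule integral_cong_AE)
    show "AE \<omega> in M. h (?V \<omega>, (Z \<omega>, N \<omega>)) = f (c * (V \<omega> powr p * Z \<omega> / k powr p) + d * N \<omega>)"
      by (simp add: h_def powr_divide mult.assoc)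
  qed auto
  finally show ?thesis unfolding ZN .
qed

theorem theorem5:
  fixes lam mu \<alpha> qm qp x1 \<beta> :: real
    and M :: "'w measure" and M0 :: "'v measure" and M' :: "'u measure"
    and W1 W2 :: "real \<Rightarrow> 'w \<Rightarrow> real"
    and \<xi> :: "real \<Rightarrow> 'w \<Rightarrow> real" and \<xi>0 :: "'v \<Rightarrow> real"
    and X :: "real \<Rightarrow> real \<Rightarrow> 'w \<Rightarrow> real \<times> real"
    and \<tau> :: "real \<Rightarrow> 'w \<Rightarrow> ereal" and C :: "real \<Rightarrow> 'w set"
    and V N Z :: "'u \<Rightarrow> real"
  assumes "lam > 0" and "mu > 0"
    and "qm < x1" and "x1 < 0" and "0 < qp"
    and "prob_space M" and "prob_space M0" and "prob_space M'"
    and "standard_wiener M W1" and "standard_wiener M W2"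
    and "indep_elements M path_space (sample_path W1) path_space (sample_path W2)"
    and "\<And>\<epsilon>. \<epsilon> > 0 \<Longrightarrow>
      indep_elements M borel (\<xi> \<epsilon>) path_space (sample_path (\<lambda>t \<omega>. (W1 t \<omega>, W2 t \<omega>)))"
    and "\<xi>0 \<in> borel_measurable M0"
    and "weak_conv_along (at_right 0) (\<lambda>\<epsilon>. distr M borel (\<xi> \<epsilon>)) (distr M0 borel \<xi>0)"
    and "\<not> (AE \<omega> in M0. \<xi>0 \<omega> = 0)"
    and "\<And>\<epsilon>. \<epsilon> > 0 \<Longrightarrow>
      strong_solution M (\<lambda>(y1, y2). (lam * y1, - mu * y2)) \<epsilon> (\<lambda>t \<omega>. (W1 t \<omega>, W2 t \<omega>))
        (\<lambda>\<omega>. (x1, \<epsilon> powr \<alpha> * \<xi> \<epsilon> \<omega>)) (X \<epsilon>)"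
    and "\<And>\<epsilon>. \<epsilon> > 0 \<Longrightarrow> \<tau> \<epsilon> = hitting_time (\<lambda>t \<omega>. fst (X \<epsilon> t \<omega>)) {qm, qp}"
    and "\<And>\<epsilon>. \<epsilon> > 0 \<Longrightarrow>
      C \<epsilon> = {\<omega> \<in> space M. \<tau> \<epsilon> \<omega> < \<infinity> \<and> fst (X \<epsilon> (real_of_ereal (\<tau> \<epsilon> \<omega>)) \<omega>) = qp}"
    and "prob_space.indep_vars M' (\<lambda>_. borel) (\<lambda>i. [V, N, Z] ! i) {..<3}"
    and "distributed M' lborel V (exponential_density 1)"
    and "distributed M' lborel N std_normal_density"
    and "distr M' borel Z = distr M0 borel \<xi>0"
    and "\<beta> = min 1 (2 * mu / lam + \<alpha>)"
  shows "weak_conv_along (at_right 0)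
    (\<lambda>\<epsilon>. cond_law M (C \<epsilon>) (\<lambda>\<omega>. snd (X \<epsilon> (real_of_ereal (\<tau> \<epsilon> \<omega>)) \<omega>) / \<epsilon> powr \<beta>))
    (distr M' borel (\<lambda>\<omega>.
       of_bool (\<beta> = 2 * mu / lam + \<alpha>) *
         (V \<omega> powr (mu / lam) * Z \<omega> / (2 * lam * qp * \<bar>x1\<bar>) powr (mu / lam))
       + of_bool (\<beta> = 1) * (N \<omega> / sqrt (2 * mu))))"
proof -
  note lam = assms(1) and mu = assms(2) and q = assms(3-5) and W = assms(9,10) and i12 = assms(11)
    and i0 = assms(12) and sol = assms(16) and \<tau> = assms(17) and C = assms(18)
  interpret prob_space M by (rule assms(6))
  interpret M0: prob_space M0 by (rule assms(7))
  interpret M': prob_space M' by (rule assms(8))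
  have ne: "qm \<noteq> qp" using q by auto
  have \<xi>m: "\<xi> \<epsilon> \<in> borel_measurable M" if "0 < \<epsilon>" for \<epsilon> using i0[OF that] unfolding indep_elements_def by simp
  have Wm: "W1 t \<in> borel_measurable M" "W2 t \<in> borel_measurable M" if "0 \<le> t" for t
    using W that unfolding standard_wiener_def by auto
  have Vm[measurable]: "V \<in> borel_measurable M'" and Nm[measurable]: "N \<in> borel_measurable M'"
    using assms(20,21) by (auto simp: distributed_def)
  have Zm[measurable]: "Z \<in> borel_measurable M'"
  proof -
    have "\<forall>i\<in>{..<3}. [V, N, Z] ! i \<in> borel_measurable M'"
      using assms(19) unfolding M'.indep_vars_def by blast
    then have "[V, N, Z] ! 2 \<in> borel_measurable M'" by (rule bspec) simp
    then show ?thesis by simp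
  qed
  let ?\<rho>0 = "distr M0 borel \<xi>0" and ?\<nu>0 = "distr M' borel V"
  let ?L = "\<lambda>\<omega>. of_bool (\<beta> = 2 * mu / lam + \<alpha>) *
         (V \<omega> powr (mu / lam) * Z \<omega> / (2 * lam * qp * \<bar>x1\<bar>) powr (mu / lam))
       + of_bool (\<beta> = 1) * (N \<omega> / sqrt (2 * mu))"
  have \<rho>0: "real_distribution ?\<rho>0" by (rule M0.real_distribution_distr) (rule assms(13))
  have \<nu>0: "real_distribution ?\<nu>0" by (rule M'.real_distribution_distr) simp
  have cdfV: "cdf ?\<nu>0 v = 1 - exp (- v)" if "0 \<le> v" for v
  proof -
    have "cdf ?\<nu>0 v = M'.prob {\<omega>\<in>space M'. V \<omega> \<le> v}"
      unfolding cdf_def by (subst measure_distr) (auto intro!: arg_cong2[where f = measure])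
    also have "\<dots> = 1 - exp (- v * 1)" by (rule M'.exponential_distributedD_le[OF assms(20) that]) simp
    finally show ?thesis by simp
  qed
  have Vpos: "AE \<omega> in M'. 0 < V \<omega>"
  proof -
    have "M'.prob {\<omega>\<in>space M'. 0 < V \<omega>} = exp (- 0 * 1)" by (rule M'.exponential_distributedD_gt[OF assms(20)]) auto
    then have "AE \<omega> in M'. \<omega> \<in> {\<omega>\<in>space M'. 0 < V \<omega>}" by (subst M'.AE_in_set_eq_1) auto
    then show ?thesis by eventually_elim simp
  qed
  then have \<nu>pos: "AE v in ?\<nu>0. 0 < v" by (subst AE_distr_iff) auto
  show ?thesis
    unfolding weak_conv_along_at_right_0
  proof (intro allI impI, elim conjE)
    fix e :: "nat \<Rightarrow> real" assume e: "\<forall>n. 0 < e n" "e \<longlonglongrightarrow> 0"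
    then have ep: "0 < e n" for n by simp
    let ?X1 = "\<lambda>n t \<omega>. fst (X (e n) t \<omega>)" and ?X2 = "\<lambda>n t \<omega>. snd (X (e n) t \<omega>)"
    note comp = strong_solution_components[OF Wm borel_measurable_times[OF borel_measurable_const \<xi>m[OF ep]] sol[OF ep]]
    have weak: "weak_conv_m (\<lambda>n. distr M borel (\<xi> (e n))) ?\<rho>0"
    proof (rule iffD1[OF weak_conv_along_sequentially])
      show "real_distribution (distr M borel (\<xi> (e n)))" for n by (rule real_distribution_distr[OF \<xi>m[OF ep]])
      show "weak_conv_along sequentially (\<lambda>n. distr M borel (\<xi> (e n))) ?\<rho>0"
        using assms(14) e unfolding weak_conv_along_at_right_0 by blast
    qed (rule \<rho>0)
    show "weak_conv_along sequentially
      (\<lambda>n. cond_law M (C (e n)) (\<lambda>\<omega>. snd (X (e n) (real_of_ereal (\<tau> (e n) \<omega>)) \<omega>) / e n powr \<beta>)) (distr M' borel ?L)"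
      unfolding weak_conv_along_def
    proof (intro allI impI, elim conjE)
      fix f :: "real \<Rightarrow> real" assume f: "continuous_on UNIV f" "bounded (range f)"
      then obtain B where B: "\<And>x. \<bar>f x\<bar> \<le> B" by (auto simp: bounded_iff)
      have fm[measurable]: "f \<in> borel_measurable borel" by (rule borel_measurable_continuous_onI[OF f(1)])
      have kc: "2 * lam * \<bar>x1\<bar> * qp = 2 * lam * qp * \<bar>x1\<bar>" by simp
      note lim = conditional_exit_limit[where \<xi> = "\<lambda>n. \<xi> (e n)", OF W i12 i0[OF ep] comp(1) comp(3) comp(2) comp(4)
        lam mu q ep e(2) \<rho>0 weak \<nu>0 cdfV \<nu>pos f(1) B assms(23)]
      have lhs: "(\<integral>x. f x \<partial>cond_law M (C (e n)) (\<lambda>\<omega>. snd (X (e n) (real_of_ereal (\<tau> (e n) \<omega>)) \<omega>) / e n powr \<beta>))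
          = (\<integral>\<omega>. f (1 / e n powr \<beta> * ?X2 n (real_of_ereal (hitting_time (?X1 n) {qm, qp} \<omega>)) \<omega>)
              \<partial>uniform_measure M {\<omega>\<in>space M. hitting_time (?X1 n) {qm, qp} \<omega> < \<infinity> \<and> ?X1 n (real_of_ereal (hitting_time (?X1 n) {qm, qp} \<omega>)) \<omega> = qp})" for n
      proof -
        have [measurable]: "(\<lambda>\<omega>. ?X2 n (real_of_ereal (hitting_time (?X1 n) {qm, qp} \<omega>)) \<omega>) \<in> borel_measurable M"
          by (rule path_evaluation_measurable[OF comp(2) hitting_time_measurable(2)[OF comp(1) ne] hitting_time_nonneg])
        show ?thesis unfolding cond_law_def C[OF ep] \<tau>[OF ep]
          by (subst integral_distr) simp_all
      qed
      have rhs: "(\<integral>v. (\<integral>r. f (of_bool (\<beta> = 2 * mu / lam + \<alpha>) * (v / (2 * lam * \<bar>x1\<bar> * qp)) powr (mu / lam) * fst r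
          + of_bool (\<beta> = 1) * (1 / sqrt (2 * mu)) * snd r) \<partial>(?\<rho>0 \<Otimes>\<^sub>M std_normal_distribution)) \<partial>?\<nu>0)
          = (\<integral>x. f x \<partial>distr M' borel ?L)"
      proof -
        have "(\<integral>v. (\<integral>r. f (of_bool (\<beta> = 2 * mu / lam + \<alpha>) * (v / (2 * lam * \<bar>x1\<bar> * qp)) powr (mu / lam) * fst r
          + of_bool (\<beta> = 1) * (1 / sqrt (2 * mu)) * snd r) \<partial>(?\<rho>0 \<Otimes>\<^sub>M std_normal_distribution)) \<partial>?\<nu>0)
          = (\<integral>\<omega>. f (of_bool (\<beta> = 2 * mu / lam + \<alpha>) * (V \<omega> powr (mu / lam) * Z \<omega> / (2 * lam * \<bar>x1\<bar> * qp) powr (mu / lam))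
              + of_bool (\<beta> = 1) * (1 / sqrt (2 * mu)) * N \<omega>) \<partial>M')"
          unfolding assms(22)[symmetric]
          by (rule M'.limit_law_integral[OF assms(19) assms(21) f(1) B])
        also have "\<dots> = (\<integral>\<omega>. f (?L \<omega>) \<partial>M')" unfolding kc by simp
        also have "\<dots> = (\<integral>x. f x \<partial>distr M' borel ?L)" by (rule integral_distr[symmetric]) auto
        finally show ?thesis .
      qed
      show "(\<lambda>n. \<integral>x. f x \<partial>cond_law M (C (e n)) (\<lambda>\<omega>. snd (X (e n) (real_of_ereal (\<tau> (e n) \<omega>)) \<omega>) / e n powr \<beta>))
          \<longlonglongrightarrow> (\<integral>x. f x \<partial>distr M' borel ?L)"
        using lim unfolding lhs rhs .
    qed
  qed
qed

end
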